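(* For every $\lambda\in\Lambda$, the polynomial $\overline R_\lambda$ is an eigenvector of both differential operators $\overline X(t)$ and $\overline Y(t)$. More precisely, $$\overline X(t)\overline R_\lambda=\prod_{1\le i\le n,\ i\text{ odd}}(t+\rho_i+\lambda_i)\,\overline R_\lambda,\qquad \overline Y(t)\overline R_\lambda=\prod_{1\le i\le n,\ i\text{ even}}(t+\rho_i+\lambda_i)\,\overline R_\lambda .$$
   Context: Let $k$ be a field of characteristic zero, $n\ge 1$, $\mathcal P=k[z_1,\dots,z_n]$, and let $W\subseteq S_n$ be the group of permutations $\pi$ with $\pi(i)\equiv i \bmod 2$ for all $i$, acting by permuting variables. Put $\underline n=\lfloor n/2\rfloor$, $\overline n=\lceil n/2\rceil$. $\Lambda$ is the set of integer tuples $\lambda=(\lambda_1\ge\dots\ge\lambda_n\ge 0)$ and $|\lambda|_{\rm odd}=\sum_{i\text{ odd}}\lambda_i$. Fix $r\in k$ which is not a negative rational number and put $\rho_i=(n-i)r$, $\rho=(\rho_1,\dots,\rho_n)$. For $\lambda\in\Lambda$ let $[\lambda]_m=\lambda_m-\lambda_{m+1}+\dots+(-1)^{n-m}\lambda_n$. $R_\lambda(z;r)\in\mathcal P^W$ is the unique $W$-invariant polynomial of degree $|\lambda|_{\rm odd}$ which satisfies $R_\lambda(\rho+\mu)=0$ for all $\mu\in\Lambda$ with $|\mu|_{\rm odd}\le|\lambda|_{\rm odd}$, $\mu\ne\lambda$, and in which the monomial $z^{[\lambda]}$ has coefficient $1$ (it is known that this exists and is unique). $\overline R_\lambda=\overline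 R_\lambda(z;r)$ is the homogeneous component of highest degree (i.e. of degree $|\lambda|_{\rm odd}$) of $R_\lambda(z;r)$. Write $x_i=z_{2i-1}$ ($1\le i\le\overline n$), $y_i=z_{2i}$ ($1\le i\le\underline n$), $\partial_{x_i}=\partial/\partial x_i$, $\partial_{y_i}=\partial/\partial y_i$; $t$ is an indeterminate. Let $$\overline{\mathfrak X}(t)=\begin{pmatrix}\big[x_i^{\overline n-j}(x_i\partial_{x_i}+(\overline n-j)r+t)\big]_{i\le\overline n,\,j\le\overline n}&\big[-x_i^{\overline n-j}\big]_{i\le\overline n,\,j\le\underline n}\\ \big[y_i^{\underline n-j}(y_i\partial_{y_i}+(\underline n+1-j)r)\big]_{i\le\underline n,\,j\le\overline n}&\big[y_i^{\underline n-j}\big]_{i\le\underline n,\,j\le\underline n}\end{pmatrix},$$ $$\overline{\mathfrak Y}(t)=\begin{pmatrix}\big[x_i^{\overline n-j}\big]_{i\le\overline n,\,j\le\overline n}&\big[x_i^{\overline n-j-1}(x_i\partial_{x_i}+(\overline n-j)r)\big]_{i\le\overline n,\,j\le\underline n}\\ \big[-y_i^{\underline n+1-j}\big]_{i\le\underline n,\,j\le\overline n}&\big[y_i^{\underline n-j}(y_i\partial_{y_i}+(\underline n-j)r+t)\big]_{i\le\underline n,\,j\le\underline n}\end{pmatrix}$$ (row index $i$, column index $j$, both starting at $1$ in each block). Entries in different rows commute, so determinants are well defined. Let $\varphi(z)=\prod_{1\le i<j\le n,\ j-i\text{ even}}(z_i-z_j)$ and $\overline X(t)=\varphi(z)^{-1}\det\overline{\mathfrak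 X}(t)$, $\overline Y(t)=\varphi(z)^{-1}\det\overline{\mathfrak Y}(t)$; these are linear differential operators with rational coefficients. *)

theory Defs
  imports
    "HOL-Library.Poly_Mapping"
    "HOL-Computational_Algebra.Polynomial"
    "HOL-Computational_Algebra.Fraction_Field"
    "HOL-Combinatorics.Permutations"
begin

section \<open>The polynomial ring\<close>

text \<open>
  The type below is the polynomial ring over \<open>'k\<close> in countably many variables
  \<open>zvar 0, zvar 1, zvar 2, \<dots>\<close>: an exponent vector is mapped to its coefficient. The ring
  \<open>k[z\<^sub>1,\<dots>,z\<^sub>n]\<close> is the subset \<open>polys n\<close>.
\<close>

type_synonym 'k mpol = "(nat \<Rightarrow>\<^sub>0 nat) \<Rightarrow>\<^sub>0 'k"

definition polys :: "nat \<Rightarrow> 'k::zero mpol set"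
  where "polys n = {f. \<forall>m \<in> Poly_Mapping.keys f. Poly_Mapping.keys m \<subseteq> {1..n}}"

definition zvar :: "nat \<Rightarrow> 'k::comm_ring_1 mpol"
  where "zvar i = Poly_Mapping.single (Poly_Mapping.single i 1) 1"

definition const :: "'k::zero \<Rightarrow> 'k mpol"
  where "const c = Poly_Mapping.single 0 c"

definition eval_at :: "(nat \<Rightarrow> 'k) \<Rightarrow> 'k::comm_ring_1 mpol \<Rightarrow> 'k"
  where "eval_at a f =
    (\<Sum>m \<in> Poly_Mapping.keys f.
       Poly_Mapping.lookup f m * (\<Prod>i \<in> Poly_Mapping.keys m. a i ^ Poly_Mapping.lookup m i))"

definition mon_degree :: "(nat \<Rightarrow>\<^sub>0 nat) \<Rightarrow> nat"
  where "mon_degree m = (\<Sum>i \<in> Poly_Mapping.keys m. Poly_Mapping.lookup m i)"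

definition total_degree :: "'k::zero mpol \<Rightarrow> nat"
  where "total_degree f = Max (insert 0 (mon_degree ` Poly_Mapping.keys f))"

definition hom_component :: "nat \<Rightarrow> 'k::comm_ring_1 mpol \<Rightarrow> 'k mpol"
  where "hom_component d f =
    (\<Sum>m \<in> {m \<in> Poly_Mapping.keys f. mon_degree m = d}.
       Poly_Mapping.single m (Poly_Mapping.lookup f m))"

definition top_component :: "'k::comm_ring_1 mpol \<Rightarrow> 'k mpol"
  where "top_component f = hom_component (total_degree f) f"

text \<open>
  If \<open>m\<close> does not contain \<open>zvar i\<close>, the truncated exponent \<open>m - single i 1\<close> is
  harmless because the coefficient is zero.
\<close>

definition pdiff :: "nat \<Rightarrow> 'k::comm_ring_1 mpol \<Rightarrow> 'k mpol"
  where "pdiff i f =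
    (\<Sum>m \<in> Poly_Mapping.keys f.
       Poly_Mapping.single (m - Poly_Mapping.single i 1)
         (of_nat (Poly_Mapping.lookup m i) * Poly_Mapping.lookup f m))"

definition parity_perms :: "nat \<Rightarrow> (nat \<Rightarrow> nat) set"
  where "parity_perms n = {\<pi>. \<pi> permutes {1..n} \<and> (\<forall>i \<in> {1..n}. \<pi> i mod 2 = i mod 2)}"

text \<open>
  \<open>perm_vars \<pi>\<close> is the substitution \<open>zvar i \<mapsto> zvar (\<pi> i)\<close>: the coefficient of \<open>m\<close> in
  \<open>perm_vars \<pi> f\<close> is the coefficient of \<open>m \<circ> \<pi>\<close> in \<open>f\<close>.
\<close>

definition perm_vars :: "(nat \<Rightarrow> nat) \<Rightarrow> 'k::zero mpol \<Rightarrow> 'k mpol"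
  where "perm_vars \<pi> f = Poly_Mapping.map_key (Poly_Mapping.map_key \<pi>) f"

definition invariants :: "nat \<Rightarrow> 'k::zero mpol set"
  where "invariants n = {f \<in> polys n. \<forall>\<pi> \<in> parity_perms n. perm_vars \<pi> f = f}"

section \<open>The polynomials \<open>R\<^sub>\<lambda>\<close>\<close>

text \<open>
  Tuples are functions on all of \<open>nat\<close>, made zero outside \<open>{1..n}\<close> so that equality of
  functions is equality of tuples.
\<close>

definition Lam :: "nat \<Rightarrow> (nat \<Rightarrow> nat) set"
  where "Lam n = {l. (\<forall>i \<in> {1..<n}. l (Suc i) \<le> l i) \<and> (\<forall>i. i \<notin> {1..n} \<longrightarrow> l i = 0)}"

definition odd_size :: "nat \<Rightarrow> (nat \<Rightarrow> nat) \<Rightarrow> nat"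
  where "odd_size n l = (\<Sum>i \<in> {i \<in> {1..n}. odd i}. l i)"

definition rho :: "nat \<Rightarrow> 'k::comm_ring_1 \<Rightarrow> nat \<Rightarrow> 'k"
  where "rho n r i = of_nat (n - i) * r"

definition bracket :: "nat \<Rightarrow> (nat \<Rightarrow> nat) \<Rightarrow> nat \<Rightarrow> int"
  where "bracket n l m = (\<Sum>i = m..n. (-1) ^ (i - m) * int (l i))"

text \<open>
  The exponent vector \<open>[\<lambda>]\<close>; \<open>nat\<close> does not truncate since \<open>bracket n l m \<ge> 0\<close> for
  \<open>l \<in> Lam n\<close>.
\<close>

definition bracket_mon :: "nat \<Rightarrow> (nat \<Rightarrow> nat) \<Rightarrow> nat \<Rightarrow>\<^sub>0 nat"
  where "bracket_mon n l = (\<Sum>m = 1..n. Poly_Mapping.single m (nat (bracket n l m)))"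

text \<open>
  \<open>is_R n r l R\<close> is the characterization defining \<open>R = R\<^sub>\<lambda>(z;r)\<close> for \<open>\<lambda> = l\<close>; for
  \<open>l \<in> Lam n\<close> and \<open>r\<close> not a negative rational it is satisfied by exactly one \<open>R\<close>.
\<close>

definition is_R :: "nat \<Rightarrow> 'k::comm_ring_1 \<Rightarrow> (nat \<Rightarrow> nat) \<Rightarrow> 'k mpol \<Rightarrow> bool"
  where "is_R n r l R \<longleftrightarrow>
    R \<in> invariants n \<and>
    total_degree R = odd_size n l \<and>
    (\<forall>\<mu> \<in> Lam n. odd_size n \<mu> \<le> odd_size n l \<longrightarrow> \<mu> \<noteq> l \<longrightarrow>
       eval_at (\<lambda>i. rho n r i + of_nat (\<mu> i)) R = 0) \<and>
    Poly_Mapping.lookup R (bracket_mon n l) = 1"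

section \<open>The differential operators\<close>

text \<open>
  The indeterminate \<open>t\<close> is the variable of the type constructor \<open>poly\<close>: operators act
  \<open>t\<close>-linearly on \<open>k[z][t]\<close>.
\<close>

type_synonym 'k diffop = "'k mpol poly \<Rightarrow> 'k mpol poly"

definition diff_op :: "nat \<Rightarrow> 'k::comm_ring_1 diffop"
  where "diff_op i = map_poly (pdiff i)"

definition t_op :: "'k::comm_ring_1 diffop"
  where "t_op F = [:0, 1:] * F"

text \<open>
  \<open>shifted_op i e r\<close> is the operator \<open>z\<^sub>i\<^sup>e\<^sup>-\<^sup>1 (z\<^sub>i \<partial>\<^sub>i + e r) = z\<^sub>i\<^sup>e \<partial>\<^sub>i + e r z\<^sub>i\<^sup>e\<^sup>-\<^sup>1\<close>.
  It is written in expanded form because \<open>e = 0\<close> occurs in the last column of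
  the block (for odd \<open>n\<close> in \<open>X_mat\<close>, for even \<open>n\<close> in \<open>Y_mat\<close>); there
  \<open>z\<^sub>i\<^sup>-\<^sup>1 (z\<^sub>i \<partial>\<^sub>i) = \<partial>\<^sub>i\<close>.
\<close>

definition shifted_op :: "nat \<Rightarrow> nat \<Rightarrow> 'k::comm_ring_1 \<Rightarrow> 'k diffop"
  where "shifted_op i e r F =
    smult (zvar i ^ e) (diff_op i F) + smult (const (of_nat e * r) * zvar i ^ (e - 1)) F"

text \<open>
  \<open>euler_op i e c\<close> is the operator \<open>z\<^sub>i\<^sup>e (z\<^sub>i \<partial>\<^sub>i + c + t)\<close>.
\<close>

definition euler_op :: "nat \<Rightarrow> nat \<Rightarrow> 'k::comm_ring_1 \<Rightarrow> 'k diffop"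
  where "euler_op i e c F =
    smult (zvar i ^ e) (smult (zvar i) (diff_op i F) + smult (const c) F + t_op F)"

definition mult_op :: "'k::comm_ring_1 mpol \<Rightarrow> 'k diffop"
  where "mult_op f F = smult f F"

definition upper_half :: "nat \<Rightarrow> nat"
  where "upper_half n = (n + 1) div 2"

definition lower_half :: "nat \<Rightarrow> nat"
  where "lower_half n = n div 2"

text \<open>
  Block matrix with upper left block \<open>A\<close> of size \<open>a \<times> a\<close>; the indices of the matrix
  and of each block start at \<open>1\<close>.
\<close>

definition block_mat ::
    "nat \<Rightarrow> (nat \<Rightarrow> nat \<Rightarrow> 'b) \<Rightarrow> (nat \<Rightarrow> nat \<Rightarrow> 'b) \<Rightarrow> (nat \<Rightarrow> nat \<Rightarrow> 'b) \<Rightarrow>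
     (nat \<Rightarrow> nat \<Rightarrow> 'b) \<Rightarrow> nat \<Rightarrow> nat \<Rightarrow> 'b"
  where "block_mat a A B C D p q =
    (if p \<le> a then (if q \<le> a then A p q else B p (q - a))
     else (if q \<le> a then C (p - a) q else D (p - a) (q - a)))"

text \<open>The variables are \<open>x\<^sub>i = zvar (2 * i - 1)\<close> and \<open>y\<^sub>i = zvar (2 * i)\<close>.\<close>

definition X_mat :: "nat \<Rightarrow> 'k::comm_ring_1 \<Rightarrow> nat \<Rightarrow> nat \<Rightarrow> 'k diffop"
  where "X_mat n r = (let a = upper_half n; b = lower_half n in block_mat a
     (\<lambda>i j. euler_op (2 * i - 1) (a - j) (of_nat (a - j) * r))
     (\<lambda>i j. mult_op (- (zvar (2 * i - 1) ^ (a - j))))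
     (\<lambda>i j. shifted_op (2 * i) (b + 1 - j) r)
     (\<lambda>i j. mult_op (zvar (2 * i) ^ (b - j))))"

definition Y_mat :: "nat \<Rightarrow> 'k::comm_ring_1 \<Rightarrow> nat \<Rightarrow> nat \<Rightarrow> 'k diffop"
  where "Y_mat n r = (let a = upper_half n; b = lower_half n in block_mat a
     (\<lambda>i j. mult_op (zvar (2 * i - 1) ^ (a - j)))
     (\<lambda>i j. shifted_op (2 * i - 1) (a - j) r)
     (\<lambda>i j. mult_op (- (zvar (2 * i) ^ (b + 1 - j))))
     (\<lambda>i j. euler_op (2 * i) (b - j) (of_nat (b - j) * r)))"

text \<open>
  Determinant of an \<open>n \<times> n\<close> matrix of operators. The product of the chosen entries is
  composition in the order of the rows; the order does not matter if entries in
  different rows commute.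
\<close>

definition det_op :: "nat \<Rightarrow> (nat \<Rightarrow> nat \<Rightarrow> 'k::comm_ring_1 diffop) \<Rightarrow> 'k diffop"
  where "det_op n M F =
    (\<Sum>\<pi> \<in> {\<pi>. \<pi> permutes {1..n}}.
       of_int (sign \<pi>) * foldr (\<lambda>p. M p (\<pi> p)) [1..<Suc n] F)"

definition vandermonde :: "nat \<Rightarrow> 'k::comm_ring_1 mpol"
  where "vandermonde n =
    (\<Prod>(i, j) \<in> {(i, j). 1 \<le> i \<and> i < j \<and> j \<le> n \<and> even (j - i)}. zvar i - zvar j)"

definition to_frac :: "'k::field mpol \<Rightarrow> 'k mpol fract"
  where "to_frac f = Fract f 1"

text \<open>
  The operators with rational coefficients, as maps from \<open>k[z][t]\<close> to \<open>k(z)[t]\<close>.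
\<close>

definition X_op :: "nat \<Rightarrow> 'k::field \<Rightarrow> 'k mpol poly \<Rightarrow> 'k mpol fract poly"
  where "X_op n r F =
    smult (inverse (to_frac (vandermonde n))) (map_poly to_frac (det_op n (X_mat n r) F))"

definition Y_op :: "nat \<Rightarrow> 'k::field \<Rightarrow> 'k mpol poly \<Rightarrow> 'k mpol fract poly"
  where "Y_op n r F =
    smult (inverse (to_frac (vandermonde n))) (map_poly to_frac (det_op n (Y_mat n r) F))"

end

theory Submission
  imports Defs "Jordan_Normal_Form.Determinant"
begin

text \<open>
  Why the theorem is true. The operators \<open>X(t)\<close> and \<open>Y(t)\<close> are the leading parts of two
  difference operators. Each row of their matrices involves a single variable \<open>z\<close>, and each
  entry is the leading part of some \<open>P - Q T\<close>, where \<open>P\<close> and \<open>Q\<close> are polynomials in \<open>z\<close>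
  and \<open>T\<close> is the shift \<open>z \<mapsto> z - 1\<close>. Expanding the determinant of these difference
  operators gives \<open>\<Sum>\<^sub>I C\<^sub>I T\<^sub>I\<close> over the sets \<open>I\<close> of variables, \<open>T\<^sub>I\<close> being the shift of
  all variables in \<open>I\<close> (\<open>diff_det_expand\<close>). The polynomials \<open>P\<close> and \<open>Q\<close> are chosen such that, at a
  node \<open>\<rho> + \<mu>\<close> with \<open>\<mu> \<in> \<Lambda>\<close>, the coefficient \<open>C\<^sub>I\<close> vanishes unless \<open>\<mu>\<close> lowered by one on
  \<open>I\<close> is again in \<open>\<Lambda>\<close>: if it is not, then two rows of the determinant are proportional, or one
  row is zero. If \<open>I\<close> is nonempty and has only even elements, \<open>C\<^sub>I\<close> vanishes because too many rows
  lie in too small a space. Finally, \<open>C\<^sub>\<emptyset>\<close> at a node is the Vandermonde product times the expected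
  eigenvalue.

  So let \<open>F\<close> be semisymmetric (invariant under permutations preserving parity), of degree at most \<open>|\<lambda>|\<^sub>o\<^sub>d\<^sub>d\<close>, and zero at all nodes \<open>\<rho> + \<mu>\<close> with
  \<open>|\<mu>|\<^sub>o\<^sub>d\<^sub>d \<le> |\<lambda>|\<^sub>o\<^sub>d\<^sub>d\<close>, \<open>\<mu> \<noteq> \<lambda>\<close>. The determinant applied to \<open>F\<close> is antisymmetric, hence
  divisible by the Vandermonde product. At each of these nodes and at \<open>\<rho> + \<lambda>\<close>, the quotient agrees with the
  eigenvalue at \<open>\<lambda>\<close> times \<open>F\<close>. Semisymmetric polynomials of bounded degree are determined by
  such values (\<open>semisym_eq_0\<close>), so the determinant multiplies \<open>F\<close> by the eigenvalue and the Vandermonde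
  product (\<open>eigenvector\<close>). Comparing leading forms gives the assertion for \<open>X(t)\<close> and
  \<open>Y(t)\<close> (\<open>sym_det_eigen\<close>).

  This divides by the value of the Vandermonde product at a node, and that value may be zero for
  \<open>r = 0\<close>. Therefore the argument is carried out over the domain \<open>k[\<epsilon>]\<close> with \<open>r + \<epsilon>\<close> in the place of
  \<open>r\<close>, and then \<open>\<epsilon>\<close> is set to zero. A suitable \<open>F\<close> over \<open>k[\<epsilon>]\<close> which does not vanish
  at \<open>\<epsilon> = 0\<close> comes from linear algebra (\<open>vanishing_family\<close>): there are as many orbit sums as
  nodes, and one node is free. At \<open>\<epsilon> = 0\<close>, uniqueness makes \<open>F\<close> proportional to \<open>R\<^sub>\<lambda>\<close>.
\<close>

section \<open>Substitution homomorphisms\<close>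

abbreviation lookup where "lookup \<equiv> Poly_Mapping.lookup"
abbreviation keys where "keys \<equiv> Poly_Mapping.keys"
abbreviation single where "single \<equiv> Poly_Mapping.single"

definition mon_val :: "(nat \<Rightarrow> 'b::comm_ring_1) \<Rightarrow> (nat \<Rightarrow>\<^sub>0 nat) \<Rightarrow> 'b"
  where "mon_val s m = (\<Prod>i \<in> keys m. s i ^ lookup m i)"

text \<open>
  The coefficients are mapped by \<open>h\<close> and the variables by \<open>s\<close>. Evaluation at a point, substitution
  of polynomials, permutation and shift of variables, and change of the coefficient ring are all
  instances, so that one proof of multiplicativity serves them all.
\<close>

definition hsubst :: "('a::comm_ring_1 \<Rightarrow> 'b::comm_ring_1) \<Rightarrow> (nat \<Rightarrow> 'b) \<Rightarrow> 'a mpol \<Rightarrow> 'b"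
  where "hsubst h s f =
    (\<Sum>m \<in> keys f. h (lookup f m) * mon_val s m)"

abbreviation subst :: "(nat \<Rightarrow> 'a::comm_ring_1 mpol) \<Rightarrow> 'a mpol \<Rightarrow> 'a mpol"
  where "subst \<equiv> hsubst const"

lemma mon_val_superset:
  assumes "finite S" "keys m \<subseteq> S"
  shows "mon_val s m = (\<Prod>i \<in> S. s i ^ lookup m i)"
  unfolding mon_val_def
  by (rule prod.mono_neutral_left) (use assms in \<open>auto simp: in_keys_iff\<close>)

lemma mon_val_0 [simp]: "mon_val s 0 = 1"
  by (simp add: mon_val_def)

lemma mon_val_add: "mon_val s (m + m') = mon_val s m * mon_val s m'"
proof -
  let ?S = "keys m \<union> keys m'"
  have "mon_val s (m + m') = (\<Prod>i \<in> ?S. s i ^ lookup (m + m') i)"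
    by (rule mon_val_superset) (auto simp: Poly_Mapping.keys_add)
  also have "\<dots> = mon_val s m * mon_val s m'"
    by (simp add: mon_val_superset[of ?S] lookup_add power_add prod.distrib)
  finally show ?thesis .
qed

lemma mon_val_single: "mon_val s (single i k) = s i ^ k"
  by (simp add: mon_val_superset[of "{i}"])

lemma mpol_expand: "f = (\<Sum>m \<in> keys f. single m (lookup f m))"
  by (rule poly_mapping_eqI)
    (auto simp: lookup_sum lookup_single when_def in_keys_iff)

lemma monom_expand: "m = (\<Sum>i \<in> keys m. single i (lookup m i))"
  for m :: "nat \<Rightarrow>\<^sub>0 nat"
  by (rule poly_mapping_eqI)
    (auto simp: lookup_sum lookup_single when_def in_keys_iff)

lemma const_hom: "comm_ring_hom (const :: 'a::comm_ring_1 \<Rightarrow> 'a mpol)"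
  by standard (auto simp: const_def single_add mult_single)

interpretation const: comm_ring_hom "const :: 'a::comm_ring_1 \<Rightarrow> 'a mpol"
  by (rule const_hom)

lemma const_eq_iff [simp]: "const c = const d \<longleftrightarrow> c = d"
  by (metis const_def lookup_single_eq)

lemma const_eq_0_iff [simp]: "const c = 0 \<longleftrightarrow> c = 0" for c :: "'a::comm_ring_1"
  using const_eq_iff[of c 0] by (simp only: const.hom_zero)

lemma zvar_power: "zvar i ^ k = single (single i k) 1"
  by (induction k) (auto simp: zvar_def mult_single simp flip: single_add)

lemma mon_val_zvar: "mon_val zvar m = single m 1"
proof -
  have "(\<Prod>i\<in>S. zvar i ^ g i) = single (\<Sum>i\<in>S. single i (g i)) 1"
    if "finite S" for S :: "nat set" and g
    using that by (induction S) (auto simp: zvar_power mult_single)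
  from this[of "keys m" "lookup m"] show ?thesis
    unfolding mon_val_def monom_expand[of m, symmetric] by simp
qed

lemma single_eq: "single m c = const c * mon_val zvar m"
  by (simp add: mon_val_zvar const_def mult_single)

lemma mpol_expand_zvar:
  "f = (\<Sum>m \<in> keys f. const (lookup f m) * mon_val zvar m)"
  unfolding single_eq[symmetric] by (rule mpol_expand)

lemma mpol_induct [case_names const zvar add mult]:
  assumes c: "\<And>c. P (const c)" and z: "\<And>i. P (zvar i)"
    and a: "\<And>f g. P f \<Longrightarrow> P g \<Longrightarrow> P (f + g)"
    and m: "\<And>f g. P f \<Longrightarrow> P g \<Longrightarrow> P (f * g)"
  shows "P (f :: 'a::comm_ring_1 mpol)"
proof -
  have 0: "P 0" "P 1" using c[of 0] c[of 1] by simp_all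
  have pw: "P (zvar i ^ k)" for i k by (induction k) (auto intro: z m 0)
  have pr: "P (\<Prod>i\<in>S. zvar i ^ g i)" if "finite S" for S :: "nat set" and g
    using that by (induction S) (auto intro: m 0 pw)
  have "P (\<Sum>m \<in> S. const (k m) * mon_val zvar m)" if "finite S" for S k
    using that by (induction S) (auto intro!: 0 a m c pr simp: mon_val_def)
  then show ?thesis by (subst mpol_expand_zvar) auto
qed

lemma hsubst_hom:
  assumes "comm_ring_hom h"
  shows "comm_ring_hom (hsubst h s)"
proof -
  interpret comm_ring_hom h by fact
  have sup: "hsubst h s f = (\<Sum>m \<in> S. h (lookup f m) * mon_val s m)"
    if "finite S" "keys f \<subseteq> S" for f S
    unfolding hsubst_def
    by (rule sum.mono_neutral_left) (use that in \<open>auto simp: in_keys_iff\<close>)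
  have add: "hsubst h s (f + g) = hsubst h s f + hsubst h s g" for f g
  proof -
    let ?S = "keys f \<union> keys g"
    show ?thesis
      by (subst (1 2 3) sup[of ?S])
        (auto simp: Poly_Mapping.keys_add lookup_add hom_add distrib_right sum.distrib)
  qed
  have zero: "hsubst h s 0 = 0" by (simp add: hsubst_def)
  have sum: "hsubst h s (sum F S) = (\<Sum>x\<in>S. hsubst h s (F x))" if "finite S" for F and S :: "'c set"
    using that by (induction S) (auto simp: add zero)
  have sg: "hsubst h s (single m c) = h c * mon_val s m" for m c
    by (subst sup[of "{m}"]) auto
  have mult: "hsubst h s (f * g) = hsubst h s f * hsubst h s g" for f g
  proof -
    have "f * g = (\<Sum>m \<in> keys f. \<Sum>m' \<in> keys g.
        single (m + m') (lookup f m * lookup g m'))"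
      by (subst (1) mpol_expand[of f], subst (1) mpol_expand[of g])
        (simp add: sum_product mult_single)
    then show ?thesis
      by (simp add: sum sg hom_mult mon_val_add) (simp add: hsubst_def sum_product mult_ac)
  qed
  show ?thesis
    by standard (auto simp: add mult zero sg simp flip: single_one)
qed

lemma hsubst_const [simp]:
  assumes "comm_ring_hom h"
  shows "hsubst h s (const c) = h c"
proof -
  interpret comm_ring_hom h by fact
  show ?thesis by (cases "c = 0") (simp_all add: const_def hsubst_def)
qed

lemma hsubst_zvar [simp]: "comm_ring_hom h \<Longrightarrow> hsubst h s (zvar i) = s i"
proof -
  assume "comm_ring_hom h"
  then interpret comm_ring_hom h .
  show ?thesis by (simp add: zvar_def hsubst_def mon_val_single)
qed

lemma subst_hom: "comm_ring_hom (subst s)"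
  by (rule hsubst_hom[OF const_hom])

interpretation subst: comm_ring_hom "subst s"
  by (rule subst_hom)

text \<open>
  An identity between ring homomorphisms need only be checked on constants and variables; this is
  how the rules for composition of substitutions are obtained.
\<close>

lemma hsubst_unique:
  assumes "comm_ring_hom h" and h': "comm_ring_hom h'"
    and "\<And>c. h' (const c) = h c" and "\<And>i. h' (zvar i) = s i"
  shows "h' f = hsubst h s f"
proof -
  interpret h': comm_ring_hom h' by fact
  interpret s: comm_ring_hom "hsubst h s" by (rule hsubst_hom) fact
  show ?thesis
    by (induction f rule: mpol_induct) (auto simp: assms h'.hom_add h'.hom_mult s.hom_add s.hom_mult)
qed

lemma comm_ring_hom_comp:
  "comm_ring_hom f \<Longrightarrow> comm_ring_hom g \<Longrightarrow> comm_ring_hom (\<lambda>x. f (g x))"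
proof -
  assume "comm_ring_hom f" "comm_ring_hom g"
  then interpret f: comm_ring_hom f + g: comm_ring_hom g .
  show ?thesis by standard (auto simp: f.hom_add g.hom_add f.hom_mult g.hom_mult)
qed

lemma hom_hsubst:
  assumes h: "comm_ring_hom h" and g: "comm_ring_hom g"
  shows "g (hsubst h s f) = hsubst (\<lambda>c. g (h c)) (\<lambda>i. g (s i)) f"
proof (rule hsubst_unique)
  show "comm_ring_hom (\<lambda>c. g (h c))" by (rule comm_ring_hom_comp[OF g h])
  show "comm_ring_hom (\<lambda>f. g (hsubst h s f))"
    by (rule comm_ring_hom_comp[OF g hsubst_hom[OF h]])
qed (simp_all add: h)

lemma hsubst_subst:
  assumes "comm_ring_hom h"
  shows "hsubst h s (subst s' f) = hsubst h (\<lambda>i. hsubst h s (s' i)) f"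
  by (subst hom_hsubst[OF const_hom hsubst_hom[OF assms]]) (simp add: assms)

lemma subst_subst: "subst s (subst s' f) = subst (\<lambda>i. subst s (s' i)) f"
  by (rule hsubst_subst[OF const_hom])

lemma id_hom: "comm_ring_hom (\<lambda>x::'a::comm_ring_1. x)"
  by standard auto

lemma subst_zvar_id [simp]: "subst zvar f = f"
  by (rule hsubst_unique[OF const_hom id_hom, symmetric]) simp_all

lemma hsubst_cong_polys:
  assumes "f \<in> polys n" "\<And>i. i \<in> {1..n} \<Longrightarrow> s i = s' i"
  shows "hsubst h s f = hsubst h s' f"
proof -
  have "mon_val s m = mon_val s' m" if "m \<in> keys f" for m
    unfolding mon_val_def
  proof (rule prod.cong)
    fix i assume "i \<in> keys m"
    then have "i \<in> {1..n}" using that assms(1) unfolding polys_def by blast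
    then show "s i ^ lookup m i = s' i ^ lookup m i"
      by (simp add: assms(2))
  qed simp
  then show ?thesis unfolding hsubst_def by simp
qed

lemma eval_at_eq: "eval_at a f = hsubst (\<lambda>x. x) a f"
  by (simp add: eval_at_def hsubst_def mon_val_def)

lemma eval_at_hom: "comm_ring_hom (eval_at a)"
  unfolding eval_at_eq[abs_def] by (rule hsubst_hom[OF id_hom])

interpretation eval_at: comm_ring_hom "eval_at a"
  by (rule eval_at_hom)

lemma eval_at_const [simp]: "eval_at a (const c) = c"
  by (simp add: eval_at_eq id_hom)

lemma eval_at_zvar [simp]: "eval_at a (zvar i) = a i"
  by (simp add: eval_at_eq id_hom)

lemma eval_at_subst: "eval_at a (subst s f) = eval_at (\<lambda>i. eval_at a (s i)) f"
  by (simp add: eval_at_eq hsubst_subst id_hom)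

lemma eval_at_cong_polys:
  "f \<in> polys n \<Longrightarrow> (\<And>i. i \<in> {1..n} \<Longrightarrow> a i = b i) \<Longrightarrow> eval_at a f = eval_at b f"
  unfolding eval_at_eq by (rule hsubst_cong_polys)

section \<open>The ring of polynomials in n variables\<close>

lemma polys_0 [simp]: "0 \<in> polys n" and polys_1 [simp]: "1 \<in> polys n"
  by (auto simp: polys_def)

lemma polys_add: "f \<in> polys n \<Longrightarrow> g \<in> polys n \<Longrightarrow> f + g \<in> polys n"
  using Poly_Mapping.keys_add[of f g] by (auto simp: polys_def)

lemma polys_mult: "f \<in> polys n \<Longrightarrow> g \<in> polys n \<Longrightarrow> f * g \<in> polys n"
  for f g :: "'a::comm_ring_1 mpol"
proof -
  assume f: "f \<in> polys n" and g: "g \<in> polys n"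
  have "keys m \<subseteq> {1..n}" if m: "m \<in> keys (f * g)" for m
  proof -
    from m keys_mult[of f g] obtain a b where
      ab: "m = a + b" "a \<in> keys f" "b \<in> keys g" by blast
    from f g ab(2,3) have "keys a \<subseteq> {1..n}" "keys b \<subseteq> {1..n}"
      unfolding polys_def by blast+
    then show ?thesis using Poly_Mapping.keys_add[of a b] ab(1) by blast
  qed
  then show ?thesis unfolding polys_def by blast
qed

lemma polys_const [simp]: "const c \<in> polys n"
  by (auto simp: polys_def const_def)

lemma polys_zvar: "i \<in> {1..n} \<Longrightarrow> zvar i \<in> polys n"
  by (auto simp: polys_def zvar_def split: if_splits)

lemma polys_uminus: "f \<in> polys n \<Longrightarrow> - f \<in> polys n" for f :: "'a::comm_ring_1 mpol"
  unfolding polys_def by simp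

lemma polys_diff: "f \<in> polys n \<Longrightarrow> g \<in> polys n \<Longrightarrow> f - g \<in> polys n" for f :: "'a::comm_ring_1 mpol"
  using polys_add[of f n "- g"] polys_uminus[of g n] by simp

lemma polys_sum: "(\<And>x. x \<in> S \<Longrightarrow> F x \<in> polys n) \<Longrightarrow> sum F S \<in> polys n"
  by (induction S rule: infinite_finite_induct) (auto intro: polys_add)

lemma polys_prod: "(\<And>x. x \<in> S \<Longrightarrow> F x \<in> polys n) \<Longrightarrow> prod F S \<in> polys n"
  for F :: "'c \<Rightarrow> 'a::comm_ring_1 mpol"
  by (induction S rule: infinite_finite_induct) (auto intro: polys_mult)

lemma polys_power: "f \<in> polys n \<Longrightarrow> f ^ k \<in> polys n" for f :: "'a::comm_ring_1 mpol"
  by (induction k) (auto intro: polys_mult)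

lemma polys_subst:
  assumes "f \<in> polys n" "\<And>i. i \<in> {1..n} \<Longrightarrow> s i \<in> polys k"
  shows "subst s f \<in> polys k"
  unfolding hsubst_def mon_val_def
proof (intro polys_sum polys_mult polys_prod polys_power polys_const)
  fix m i assume "m \<in> keys f" "i \<in> keys m"
  then have "i \<in> {1..n}" using assms(1) unfolding polys_def by blast
  then show "s i \<in> polys k" by (rule assms(2))
qed

section \<open>Degrees and leading forms\<close>

text \<open>
  Degree bounds are sets of integers, since an operator in the matrices may lower the degree: then
  bounds like \<open>d - 1\<close> make sense for \<open>d = 0\<close> as well.
\<close>

definition deg_in :: "int set \<Rightarrow> 'a::zero mpol \<Rightarrow> bool"
  where "deg_in D f \<longleftrightarrow> (\<forall>m \<in> keys f. int (mon_degree m) \<in> D)"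

lemma mon_degree_superset:
  "finite S \<Longrightarrow> keys m \<subseteq> S \<Longrightarrow> mon_degree m = (\<Sum>i\<in>S. lookup m i)"
  unfolding mon_degree_def
  by (rule sum.mono_neutral_left) (auto simp: in_keys_iff)

lemma mon_degree_add: "mon_degree (m + m') = mon_degree m + mon_degree m'"
proof -
  let ?S = "keys m \<union> keys m'"
  have "mon_degree (m + m') = (\<Sum>i\<in>?S. lookup (m + m') i)"
    by (rule mon_degree_superset) (auto simp: Poly_Mapping.keys_add)
  also have "\<dots> = mon_degree m + mon_degree m'"
    by (simp add: mon_degree_superset[of ?S] lookup_add sum.distrib)
  finally show ?thesis .
qed

lemma mon_degree_single: "mon_degree (single i k) = k"
  by (simp add: mon_degree_superset[of "{i}"])

lemma mon_degree_0: "mon_degree 0 = 0"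
  by (simp add: mon_degree_def)

lemma deg_in_0 [simp]: "deg_in D 0"
  by (simp add: deg_in_def)

lemma deg_in_mono: "deg_in D f \<Longrightarrow> D \<subseteq> E \<Longrightarrow> deg_in E f"
  by (auto simp: deg_in_def)

lemma deg_in_add: "deg_in D f \<Longrightarrow> deg_in D g \<Longrightarrow> deg_in D (f + g)"
  using Poly_Mapping.keys_add[of f g] by (auto simp: deg_in_def)

lemma deg_in_uminus: "deg_in D f \<Longrightarrow> deg_in D (- f)" for f :: "'a::ab_group_add mpol"
  by (auto simp: deg_in_def)

lemma deg_in_diff: "deg_in D f \<Longrightarrow> deg_in D g \<Longrightarrow> deg_in D (f - g)"
  for f :: "'a::ab_group_add mpol"
  using deg_in_add[of D f "- g"] deg_in_uminus[of D g] by simp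

lemma deg_in_sum: "(\<And>x. x \<in> S \<Longrightarrow> deg_in D (F x)) \<Longrightarrow> deg_in D (sum F S)"
  by (induction S rule: infinite_finite_induct) (auto intro: deg_in_add)

lemma deg_in_mult:
  fixes f g :: "'a::comm_ring_1 mpol"
  assumes "deg_in D f" "deg_in E g" "\<And>a b. a \<in> D \<Longrightarrow> b \<in> E \<Longrightarrow> a + b \<in> F"
  shows "deg_in F (f * g)"
  unfolding deg_in_def
proof
  fix m assume "m \<in> keys (f * g)"
  with keys_mult[of f g] obtain a b where
    ab: "m = a + b" "a \<in> keys f" "b \<in> keys g" by blast
  with assms show "int (mon_degree m) \<in> F"
    by (auto simp: deg_in_def mon_degree_add)
qed

lemma deg_in_const: "0 \<in> D \<Longrightarrow> deg_in D (const c)"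
  by (auto simp: deg_in_def const_def mon_degree_0 split: if_splits)

lemma deg_in_zvar: "1 \<in> D \<Longrightarrow> deg_in D (zvar i :: 'a::comm_ring_1 mpol)"
  by (auto simp: deg_in_def zvar_def mon_degree_single split: if_splits)

lemma deg_in_const_mult: "deg_in D f \<Longrightarrow> deg_in D (const c * f)" for f :: "'a::comm_ring_1 mpol"
  by (rule deg_in_mult[of "{0}" "const c" D]) (auto intro: deg_in_const)

text \<open>
  \<open>f\<close> has degree at most \<open>d\<close>, and its homogeneous part of degree \<open>d\<close> is \<open>g\<close>, possibly zero.
  Being a relation with \<open>d\<close> prescribed, it is preserved by sums, products and all the operators
  below, without case distinctions for cancelling leading terms.
\<close>

definition lead :: "int \<Rightarrow> 'a::comm_ring_1 mpol \<Rightarrow> 'a mpol \<Rightarrow> bool"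
  where "lead d f g \<longleftrightarrow> deg_in {d} g \<and> deg_in {..<d} (f - g)"

lemma lead_le: "lead d f g \<Longrightarrow> deg_in {..d} f"
proof -
  assume "lead d f g"
  then have "deg_in {..d} g" "deg_in {..d} (f - g)"
    by (auto simp: lead_def elim!: deg_in_mono)
  from deg_in_add[OF this] show ?thesis by simp
qed

lemma lead_unique:
  assumes "lead d f g" "lead d f g'"
  shows "g = g'"
proof -
  have "deg_in {d} (g - g')" using assms by (auto simp: lead_def intro: deg_in_diff)
  moreover have "deg_in {..<d} ((f - g') - (f - g))"
    by (rule deg_in_diff) (use assms in \<open>auto simp: lead_def\<close>)
  then have "deg_in {..<d} (g - g')" by simp
  ultimately have "keys (g - g') = {}" by (auto simp: deg_in_def)
  then show ?thesis by simp
qed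

lemma lead_zero [simp]: "lead d 0 0"
  by (simp add: lead_def)

lemma lead_add: "lead d f g \<Longrightarrow> lead d f' g' \<Longrightarrow> lead d (f + f') (g + g')"
  using deg_in_add[of "{..<d}" "f - g" "f' - g'"] deg_in_add[of "{d}" g g']
  by (simp add: lead_def algebra_simps)

lemma lead_diff: "lead d f g \<Longrightarrow> lead d f' g' \<Longrightarrow> lead d (f - f') (g - g')"
  using deg_in_diff[of "{..<d}" "f - g" "f' - g'"] deg_in_diff[of "{d}" g g']
  by (simp add: lead_def algebra_simps)

lemma lead_sum: "(\<And>x. x \<in> S \<Longrightarrow> lead d (F x) (G x)) \<Longrightarrow> lead d (sum F S) (sum G S)"
  by (induction S rule: infinite_finite_induct) (auto intro: lead_add)

lemma lead_mult:
  assumes "lead d f g" "lead e f' g'"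
  shows "lead (d + e) (f * f') (g * g')"
proof -
  have "deg_in {..<d + e} ((f - g) * f' + g * (f' - g'))"
  proof (rule deg_in_add)
    show "deg_in {..<d + e} ((f - g) * f')"
      by (rule deg_in_mult[of "{..<d}" _ "{..e}"]) (use assms lead_le in \<open>auto simp: lead_def\<close>)
    show "deg_in {..<d + e} (g * (f' - g'))"
      by (rule deg_in_mult[of "{d}" _ "{..<e}"]) (use assms in \<open>auto simp: lead_def\<close>)
  qed
  moreover have "deg_in {d + e} (g * g')"
    by (rule deg_in_mult[of "{d}" _ "{e}"]) (use assms in \<open>auto simp: lead_def\<close>)
  ultimately show ?thesis by (simp add: lead_def algebra_simps)
qed

lemma lead_hom: "deg_in {d} f \<Longrightarrow> lead d f f"
  by (simp add: lead_def)

lemma lead_low: "deg_in {..<d} f \<Longrightarrow> lead d f 0"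
  by (simp add: lead_def)

lemma lead_const: "lead 0 (const c) (const c)"
  by (simp add: lead_hom deg_in_const)

lemma lead_zvar: "lead 1 (zvar i) (zvar i)"
  by (simp add: lead_hom deg_in_zvar)

lemma lead_one: "lead 0 1 1"
  using lead_const[of 1] by simp

lemma lead_const_mult: "lead d f g \<Longrightarrow> lead d (const c * f) (const c * g)"
  using lead_mult[OF lead_const] by simp

lemma lead_power: "lead d f g \<Longrightarrow> lead (int k * d) (f ^ k) (g ^ k)"
proof (induction k)
  case (Suc k)
  then show ?case using lead_mult[of d f g "int k * d" "f ^ k" "g ^ k"] by (simp add: algebra_simps)
qed (simp add: lead_one)

lemma lead_prod:
  "(\<And>x. x \<in> S \<Longrightarrow> lead (D x) (F x) (G x)) \<Longrightarrow> lead (sum D S) (prod F S) (prod G S)"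
  by (induction S rule: infinite_finite_induct) (auto intro: lead_mult lead_one)

lemma lookup_hom_component:
  "lookup (hom_component d f) m = (if mon_degree m = d then lookup f m else 0)"
proof -
  have "lookup (hom_component d f) m =
      (\<Sum>m' \<in> {m \<in> keys f. mon_degree m = d}. if m' = m then lookup f m' else 0)"
    unfolding hom_component_def lookup_sum by (rule sum.cong) (auto simp: lookup_single when_def)
  then show ?thesis by (auto simp: in_keys_iff)
qed

lemma lead_hom_component:
  assumes "deg_in {..int d} f"
  shows "lead (int d) f (hom_component d f)"
  unfolding lead_def deg_in_def
proof safe
  fix m assume "m \<in> keys (hom_component d f)"
  then show "int (mon_degree m) = int d"
    by (auto simp: in_keys_iff lookup_hom_component split: if_splits)
next
  fix m assume m: "m \<in> keys (f - hom_component d f)"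
  then have "m \<in> keys f \<and> mon_degree m \<noteq> d"
    by (auto simp: in_keys_iff lookup_hom_component lookup_minus split: if_splits)
  with assms show "int (mon_degree m) < int d" by (force simp: deg_in_def)
qed

lemma total_degree_ge: "m \<in> keys f \<Longrightarrow> mon_degree m \<le> total_degree f"
  unfolding total_degree_def by (rule Max_ge) auto

lemma total_degree_attained:
  assumes "f \<noteq> 0"
  shows "\<exists>m \<in> keys f. mon_degree m = total_degree f"
proof -
  have "total_degree f \<in> insert 0 (mon_degree ` keys f)"
    unfolding total_degree_def by (rule Max_in) auto
  then show ?thesis
  proof
    assume 0: "total_degree f = 0"
    from assms obtain m where "m \<in> keys f" by fastforce
    with 0 total_degree_ge[of m f] show ?thesis by auto
  qed auto
qed

lemma deg_in_total_degree: "deg_in {..int (total_degree f)} f"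
  by (auto simp: deg_in_def total_degree_ge)

lemma lead_top_component: "lead (int (total_degree f)) f (top_component f)"
  unfolding top_component_def by (rule lead_hom_component[OF deg_in_total_degree])

lemma top_component_nonzero:
  assumes "f \<noteq> 0"
  shows "top_component f \<noteq> 0"
proof
  assume 0: "top_component f = 0"
  from total_degree_attained[OF assms] obtain m where
    m: "m \<in> keys f" "mon_degree m = total_degree f" by blast
  have "lookup (top_component f) m = lookup f m"
    unfolding top_component_def lookup_hom_component using m(2) by simp
  with 0 m(1) show False by (simp add: in_keys_iff)
qed

text \<open>
  Over a domain the leading form of a product is the product of the leading forms, so no cancellation
  can hide terms of high degree of \<open>g\<close>.
\<close>

lemma deg_in_cofactor:
  fixes p g :: "'a::idom mpol"
  assumes "lead D p p0" "p0 \<noteq> 0" "deg_in {..D + d} (p * g)"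
  shows "deg_in {..d} g"
proof (cases "g = 0")
  case False
  let ?e = "int (total_degree g)"
  have l: "lead (D + ?e) (p * g) (p0 * top_component g)"
    by (rule lead_mult[OF assms(1) lead_top_component])
  have "?e \<le> d"
  proof (rule ccontr)
    assume "\<not> ?e \<le> d"
    then have "deg_in {..<D + ?e} (p * g)"
      by (intro deg_in_mono[OF assms(3)]) auto
    from lead_unique[OF l lead_low[OF this]] top_component_nonzero[OF False] assms(2)
    show False by simp
  qed
  then show ?thesis by (intro deg_in_mono[OF deg_in_total_degree]) auto
qed simp

section \<open>Partial derivatives\<close>

lemma lookup_pdiff:
  "lookup (pdiff i f) m =
    of_nat (lookup m i + 1) * lookup f (m + single i 1)"
proof -
  let ?e = "single i (1::nat)"
  have eq: "m' - ?e = m \<longleftrightarrow> m' = m + ?e" if "lookup m' i \<noteq> 0" for m'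
  proof
    assume h: "m' - ?e = m"
    show "m' = m + ?e"
    proof (rule poly_mapping_eqI)
      fix j
      show "lookup m' j = lookup (m + ?e) j"
        using that unfolding h[symmetric]
        by (cases "i = j") (auto simp: lookup_add lookup_minus lookup_single)
    qed
  qed simp
  have "lookup (pdiff i f) m = (\<Sum>m' \<in> keys f.
      (of_nat (lookup m' i) * lookup f m' when m' - ?e = m))"
    by (simp add: pdiff_def lookup_sum lookup_single)
  also have "\<dots> = (\<Sum>m' \<in> keys f. if m' = m + ?e
      then of_nat (lookup m i + 1) * lookup f m' else 0)"
  proof (rule sum.cong[OF refl])
    fix m'
    show "(of_nat (lookup m' i) * lookup f m' when m' - ?e = m) =
        (if m' = m + ?e then of_nat (lookup m i + 1) * lookup f m' else 0)"
    proof (cases "lookup m' i = 0")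
      case True
      then have "m' \<noteq> m + ?e" by (auto simp: lookup_add)
      with True show ?thesis by simp
    next
      case False
      show ?thesis unfolding eq[OF False] by (auto simp: when_def lookup_add)
    qed
  qed
  also have "\<dots> = of_nat (lookup m i + 1) * lookup f (m + ?e)"
    by (auto simp: in_keys_iff)
  finally show ?thesis .
qed

lemma pdiff_add: "pdiff i (f + g) = pdiff i f + pdiff i g"
  by (rule poly_mapping_eqI) (simp only: lookup_pdiff lookup_add distrib_left)

lemma pdiff_0 [simp]: "pdiff i 0 = 0"
  by (simp add: pdiff_def)

lemma pdiff_single:
  "pdiff i (single m c) =
    single (m - single i 1) (of_nat (lookup m i) * c)"
  by (cases "c = 0") (simp_all add: pdiff_def)

lemma pdiff_const [simp]: "pdiff i (const c) = 0"
  by (simp add: const_def pdiff_single)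

lemma pdiff_zvar: "pdiff i (zvar j) = (if i = j then 1 else 0)"
  by (auto simp: zvar_def pdiff_single lookup_single simp flip: single_one)

lemma mpol_additive_induct:
  assumes "\<And>m c. P (single m c)" "\<And>f g. P f \<Longrightarrow> P g \<Longrightarrow> P (f + g)"
  shows "P (f :: 'a::comm_ring_1 mpol)"
proof -
  have 0: "P 0" using assms(1)[of 0 0] by simp
  have "P (\<Sum>m \<in> S. single m (k m))" if "finite S" for S k
    using that by (induction S) (auto intro: 0 assms)
  then show ?thesis by (subst mpol_expand) auto
qed

lemma monom_minus_single_add:
  fixes m m' :: "nat \<Rightarrow>\<^sub>0 nat"
  assumes "lookup m i \<noteq> 0"
  shows "m + m' - single i 1 = (m - single i 1) + m'"
proof (rule poly_mapping_eqI)
  fix j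
  show "lookup (m + m' - single i 1) j =
      lookup (m - single i 1 + m') j"
    using assms by (cases "i = j") (auto simp: lookup_add lookup_minus lookup_single)
qed

text \<open>
  Both sides are biadditive, so the Leibniz rule reduces to monomials. There the truncated
  subtraction in exponents is harmless because its coefficient is zero.
\<close>

lemma pdiff_mult: "pdiff i (f * g) = pdiff i f * g + f * pdiff i g"
proof (induction f rule: mpol_additive_induct)
  case (1 m c)
  show ?case
  proof (induction g rule: mpol_additive_induct)
    case (1 m' c')
    let ?e = "single i (1::nat)"
    have "single (m + m' - ?e) (of_nat (lookup m i) * (c * c')) =
        single (m - ?e + m') (of_nat (lookup m i) * (c * c'))"
      using monom_minus_single_add[of m i m'] by (cases "lookup m i = 0") auto
    moreover have "single (m + m' - ?e) (of_nat (lookup m' i) * (c * c')) =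
        single (m + (m' - ?e)) (of_nat (lookup m' i) * (c * c'))"
      using monom_minus_single_add[of m' i m] by (cases "lookup m' i = 0") (auto simp: add.commute)
    moreover have "pdiff i (single m c * single m' c') =
        single (m + m' - ?e) (of_nat (lookup m i) * (c * c'))
      + single (m + m' - ?e) (of_nat (lookup m' i) * (c * c'))"
      by (simp add: mult_single pdiff_single lookup_add distrib_right flip: single_add)
    ultimately show ?case
      by (simp add: mult_single pdiff_single mult.assoc mult.left_commute[of c])
  qed (simp add: pdiff_add algebra_simps)
qed (simp add: pdiff_add algebra_simps)

lemma pdiff_const_mult [simp]: "pdiff i (const c * f) = const c * pdiff i f"
  by (simp add: pdiff_mult)

lemma deg_in_pdiff:
  assumes "deg_in D f" "\<And>x. x \<in> D \<Longrightarrow> x - 1 \<in> E"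
  shows "deg_in E (pdiff i f)"
  unfolding deg_in_def
proof
  fix m assume "m \<in> keys (pdiff i f)"
  then have "m + single i 1 \<in> keys f"
    by (auto simp: in_keys_iff lookup_pdiff)
  then have "int (mon_degree (m + single i 1)) \<in> D"
    using assms(1) unfolding deg_in_def by blast
  then have "int (mon_degree m) + 1 \<in> D"
    by (simp add: mon_degree_add mon_degree_single add.commute)
  from assms(2)[OF this] show "int (mon_degree m) \<in> E" by simp
qed

section \<open>Unit shifts\<close>

definition shift :: "nat \<Rightarrow> 'a::comm_ring_1 mpol \<Rightarrow> 'a mpol"
  where "shift i = subst (zvar(i := zvar i - 1))"

lemma shift_hom: "comm_ring_hom (shift i)"
  unfolding shift_def by (rule subst_hom)

interpretation shift: comm_ring_hom "shift i"
  by (rule shift_hom)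

lemma shift_const [simp]: "shift i (const c) = const c"
  by (simp add: shift_def const_hom)

lemma shift_zvar: "shift i (zvar j) = (if i = j then zvar j - 1 else zvar j)"
  by (simp add: shift_def const_hom)

text \<open>The operator \<open>1 - shift i\<close> lowers degrees by one, and agrees with \<open>pdiff i\<close> to leading order.\<close>

definition difference_bounds :: "nat \<Rightarrow> int \<Rightarrow> 'a::comm_ring_1 mpol \<Rightarrow> bool"
  where "difference_bounds i d f \<longleftrightarrow> deg_in {..d} f \<and> deg_in {..d - 1} (f - shift i f)
    \<and> deg_in {..d - 2} (f - shift i f - pdiff i f)"

lemma difference_bounds_mono: "difference_bounds i d f \<Longrightarrow> d \<le> e \<Longrightarrow> difference_bounds i e f"
  unfolding difference_bounds_def by (auto elim!: deg_in_mono)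

lemma difference_bounds_add:
  assumes "difference_bounds i d f" "difference_bounds i d g"
  shows "difference_bounds i d (f + g)"
proof -
  have "f + g - shift i (f + g) = (f - shift i f) + (g - shift i g)"
    "f + g - shift i (f + g) - pdiff i (f + g) =
      (f - shift i f - pdiff i f) + (g - shift i g - pdiff i g)"
    by (simp_all add: shift.hom_add pdiff_add)
  then show ?thesis
    using assms by (simp only: difference_bounds_def) (blast intro: deg_in_add)
qed

text \<open>
  With \<open>\<delta> = 1 - shift\<close>, this is the twisted Leibniz rule \<open>\<delta>(fg) = \<delta>f g + f \<delta>g - \<delta>f \<delta>g\<close>; its last
  term has degree two less than \<open>fg\<close>.
\<close>

lemma difference_bounds_mult:
  assumes f: "difference_bounds i d f" and g: "difference_bounds i e g"
  shows "difference_bounds i (d + e) (f * g)"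
proof -
  let ?df = "f - shift i f" and ?dg = "g - shift i g"
  have 1: "deg_in {..d + e} (f * g)"
    by (rule deg_in_mult[of "{..d}" _ "{..e}"]) (use f g in \<open>auto simp: difference_bounds_def\<close>)
  have 2: "deg_in {..d + e - 1} (?df * g)"
    by (rule deg_in_mult[of "{..d-1}" _ "{..e}"]) (use f g in \<open>auto simp: difference_bounds_def\<close>)
  have 3: "deg_in {..d + e - 1} (f * ?dg)"
    by (rule deg_in_mult[of "{..d}" _ "{..e-1}"]) (use f g in \<open>auto simp: difference_bounds_def\<close>)
  have 4: "deg_in {..d + e - 2} (?df * ?dg)"
    by (rule deg_in_mult[of "{..d-1}" _ "{..e-1}"]) (use f g in \<open>auto simp: difference_bounds_def\<close>)
  have 5: "deg_in {..d + e - 2} ((?df - pdiff i f) * g)"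
    by (rule deg_in_mult[of "{..d-2}" _ "{..e}"]) (use f g in \<open>auto simp: difference_bounds_def\<close>)
  have 6: "deg_in {..d + e - 2} (f * (?dg - pdiff i g))"
    by (rule deg_in_mult[of "{..d}" _ "{..e-2}"]) (use f g in \<open>auto simp: difference_bounds_def\<close>)
  have a: "f * g - shift i (f * g) = ?df * g + f * ?dg - ?df * ?dg"
    by (simp add: shift.hom_mult algebra_simps)
  have b: "f * g - shift i (f * g) - pdiff i (f * g) =
      (?df - pdiff i f) * g + f * (?dg - pdiff i g) - ?df * ?dg"
    by (simp add: shift.hom_mult pdiff_mult algebra_simps)
  have lo: "deg_in {..d + e - 1} (?df * ?dg)"
    by (rule deg_in_mono[OF 4]) auto
  have "deg_in {..d + e - 1} (f * g - shift i (f * g))"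
    unfolding a by (rule deg_in_diff[OF deg_in_add[OF 2 3] lo])
  moreover have "deg_in {..d + e - 2} (f * g - shift i (f * g) - pdiff i (f * g))"
    unfolding b by (rule deg_in_diff[OF deg_in_add[OF 5 6] 4])
  ultimately show ?thesis using 1 by (simp add: difference_bounds_def)
qed

lemma difference_bounds_const: "difference_bounds i 0 (const c)"
  by (simp add: difference_bounds_def deg_in_const)

lemma difference_bounds_zvar: "difference_bounds i 1 (zvar j :: 'a::comm_ring_1 mpol)"
  using deg_in_const[of "{..0}" "1::'a"]
  by (auto simp: difference_bounds_def const.hom_one deg_in_zvar shift_zvar pdiff_zvar)

lemma difference_bounds_zvar_power: "difference_bounds i (int k) (zvar j ^ k)"
proof (induction k)
  case 0
  show ?case using difference_bounds_const[of i 1] by simp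
next
  case (Suc k)
  from difference_bounds_mult[OF difference_bounds_zvar this] show ?case by simp
qed

lemma difference_bounds_monom: "difference_bounds i (int (mon_degree m)) (single m c)"
proof -
  have "difference_bounds i (\<Sum>j\<in>S. int (g j)) (\<Prod>j\<in>S. zvar j ^ g j)" if "finite S" for S g
    using that
  proof (induction S)
    case empty
    show ?case using difference_bounds_const[of i 1] by simp
  next
    case (insert j S)
    with difference_bounds_mult[OF difference_bounds_zvar_power[of i "g j" j]] show ?case by simp
  qed
  from difference_bounds_mult[OF difference_bounds_const this[of "keys m" "lookup m"]]
  show ?thesis by (simp add: single_eq mon_val_def mon_degree_def)
qed

lemma difference_bounds_deg_in:
  assumes "deg_in {..d} f"
  shows "difference_bounds i d f"
proof -
  have 0: "difference_bounds i d 0" by (simp add: difference_bounds_def)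
  have "difference_bounds i d (\<Sum>m \<in> S. single m (k m))"
    if "finite S" "\<forall>m\<in>S. int (mon_degree m) \<le> d" for S k
    using that by (induction S) (auto intro!: 0 difference_bounds_add difference_bounds_mono[OF difference_bounds_monom])
  from this[of "keys f"] show ?thesis
    using assms by (subst mpol_expand) (auto simp: deg_in_def)
qed

lemma lead_pdiff: "deg_in {d} g \<Longrightarrow> deg_in {d - 1} (pdiff i g)"
  by (rule deg_in_pdiff) auto

lemma lead_diff_shift:
  assumes "lead d f g"
  shows "lead (d - 1) (f - shift i f) (pdiff i g)"
proof -
  let ?h = "f - g"
  have g: "deg_in {d} g" and h: "deg_in {..d - 1} ?h"
    using assms by (auto simp: lead_def deg_in_def)
  have "deg_in {..d} g" by (rule deg_in_mono[OF g]) auto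
  then have 1: "deg_in {..d - 2} (g - shift i g - pdiff i g)"
    using difference_bounds_deg_in by (auto simp: difference_bounds_def)
  have 2: "deg_in {..d - 2} (?h - shift i ?h)"
    using difference_bounds_deg_in[OF h, of i] by (auto simp: difference_bounds_def)
  have "f - shift i f - pdiff i g = (g - shift i g - pdiff i g) + (?h - shift i ?h)"
    by (simp add: shift.hom_minus)
  also have "deg_in {..<d - 1} \<dots>"
    using deg_in_add[OF 1 2] by (rule deg_in_mono) auto
  finally show ?thesis
    using lead_pdiff[OF g] by (simp add: lead_def)
qed

lemma lead_shift:
  assumes "lead d f g"
  shows "lead d (shift i f) g"
proof -
  have "deg_in {..<d} (f - shift i f)"
    using lead_le[OF lead_diff_shift[OF assms]] by (rule deg_in_mono) auto
  with lead_diff[OF assms lead_low] show ?thesis by fastforce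
qed

section \<open>Divisibility by linear forms\<close>

text \<open>
  The quotient ring modulo \<open>z\<^sub>i - w\<close> identifies \<open>z\<^sub>i\<close> with \<open>w\<close>.
\<close>

lemma linear_dvd: "zvar i - w dvd f - subst (zvar(i := w)) f"
proof (induction f rule: mpol_induct)
  case (mult f g)
  let ?s = "subst (zvar(i := w))"
  have "f * g - ?s (f * g) = f * (g - ?s g) + (f - ?s f) * ?s g"
    by (simp add: subst.hom_mult algebra_simps)
  then show ?case using dvd_add[OF dvd_mult[OF mult(2), of f] dvd_mult2[OF mult(1), of "?s g"]]
    by (simp only:)
next
  case (add f g)
  let ?s = "subst (zvar(i := w))"
  have "f + g - ?s (f + g) = (f - ?s f) + (g - ?s g)"
    by (simp add: subst.hom_add)
  then show ?case using dvd_add[OF add] by (simp only:)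
qed (auto simp: const_hom)

text \<open>
  The linear forms are split off one at a time: the substitution that kills the next form maps the
  product of the earlier ones to a nonzero element of a domain, so it kills the remaining cofactor.
\<close>

lemma prod_linear_dvd:
  fixes h :: "'a::idom mpol"
  assumes "finite P"
    and "\<And>p. p \<in> P \<Longrightarrow> subst (zvar(ix p := w p)) h = 0"
    and "\<And>p q. p \<in> P \<Longrightarrow> q \<in> P \<Longrightarrow> p \<noteq> q \<Longrightarrow>
      subst (zvar(ix p := w p)) (zvar (ix q) - w q) \<noteq> 0"
  shows "(\<Prod>p\<in>P. zvar (ix p) - w p) dvd h"
  using assms
proof (induction P)
  case (insert p P)
  let ?s = "subst (zvar(ix p := w p))"
  from insert have "(\<Prod>q\<in>P. zvar (ix q) - w q) dvd h" by blast
  then obtain k where k: "h = (\<Prod>q\<in>P. zvar (ix q) - w q) * k" by (auto simp: dvd_def)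
  have "?s (\<Prod>q\<in>P. zvar (ix q) - w q) \<noteq> 0"
  proof -
    have "\<forall>q\<in>P. ?s (zvar (ix q) - w q) \<noteq> 0"
      using insert.prems(2)[of p] insert.hyps(2) by blast
    then show ?thesis
      unfolding subst.hom_prod prod_zero_iff[OF insert.hyps(1)] by blast
  qed
  moreover have "?s h = 0" by (rule insert.prems(1)) simp
  ultimately have "?s k = 0" unfolding k by (simp add: subst.hom_mult)
  then have "zvar (ix p) - w p dvd k" using linear_dvd[of "ix p" "w p" k] by simp
  then show ?case using insert.hyps unfolding k
    by (simp add: mult.commute[of "zvar (ix p) - w p"] mult_dvd_mono)
qed simp

text \<open>
  Setting the variables outside \<open>{1..n}\<close> to zero fixes \<open>p\<close> and \<open>p * g\<close>, hence also \<open>g\<close>.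
\<close>

lemma polys_cofactor:
  fixes p :: "'a::idom mpol"
  assumes "p \<in> polys n" "p * g \<in> polys n" "p \<noteq> 0"
  shows "g \<in> polys n"
proof -
  let ?c = "\<lambda>i. if i \<in> {1..n} then zvar i else (0::'a mpol)"
  have keep: "subst ?c f = f" if "f \<in> polys n" for f
    using hsubst_cong_polys[OF that, of ?c zvar const] by simp
  have "p * subst ?c g = p * g"
    using keep[OF assms(1)] keep[OF assms(2)] by (simp add: subst.hom_mult)
  then have eq: "subst ?c g = g" using assms(3) by simp
  have "subst ?c g \<in> polys n"
    unfolding hsubst_def mon_val_def
  proof (intro polys_sum polys_mult polys_prod polys_power polys_const)
    fix i show "?c i \<in> polys n" by (auto intro: polys_zvar)
  qed
  then show ?thesis by (simp only: eq)
qed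

section \<open>Semisymmetric polynomials are determined by their values at the nodes\<close>

abbreviation swap_vars :: "nat \<Rightarrow> nat \<Rightarrow> 'a::comm_ring_1 mpol \<Rightarrow> 'a mpol"
  where "swap_vars i j \<equiv> subst (\<lambda>k. zvar (transpose i j k))"

text \<open>
  Invariance is demanded for transpositions only. They generate the group of parity preserving
  permutations, and they are their own inverses.
\<close>

definition semisym :: "nat \<Rightarrow> 'a::comm_ring_1 mpol \<Rightarrow> bool"
  where "semisym n f \<longleftrightarrow> f \<in> polys n \<and>
    (\<forall>i \<in> {1..n}. \<forall>j \<in> {1..n}. even (i + j) \<longrightarrow> swap_vars i j f = f)"

lemma perm_vars_transpose: "perm_vars (transpose i j) f = swap_vars i j f"
proof -
  let ?t = "transpose i j"
  let ?K = "Poly_Mapping.map_key ?t :: (nat \<Rightarrow>\<^sub>0 nat) \<Rightarrow> (nat \<Rightarrow>\<^sub>0 nat)"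
  have t: "inj ?t" by (rule inj_on_subset[OF bij_is_inj]) auto
  have KK: "?K (?K m) = m" for m
  proof -
    have "?K (?K m) = Poly_Mapping.map_key (?t \<circ> ?t) m"
      by (rule map_key_compose[OF t t])
    also have "?t \<circ> ?t = (\<lambda>x. x)" by auto
    finally show ?thesis by (simp only: map_key_id)
  qed
  have injK: "inj ?K" by (rule inj_on_inverseI[where g = ?K]) (rule KK)
  have lk: "lookup (?K m) k = lookup m (?t k)" for m k
    using t by (simp add: map_key.rep_eq)
  have mon: "mon_val (\<lambda>k. zvar (?t k)) m = mon_val zvar (?K m)" for m
  proof -
    have keys: "keys (?K m) = ?t ` keys m"
    proof
      show "keys (?K m) \<subseteq> ?t ` keys m"
      proof
        fix k assume "k \<in> keys (?K m)"
        then have "?t k \<in> keys m" by (simp add: in_keys_iff lk)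
        then have "?t (?t k) \<in> ?t ` keys m" by (rule imageI)
        then show "k \<in> ?t ` keys m" by simp
      qed
      show "?t ` keys m \<subseteq> keys (?K m)"
        by (auto simp: in_keys_iff lk)
    qed
    show ?thesis
      unfolding mon_val_def keys
      by (subst prod.reindex[OF inj_on_subset[OF t]]) (auto simp: lk)
  qed
  show ?thesis
  proof (induction f rule: mpol_additive_induct)
    case (1 m c)
    have "perm_vars ?t (single m c) = single (?K m) c"
      using map_key_single[OF injK, of "?K m" c] unfolding perm_vars_def KK .
    also have "\<dots> = const c * mon_val zvar (?K m)"
      by (rule single_eq)
    also have "\<dots> = subst (\<lambda>k. zvar (?t k)) (single m c)"
      unfolding mon[symmetric] single_eq[of m c]
      by (simp add: subst.hom_mult const_hom mon_val_def subst.hom_prod subst.hom_power)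
    finally show ?case .
  next
    case (2 f g)
    have "perm_vars ?t (f + g) = perm_vars ?t f + perm_vars ?t g"
      unfolding perm_vars_def by (rule map_key_plus[OF injK])
    with 2 show ?case by (simp add: subst.hom_add)
  qed
qed

lemma invariants_semisym:
  assumes "f \<in> invariants n"
  shows "semisym n f"
  unfolding semisym_def
proof (intro conjI ballI impI)
  show "f \<in> polys n" using assms by (simp add: invariants_def)
  fix i j assume ij: "i \<in> {1..n}" "j \<in> {1..n}" "even (i + j)"
  have "transpose i j \<in> parity_perms n"
    unfolding parity_perms_def
  proof (intro CollectI conjI ballI)
    show "transpose i j permutes {1..n}" by (rule permutes_swap_id) (use ij in auto)
    have "i mod 2 = j mod 2" using ij(3) by presburger
    then show "transpose i j k mod 2 = k mod 2" for k
      by (simp add: transpose_def)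
  qed
  then show "swap_vars i j f = f"
    using assms perm_vars_transpose[of i j f] by (auto simp: invariants_def)
qed

lemma semisymD:
  "semisym n f \<Longrightarrow> i \<in> {1..n} \<Longrightarrow> j \<in> {1..n} \<Longrightarrow> even (i + j) \<Longrightarrow>
    swap_vars i j f = f"
  by (simp add: semisym_def)

lemma semisym_polys: "semisym n f \<Longrightarrow> f \<in> polys n"
  by (simp add: semisym_def)

lemma semisym_diff: "semisym n f \<Longrightarrow> semisym n g \<Longrightarrow> semisym n (f - g)"
  by (auto simp: semisym_def polys_diff subst.hom_minus)

lemma semisym_const_mult: "semisym n f \<Longrightarrow> semisym n (const c * f)"
  by (auto simp: semisym_def polys_mult subst.hom_mult const_hom)

lemma semisym_sum: "(\<And>x. x \<in> S \<Longrightarrow> semisym n (F x)) \<Longrightarrow> semisym n (sum F S)"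
  by (auto simp: semisym_def intro!: polys_sum simp: subst.hom_sum)

lemma deg_in_subst:
  fixes f :: "'a::comm_ring_1 mpol"
  assumes f: "deg_in {..d} f" and s: "\<And>i. deg_in {..1} (s i)"
  shows "deg_in {..d} (subst s f)"
proof -
  have one: "deg_in {..0} (1 :: 'a mpol)"
    using deg_in_const[of "{..0}" "1::'a"] by simp
  have pw: "deg_in {..int k} (s i ^ k)" for i k
  proof (induction k)
    case (Suc k)
    have "deg_in {..int (Suc k)} (s i * s i ^ k)"
      by (rule deg_in_mult[OF s Suc]) auto
    then show ?case by simp
  qed (simp add: one)
  have pr: "deg_in {..\<Sum>i\<in>S. int (g i)} (\<Prod>i\<in>S. s i ^ g i)" if "finite S" for S g
    using that
  proof (induction S)
    case (insert i S)
    have "deg_in {..\<Sum>i\<in>insert i S. int (g i)} (s i ^ g i * (\<Prod>i\<in>S. s i ^ g i))"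
      by (rule deg_in_mult[OF pw insert.IH]) (use insert.hyps in auto)
    then show ?case using insert.hyps by simp
  qed (simp add: one)
  show ?thesis
    unfolding hsubst_def
  proof (intro deg_in_sum deg_in_const_mult)
    fix m assume m: "m \<in> keys f"
    have "deg_in {..int (mon_degree m)} (mon_val s m)"
      unfolding mon_val_def mon_degree_def using pr[of "keys m"] by simp
    then show "deg_in {..d} (mon_val s m)"
      by (rule deg_in_mono) (use f m in \<open>auto simp: deg_in_def\<close>)
  qed
qed

lemma card_odd_upto: "card {i \<in> {1..n}. odd i} = (n + 1) div 2"
proof (induction n)
  case (Suc n)
  have "{i \<in> {1..Suc n}. odd i} =
      (if odd (Suc n) then insert (Suc n) {i \<in> {1..n}. odd i} else {i \<in> {1..n}. odd i})"
    by (auto simp: le_Suc_eq)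
  then show ?case using Suc by (auto elim!: oddE evenE)
qed simp

lemma card_even_upto: "card {i \<in> {1..n}. even i} = n div 2"
proof (induction n)
  case (Suc n)
  have "{i \<in> {1..Suc n}. even i} =
      (if even (Suc n) then insert (Suc n) {i \<in> {1..n}. even i} else {i \<in> {1..n}. even i})"
    by (auto simp: le_Suc_eq)
  then show ?case using Suc by (auto elim!: oddE evenE)
qed simp

lemma card_same_parity: fixes n :: nat shows "card {i \<in> {1..n}. even (i + n)} = card {i \<in> {1..n}. odd i}"
proof (cases "even n")
  case True
  then have "{i \<in> {1..n}. even (i + n)} = {i \<in> {1..n}. even i}" by simp
  moreover have "n div 2 = (n + 1) div 2" using True by simp
  ultimately show ?thesis by (simp only: card_odd_upto card_even_upto)
next
  case False
  then show ?thesis by simp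
qed

lemma zvar_neq_const: "zvar i \<noteq> (const c :: 'a::comm_ring_1 mpol)"
proof
  assume "zvar i = const c"
  then have "eval_at (\<lambda>_. c + 1) (zvar i) = eval_at (\<lambda>_. c + 1) (const c)" by simp
  then show False by simp
qed

lemma zvar_neq_0: "zvar i \<noteq> (0 :: 'a::comm_ring_1 mpol)"
  using zvar_neq_const[of i 0] by simp

lemma semisym_cofactor:
  fixes p g :: "'a::idom mpol"
  assumes p: "p \<in> polys n" "p \<noteq> 0" and f: "semisym n (p * g)"
    and inv: "\<And>i j. i \<in> {1..n} \<Longrightarrow> j \<in> {1..n} \<Longrightarrow> even (i + j) \<Longrightarrow>
      swap_vars i j p = p"
  shows "semisym n g"
  unfolding semisym_def
proof (intro conjI ballI impI)
  show "g \<in> polys n" by (rule polys_cofactor[OF p(1) semisym_polys[OF f] p(2)])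
  fix i j assume ij: "i \<in> {1..n}" "j \<in> {1..n}" "even (i + j)"
  let ?s = "swap_vars i j"
  have "p * ?s g = p * g"
    using semisymD[OF f ij] inv[OF ij] by (simp add: subst.hom_mult)
  then show "?s g = g" using p(2) by simp
qed

text \<open>
  The proof is by induction on \<open>n\<close> and the degree \<open>d\<close>. The nodes with \<open>\<mu>\<^sub>n = 0\<close> lie on the hyperplane \<open>z\<^sub>n = c\<close>, where they are the nodes
  for \<open>n - 1\<close> variables; so \<open>f\<close> vanishes there, and by symmetry it is divisible by all \<open>z\<^sub>i - c\<close> with
  \<open>i\<close> of the parity of \<open>n\<close>. The cofactor vanishes at the nodes with \<open>\<mu>\<^sub>n \<ge> 1\<close>, that is, at the nodes
  based at \<open>c + 1\<close> instead of \<open>c\<close>. Lowering all \<open>\<mu>\<^sub>i\<close> by one lowers the odd size by the number of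
  odd indices, which is also the number of linear factors, so the degree bound is preserved.
  The base point \<open>c\<close> is arbitrary because both steps of the induction move it.
\<close>

theorem semisym_eq_0:
  fixes f :: "'a::idom mpol"
  assumes r: "\<And>j m. 1 \<le> m \<Longrightarrow> of_nat j * r + of_nat m \<noteq> 0"
    and "semisym n f" "deg_in {..int d} f"
    and "\<And>\<mu>. \<mu> \<in> Lam n \<Longrightarrow> odd_size n \<mu> \<le> d \<Longrightarrow>
      eval_at (\<lambda>i. c + rho n r i + of_nat (\<mu> i)) f = 0"
  shows "f = 0"
  using assms(2-)
proof (induction n arbitrary: f c d)
  case 0
  have "f = subst (\<lambda>i. const (c + rho 0 r i)) f"
    using hsubst_cong_polys[OF semisym_polys[OF 0(1)], of zvar _ const] by simp
  also have "\<dots> = const (eval_at (\<lambda>i. c + rho 0 r i) f)"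
    unfolding eval_at_eq by (rule hom_hsubst[OF id_hom const_hom, symmetric])
  also have "eval_at (\<lambda>i. c + rho 0 r i) f = 0"
    using 0(3)[of "\<lambda>_. 0"] by (simp add: Lam_def odd_size_def)
  finally show ?case by simp
next
  case (Suc k)
  note IH = Suc.IH
  from Suc.prems show ?case
  proof (induction d arbitrary: f c rule: less_induct)
    case (less d)
    let ?n = "Suc k"
    let ?R = "zvar(?n := const c)"
    note sym = semisymD[OF less.prems(1)]
    have f: "f \<in> polys ?n" by (rule semisym_polys[OF less.prems(1)])
    have restr: "subst ?R f = 0"
    proof (rule IH[of _ d "c + r"])
      show "semisym k (subst ?R f)"
        unfolding semisym_def
      proof (intro conjI ballI impI)
        show "subst ?R f \<in> polys k"
          by (rule polys_subst[OF f]) (auto intro: polys_zvar)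
        fix i j assume ij: "i \<in> {1..k}" "j \<in> {1..k}" "even (i + j)"
        let ?t = "transpose i j"
        have t: "?t l = ?n \<longleftrightarrow> l = ?n" for l
          using ij by (auto simp: transpose_def)
        have "subst (\<lambda>l. zvar (?t l)) (subst ?R f) = subst (\<lambda>l. if l = ?n then const c else zvar (?t l)) f"
          unfolding subst_subst
          by (rule arg_cong[of _ _ "\<lambda>s. subst s f"]) (auto simp: const_hom)
        also have "\<dots> = subst ?R (subst (\<lambda>l. zvar (?t l)) f)"
          unfolding subst_subst
          by (rule arg_cong[of _ _ "\<lambda>s. subst s f"]) (auto simp: const_hom t)
        also have "\<dots> = subst ?R f" using sym[of i j] ij by simp
        finally show "subst (\<lambda>l. zvar (?t l)) (subst ?R f) = subst ?R f" .
      qed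
      show "deg_in {..int d} (subst ?R f)"
        by (rule deg_in_subst[OF less.prems(2)]) (auto intro: deg_in_const deg_in_zvar)
      fix \<mu> assume \<mu>: "\<mu> \<in> Lam k" "odd_size k \<mu> \<le> d"
      have mu0: "\<mu> i = 0" if "i \<notin> {1..k}" for i using \<mu>(1) that by (auto simp: Lam_def)
      have "\<mu> \<in> Lam ?n"
        unfolding Lam_def
      proof (intro CollectI conjI ballI allI impI)
        fix i assume "i \<in> {1..<?n}"
        then show "\<mu> (Suc i) \<le> \<mu> i"
          using \<mu>(1) mu0[of "Suc i"] by (cases "i = k") (auto simp: Lam_def)
      qed (use mu0 in auto)
      moreover have "odd_size ?n \<mu> = odd_size k \<mu>"
        unfolding odd_size_def
      proof (rule sum.mono_neutral_right)
        show "\<forall>i \<in> {i \<in> {1..?n}. odd i} - {i \<in> {1..k}. odd i}. \<mu> i = 0"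
          by (intro ballI mu0) auto
      qed auto
      ultimately have "eval_at (\<lambda>i. c + rho ?n r i + of_nat (\<mu> i)) f = 0"
        using less.prems(3) \<mu>(2) by simp
      moreover have "eval_at (\<lambda>i. c + r + rho k r i + of_nat (\<mu> i)) (subst ?R f) =
          eval_at (\<lambda>i. c + rho ?n r i + of_nat (\<mu> i)) f"
        unfolding eval_at_subst
      proof (rule eval_at_cong_polys[OF f])
        fix i assume "i \<in> {1..?n}"
        then show "eval_at (\<lambda>i. c + r + rho k r i + of_nat (\<mu> i)) (?R i) =
            c + rho ?n r i + of_nat (\<mu> i)"
          using mu0[of ?n] by (auto simp: rho_def Suc_diff_le algebra_simps)
      qed
      ultimately show "eval_at (\<lambda>i. c + r + rho k r i + of_nat (\<mu> i)) (subst ?R f) = 0" by simp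
    qed
    \<comment> \<open>the indices \<open>i\<close> for which \<open>z\<^sub>i - c\<close> divides \<open>f\<close>\<close>
    define J where "J = {i \<in> {1..?n}. even (i + ?n)}"
    define p where "p = (\<Prod>i\<in>J. zvar i - (const c :: 'a mpol))"
    have finJ: "finite J" by (simp add: J_def)
    have "p dvd f"
      unfolding p_def
    proof (rule prod_linear_dvd[of J "\<lambda>i. i" "\<lambda>_. const c"])
      fix i assume i: "i \<in> J"
      let ?t = "transpose i ?n"
      have t: "?t l = i \<longleftrightarrow> l = ?n" for l by (auto simp: transpose_def)
      have "subst (zvar(i := const c)) f = subst (zvar(i := const c)) (subst (\<lambda>l. zvar (?t l)) f)"
        using sym[of i ?n] i by (simp add: J_def)
      also have "\<dots> = subst (\<lambda>l. zvar (?t l)) (subst ?R f)"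
        unfolding subst_subst
        by (rule arg_cong[of _ _ "\<lambda>s. subst s f"]) (auto simp: const_hom t)
      finally show "subst (zvar(i := const c)) f = 0" by (simp add: restr)
    next
      fix i j assume "i \<in> J" "j \<in> J" "i \<noteq> j"
      then show "subst (zvar(i := const c)) (zvar j - const c) \<noteq> 0"
        using zvar_neq_const[of j c] by (simp add: subst.hom_minus const_hom)
    qed (rule finJ)
    then obtain g where g: "f = p * g" by (auto simp: dvd_def)
    have p0: "p \<noteq> 0"
      unfolding p_def prod_zero_iff[OF finJ] using zvar_neq_const by (metis eq_iff_diff_eq_0)
    have pp: "p \<in> polys ?n"
      unfolding p_def by (intro polys_prod polys_diff polys_zvar polys_const) (simp add: J_def)
    have "semisym ?n g"
    proof (rule semisym_cofactor[OF pp p0])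
      show "semisym ?n (p * g)" using less.prems(1) unfolding g .
      fix i j assume ij: "i \<in> {1..?n}" "j \<in> {1..?n}" "even (i + j)"
      let ?t = "transpose i j"
      have par: "even (i + ?n) \<longleftrightarrow> even (j + ?n)" using ij(3) by presburger
      have "?t l \<in> J" if "l \<in> J" for l
      proof -
        consider "l = i" | "l = j" "l \<noteq> i" | "l \<noteq> i" "l \<noteq> j" by blast
        then show ?thesis
        proof cases
          case 1
          then show ?thesis using ij(2) par that unfolding J_def by simp
        next
          case 2
          then show ?thesis using ij(1) par that unfolding J_def by simp
        next
          case 3
          then show ?thesis using that by simp
        qed
      qed
      then have "bij_betw ?t J J"
        by (intro bij_betw_byWitness[where f' = ?t]) auto
      then show "subst (\<lambda>l. zvar (?t l)) p = p"
        unfolding p_def subst.hom_prod subst.hom_minus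
        by (simp add: const_hom prod.reindex_bij_betw[where g = "\<lambda>x. zvar x - const c"])
    qed
    moreover have deg: "deg_in {..int d - int (card J)} g"
    proof (rule deg_in_cofactor)
      have "lead 1 (zvar i - const c) (zvar i)" for i
        using lead_diff[OF lead_zvar lead_low[OF deg_in_const]] by simp
      from lead_prod[where S = J and D = "\<lambda>_. 1", OF this]
      show "lead (int (card J)) p (\<Prod>i\<in>J. zvar i)" by (simp add: p_def)
      show "(\<Prod>i\<in>J. zvar i) \<noteq> (0 :: 'a mpol)"
        unfolding prod_zero_iff[OF finJ] using zvar_neq_0 by blast
      show "deg_in {..int (card J) + (int d - int (card J))} (p * g)"
        using less.prems(2) g by simp
    qed
    have "g = 0"
    proof (cases "card J \<le> d")
      case False
      then have "keys g = {}" using deg by (auto simp: deg_in_def)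
      then show ?thesis by simp
    next
      case True
      have "?n \<in> J" by (simp add: J_def)
      then have "card J > 0" using finJ by (auto simp: card_gt_0_iff)
      show ?thesis
      proof (rule less.IH[of "d - card J" _ "c + 1"])
        show "d - card J < d" using \<open>card J > 0\<close> True by simp
        show "semisym ?n g" by fact
        show "deg_in {..int (d - card J)} g" using deg True by (simp add: of_nat_diff)
        fix \<nu> assume \<nu>: "\<nu> \<in> Lam ?n" "odd_size ?n \<nu> \<le> d - card J"
        \<comment> \<open>nodes based at \<open>c + 1\<close> are nodes based at \<open>c\<close> all of whose parts are positive\<close>
        define \<mu> where "\<mu> i = (if i \<in> {1..?n} then \<nu> i + 1 else 0)" for i
        have "\<mu> \<in> Lam ?n" using \<nu>(1) by (auto simp: Lam_def \<mu>_def)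
        moreover have "odd_size ?n \<mu> = odd_size ?n \<nu> + card J"
          unfolding odd_size_def \<mu>_def J_def card_same_parity
          by (simp add: sum_Suc)
        ultimately have "eval_at (\<lambda>i. c + rho ?n r i + of_nat (\<mu> i)) (p * g) = 0"
          using less.prems(3) \<nu>(2) True unfolding g by simp
        moreover have "eval_at (\<lambda>i. c + rho ?n r i + of_nat (\<mu> i)) p \<noteq> 0"
        proof -
          have "eval_at (\<lambda>i. c + rho ?n r i + of_nat (\<mu> i)) (zvar i - const c) \<noteq> 0" if "i \<in> J" for i
            using r[of "\<mu> i" "?n - i"] that by (simp add: eval_at.hom_minus rho_def \<mu>_def J_def)
          then show ?thesis unfolding p_def eval_at.hom_prod prod_zero_iff[OF finJ] by blast
        qed
        ultimately have "eval_at (\<lambda>i. c + rho ?n r i + of_nat (\<mu> i)) g = 0"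
          by (simp add: eval_at.hom_mult)
        also have "eval_at (\<lambda>i. c + rho ?n r i + of_nat (\<mu> i)) g =
            eval_at (\<lambda>i. c + 1 + rho ?n r i + of_nat (\<nu> i)) g"
          by (rule eval_at_cong_polys[OF semisym_polys[OF \<open>semisym ?n g\<close>]]) (simp add: \<mu>_def)
        finally show "eval_at (\<lambda>i. c + 1 + rho ?n r i + of_nat (\<nu> i)) g = 0" .
      qed
    qed
    then show ?case by (simp add: g)
  qed
qed

section \<open>Determinants\<close>

text \<open>
  The Leibniz determinant in the shape used for operators: a matrix is a function, with indices
  starting at 1. In this form it can be compared with a sum of compositions term by term.
\<close>

definition detf :: "nat \<Rightarrow> (nat \<Rightarrow> nat \<Rightarrow> 'a::comm_ring_1) \<Rightarrow> 'a"
  where "detf n M = (\<Sum>\<pi> \<in> {\<pi>. \<pi> permutes {1..n}}. of_int (sign \<pi>) * (\<Prod>p\<in>{1..n}. M p (\<pi> p)))"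

lemma detf_cong:
  assumes "\<And>p q. p \<in> {1..n} \<Longrightarrow> q \<in> {1..n} \<Longrightarrow> M p q = M' p q"
  shows "detf n M = detf n M'"
  unfolding detf_def
proof (intro sum.cong refl arg_cong2[of _ _ _ _ "(*)"] prod.cong)
  fix \<pi> p assume "\<pi> \<in> {\<pi>. \<pi> permutes {1..n}}" "p \<in> {1..n}"
  then have "\<pi> p \<in> {1..n}" using permutes_in_image[of \<pi> "{1..n}" p] by simp
  with \<open>p \<in> {1..n}\<close> show "M p (\<pi> p) = M' p (\<pi> p)" by (rule assms)
qed

lemma detf_eq_det: "detf n M = Determinant.det (mat n n (\<lambda>(i, j). M (Suc i) (Suc j)))"
proof -
  let ?A = "mat n n (\<lambda>(i, j). M (Suc i) (Suc j))"
  have im: "Suc ` {0..<n} = {1..n}" by (simp add: image_Suc_atLeastLessThan atLeastLessThanSuc_atLeastAtMost)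
  have bij: "bij_betw Suc {0..<n} {1..n}" using im by (simp add: bij_betw_def)
  have bij': "bij_betw (\<lambda>k. k - 1) {1..n} {0..<n}"
    by (rule bij_betw_byWitness[where f' = Suc]) auto
  have "Determinant.det ?A = (\<Sum>\<pi> \<in> {\<pi>. \<pi> permutes {0..<n}}.
      of_int (sign \<pi>) * (\<Prod>i=0..<n. ?A $$ (i, \<pi> i)))"
    by (rule det_def') simp
  also have "\<dots> = detf n M"
    unfolding detf_def
  proof (rule sum.reindex_bij_witness[where
        i = "map_permutation {1..n} (\<lambda>k. k - 1)" and j = "map_permutation {0..<n} Suc"])
    fix \<pi> assume "\<pi> \<in> {\<pi>. \<pi> permutes {0..<n}}"
    then have \<pi>: "\<pi> permutes {0..<n}" by simp
    show "map_permutation {1..n} (\<lambda>k. k - 1) (map_permutation {0..<n} Suc \<pi>) = \<pi>"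
      by (rule map_permutation_compose_inv[OF bij \<pi>]) simp
    show "map_permutation {0..<n} Suc \<pi> \<in> {\<pi>. \<pi> permutes {1..n}}"
      using map_permutation_permutes[OF bij \<pi>] by simp
    have "(\<Prod>p\<in>{1..n}. M p (map_permutation {0..<n} Suc \<pi> p)) = (\<Prod>i=0..<n. ?A $$ (i, \<pi> i))"
      unfolding im[symmetric]
    proof (subst prod.reindex, simp, rule prod.cong[OF refl])
      fix i assume i: "i \<in> {0..<n}"
      then have "\<pi> i \<in> {0..<n}" using permutes_in_image[OF \<pi>, of i] by simp
      with i map_permutation_apply[of Suc "{0..<n}" i \<pi>]
      show "((\<lambda>p. M p (map_permutation {0..<n} Suc \<pi> p)) \<circ> Suc) i = ?A $$ (i, \<pi> i)" by simp
    qed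
    moreover have "sign (map_permutation {0..<n} Suc \<pi>) = sign \<pi>"
      by (rule sign_map_permutation) (use \<pi> in auto)
    ultimately show "of_int (sign (map_permutation {0..<n} Suc \<pi>)) *
        (\<Prod>p\<in>{1..n}. M p (map_permutation {0..<n} Suc \<pi> p)) =
        of_int (sign \<pi>) * (\<Prod>i=0..<n. ?A $$ (i, \<pi> i))"
      by simp
  next
    fix \<pi> assume "\<pi> \<in> {\<pi>. \<pi> permutes {1..n}}"
    then have \<pi>: "\<pi> permutes {1..n}" by simp
    show "map_permutation {0..<n} Suc (map_permutation {1..n} (\<lambda>k. k - 1) \<pi>) = \<pi>"
      by (rule map_permutation_compose_inv[OF bij' \<pi>]) auto
    show "map_permutation {1..n} (\<lambda>k. k - 1) \<pi> \<in> {\<pi>. \<pi> permutes {0..<n}}"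
      using map_permutation_permutes[OF bij' \<pi>] by simp
  qed
  finally show ?thesis by simp
qed

lemma detf_hom:
  assumes "comm_ring_hom h"
  shows "h (detf n M) = detf n (\<lambda>p q. h (M p q))"
proof -
  interpret comm_ring_hom h by fact
  show ?thesis by (simp add: detf_def hom_sum hom_mult hom_prod hom_of_int)
qed

lemma detf_scale_rows: "detf n (\<lambda>p q. c p * M p q) = (\<Prod>p\<in>{1..n}. c p) * detf n M"
  by (simp add: detf_def sum_distrib_left prod.distrib mult_ac)

lemma detf_swap_rows:
  assumes "i \<in> {1..n}" "j \<in> {1..n}" "i \<noteq> j"
  shows "detf n (\<lambda>p. M (transpose i j p)) = - detf n M"
proof -
  let ?t = "transpose i j"
  have t: "?t permutes {1..n}" by (rule permutes_swap_id[OF assms(1,2)])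
  have "detf n (\<lambda>p. M (?t p)) = (\<Sum>\<pi> \<in> {\<pi>. \<pi> permutes {1..n}}.
      of_int (sign (\<pi> \<circ> ?t)) * (\<Prod>p\<in>{1..n}. M (?t p) ((\<pi> \<circ> ?t) p)))"
    unfolding detf_def by (rule sum_permutations_compose_right[OF t])
  also have "\<dots> = (\<Sum>\<pi> \<in> {\<pi>. \<pi> permutes {1..n}}.
      - (of_int (sign \<pi>) * (\<Prod>p\<in>{1..n}. M p (\<pi> p))))"
  proof (rule sum.cong[OF refl])
    fix \<pi> assume "\<pi> \<in> {\<pi>. \<pi> permutes {1..n}}"
    then have "permutation \<pi>" by (auto intro: permutes_imp_permutation[of "{1..n}"])
    then have "sign (\<pi> \<circ> ?t) = - sign \<pi>"
      using assms(3) by (simp add: sign_compose permutation_swap_id sign_swap_id)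
    moreover have "(\<Prod>p\<in>{1..n}. M (?t p) ((\<pi> \<circ> ?t) p)) = (\<Prod>p\<in>{1..n}. M p (\<pi> p))"
      using prod.permute[OF t, of "\<lambda>p. M p (\<pi> p)"] by (simp add: o_def)
    ultimately show "of_int (sign (\<pi> \<circ> ?t)) * (\<Prod>p\<in>{1..n}. M (?t p) ((\<pi> \<circ> ?t) p)) =
        - (of_int (sign \<pi>) * (\<Prod>p\<in>{1..n}. M p (\<pi> p)))" by simp
  qed
  finally show ?thesis by (simp add: detf_def sum_negf)
qed

lemma eq_neg_imp_0:
  fixes x :: "'a::{idom,ring_char_0}"
  assumes "x = - x"
  shows "x = 0"
proof -
  from assms have "2 * x = 0" by (metis mult_2 add.right_inverse)
  then show ?thesis by simp
qed

lemma detf_proportional_rows: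
  fixes M :: "nat \<Rightarrow> nat \<Rightarrow> 'a::{idom,ring_char_0}"
  assumes ij: "i \<in> {1..n}" "j \<in> {1..n}" "i \<noteq> j"
    and M: "\<And>q. q \<in> {1..n} \<Longrightarrow> M i q = \<alpha> * w q" "\<And>q. q \<in> {1..n} \<Longrightarrow> M j q = \<beta> * w q"
  shows "detf n M = 0"
proof -
  \<comment> \<open>extract the factors of the two rows, which then become identical\<close>
  define c where "c = (\<lambda>p. if p = i then \<alpha> else if p = j then \<beta> else 1)"
  define M' where "M' = (\<lambda>p q. if p = i \<or> p = j then w q else M p q)"
  have "detf n M = detf n (\<lambda>p q. c p * M' p q)"
    by (rule detf_cong) (use M ij in \<open>auto simp: c_def M'_def\<close>)
  also have "\<dots> = (\<Prod>p\<in>{1..n}. c p) * detf n M'" by (rule detf_scale_rows)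
  also have "detf n M' = 0"
  proof (rule eq_neg_imp_0)
    have "(\<lambda>p. M' (transpose i j p)) = M'"
      by (auto simp: M'_def transpose_def fun_eq_iff)
    then show "detf n M' = - detf n M'" using detf_swap_rows[OF ij, of M'] by simp
  qed
  finally show ?thesis by simp
qed

lemma detf_zero_row:
  assumes "i \<in> {1..n}" "\<And>q. q \<in> {1..n} \<Longrightarrow> M i q = 0"
  shows "detf n M = 0"
proof -
  have "(\<Prod>p\<in>{1..n}. M p (\<pi> p)) = 0" if "\<pi> permutes {1..n}" for \<pi>
  proof (rule prod_zero)
    have "\<pi> i \<in> {1..n}" using that assms(1) permutes_in_image by metis
    with assms show "\<exists>p\<in>{1..n}. M p (\<pi> p) = 0" by blast
  qed simp
  then show ?thesis by (simp add: detf_def)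
qed

lemma detf_pigeonhole:
  assumes J: "J \<subseteq> {1..n}" "card J > a"
    and M: "\<And>p q. p \<in> J \<Longrightarrow> q \<in> {1..n} \<Longrightarrow> a < q \<Longrightarrow> M p q = 0"
  shows "detf n M = 0"
proof -
  have "(\<Prod>p\<in>{1..n}. M p (\<pi> p)) = 0" if \<pi>: "\<pi> permutes {1..n}" for \<pi>
  proof (rule prod_zero)
    have "\<not> \<pi> ` J \<subseteq> {1..a}"
    proof
      assume "\<pi> ` J \<subseteq> {1..a}"
      then have "card (\<pi> ` J) \<le> card {1..a}" by (intro card_mono) auto
      moreover have "card (\<pi> ` J) = card J"
        by (rule card_image) (rule inj_on_subset[OF permutes_inj[OF \<pi>]], simp)
      ultimately show False using J(2) by simp
    qed
    then obtain p where p: "p \<in> J" "\<pi> p \<notin> {1..a}" by blast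
    moreover have "\<pi> p \<in> {1..n}" using p J(1) permutes_in_image[OF \<pi>, of p] by blast
    ultimately have "M p (\<pi> p) = 0" by (intro M) auto
    with p(1) J(1) show "\<exists>p\<in>{1..n}. M p (\<pi> p) = 0" by blast
  qed simp
  then show ?thesis by (simp add: detf_def)
qed

lemma detf_block:
  fixes M :: "nat \<Rightarrow> nat \<Rightarrow> 'a::idom"
  assumes "\<And>p q. p \<in> {1..a} \<Longrightarrow> q \<in> {a + 1..a + b} \<Longrightarrow> M p q = 0"
  shows "detf (a + b) M = detf a M * detf b (\<lambda>p q. M (a + p) (a + q))"
proof -
  let ?A = "mat a a (\<lambda>(i, j). M (Suc i) (Suc j))"
  let ?B = "mat a b (\<lambda>(i, j). M (Suc i) (a + Suc j))"
  let ?C = "mat b a (\<lambda>(i, j). M (a + Suc i) (Suc j))"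
  let ?D = "mat b b (\<lambda>(i, j). M (a + Suc i) (a + Suc j))"
  have "mat (a + b) (a + b) (\<lambda>(i, j). M (Suc i) (Suc j)) = four_block_mat ?A ?B ?C ?D"
    by (rule eq_matI) (auto simp: four_block_mat_def Let_def)
  moreover have "det (four_block_mat ?A ?B ?C ?D) = det ?A * det ?D"
  proof (rule det_four_block_mat_upper_right_zero)
    show "?B = 0\<^sub>m a b" by (rule eq_matI) (auto simp: assms)
  qed auto
  ultimately show ?thesis by (simp add: detf_eq_det)
qed

text \<open>
  Subtracting the first columns from the columns in the second block is multiplication by a
  unipotent matrix.
\<close>

lemma detf_subtract_columns:
  fixes M :: "nat \<Rightarrow> nat \<Rightarrow> 'a::comm_ring_1"
  assumes "n \<le> a + a"
  shows "detf n M = detf n (\<lambda>p q. if a < q then M p q - M p (q - a) else M p q)"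
proof -
  define U where "U = mat n n (\<lambda>(i, j). (if i = j then 1 else if j = i + a then -1 else 0) :: 'a)"
  show ?thesis
  proof (cases "a = 0")
    case True
    with assms have "n = 0" by simp
    then show ?thesis by (simp add: detf_def)
  next
    case False
    let ?A = "mat n n (\<lambda>(i, j). M (Suc i) (Suc j))"
    let ?B = "mat n n (\<lambda>(i, j). if a < Suc j then M (Suc i) (Suc j) - M (Suc i) (Suc j - a) else M (Suc i) (Suc j))"
    have U: "U \<in> carrier_mat n n" by (simp add: U_def)
    have "det U = prod_list (diag_mat U)"
      by (rule det_upper_triangular[OF _ U]) (auto simp: U_def)
    also have "diag_mat U = replicate n 1"
      by (rule nth_equalityI) (auto simp: diag_mat_def U_def)
    finally have detU: "det U = 1" by simp
    have "?A * U = ?B"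
    proof (rule eq_matI)
      fix i j assume "i < dim_row ?B" "j < dim_col ?B"
      then have ij: "i < n" "j < n" by auto
      have "(?A * U) $$ (i, j) = (\<Sum>k = 0..<n. M (Suc i) (Suc k) * U $$ (k, j))"
        using ij by (simp add: scalar_prod_def U_def)
      also have "\<dots> = (\<Sum>k = 0..<n. (if k = j then M (Suc i) (Suc k) else 0)
          - (if k + a = j then M (Suc i) (Suc k) else 0))"
        by (rule sum.cong) (use ij False in \<open>auto simp: U_def\<close>)
      also have "\<dots> = M (Suc i) (Suc j) - (\<Sum>k = 0..<n. if k + a = j then M (Suc i) (Suc k) else 0)"
        using ij by (simp add: sum_subtractf)
      also have "(\<Sum>k = 0..<n. if k + a = j then M (Suc i) (Suc k) else 0) =
          (if a \<le> j then M (Suc i) (Suc j - a) else 0)"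
      proof (cases "a \<le> j")
        case True
        then have "(\<lambda>k. k + a = j) = (\<lambda>k. k = j - a)" by (auto simp: fun_eq_iff)
        then have "(\<Sum>k = 0..<n. if k + a = j then M (Suc i) (Suc k) else 0) =
            (\<Sum>k = 0..<n. if k = j - a then M (Suc i) (Suc k) else 0)" by metis
        also have "\<dots> = M (Suc i) (Suc (j - a))" using ij by simp
        finally show ?thesis using True by (simp add: Suc_diff_le)
      qed simp
      finally show "(?A * U) $$ (i, j) = ?B $$ (i, j)" using ij by auto
    qed (auto simp: U_def)
    moreover have "det (?A * U) = det ?A * det U" by (rule det_mult[OF _ U]) simp
    ultimately show ?thesis by (simp add: detf_eq_det detU)
  qed
qed

section \<open>Vandermonde determinants\<close>

definition pairs :: "nat \<Rightarrow> (nat \<times> nat) set"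
  where "pairs a = {(i, j). 1 \<le> i \<and> i < j \<and> j \<le> a}"

lemma pairs_Sigma: "pairs a = Sigma {1..a} (\<lambda>i. {i<..a})"
  by (auto simp: pairs_def)

lemma finite_pairs [simp]: "finite (pairs a)"
  by (simp add: pairs_Sigma)

lemma card_pairs: "card (pairs a) = (\<Sum>i\<in>{1..a}. a - i)"
  by (simp add: pairs_Sigma)

text \<open>
  Expanding the monic polynomials in powers multiplies the matrix of powers by a unitriangular one.
\<close>

lemma detf_monic_powers:
  fixes P :: "nat \<Rightarrow> 'a::comm_ring_1 poly"
  assumes P: "\<And>j. j \<in> {1..a} \<Longrightarrow> degree (P j) \<le> a - j" "\<And>j. j \<in> {1..a} \<Longrightarrow> coeff (P j) (a - j) = 1"
  shows "detf a (\<lambda>i j. poly (P j) (x i)) = detf a (\<lambda>i j. x i ^ (a - j))"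
proof -
  define U where "U = mat a a (\<lambda>(k, j). coeff (P (Suc j)) (a - Suc k))"
  let ?A = "mat a a (\<lambda>(i, j). x (Suc i) ^ (a - Suc j))"
  let ?B = "mat a a (\<lambda>(i, j). poly (P (Suc j)) (x (Suc i)))"
  have U: "U \<in> carrier_mat a a" by (simp add: U_def)
  have "det U = prod_list (diag_mat U)"
  proof (rule det_lower_triangular[OF _ U])
    fix i j assume "i < j" "j < a"
    then show "U $$ (i, j) = 0"
      using P(1)[of "Suc j"] by (auto simp: U_def intro!: coeff_eq_0)
  qed
  also have "diag_mat U = replicate a 1"
    by (rule nth_equalityI) (auto simp: diag_mat_def U_def P(2))
  finally have detU: "det U = 1" by simp
  have "?A * U = ?B"
  proof (rule eq_matI)
    fix i j assume "i < dim_row ?B" "j < dim_col ?B"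
    then have ij: "i < a" "j < a" by auto
    have "(?A * U) $$ (i, j) = (\<Sum>k = 0..<a. x (Suc i) ^ (a - Suc k) * coeff (P (Suc j)) (a - Suc k))"
      using ij by (simp add: scalar_prod_def U_def)
    also have "\<dots> = (\<Sum>k<a. x (Suc i) ^ k * coeff (P (Suc j)) k)"
      unfolding lessThan_atLeast0
      by (rule sum.reindex_bij_witness[where i = "\<lambda>k. a - Suc k" and j = "\<lambda>k. a - Suc k"]) auto
    also have "\<dots> = (\<Sum>k\<le>degree (P (Suc j)). x (Suc i) ^ k * coeff (P (Suc j)) k)"
      by (rule sum.mono_neutral_right) (use P(1)[of "Suc j"] ij in \<open>auto simp: coeff_eq_0\<close>)
    finally show "(?A * U) $$ (i, j) = ?B $$ (i, j)"
      using ij by (simp add: poly_altdef mult.commute)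
  qed (auto simp: U_def)
  moreover have "det (?A * U) = det ?A * det U" by (rule det_mult[OF _ U]) simp
  ultimately show ?thesis by (simp add: detf_eq_det detU)
qed

text \<open>
  By \<open>detf_monic_powers\<close> the determinant is the same for every family of monic polynomials of these
  degrees. For \<open>Q\<^sub>j = \<Prod>\<^sub>k\<^sub>>\<^sub>j (X - x\<^sub>k)\<close> the matrix is triangular, and its diagonal is the product.
\<close>

lemma detf_vandermonde:
  fixes P :: "nat \<Rightarrow> 'a::idom poly"
  assumes P: "\<And>j. j \<in> {1..a} \<Longrightarrow> degree (P j) \<le> a - j" "\<And>j. j \<in> {1..a} \<Longrightarrow> coeff (P j) (a - j) = 1"
  shows "detf a (\<lambda>i j. poly (P j) (x i)) = (\<Prod>(i, j)\<in>pairs a. x i - x j)"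
proof -
  define Q where "Q j = (\<Prod>k\<in>{j<..a}. [:- x k, 1:])" for j
  have degQ: "degree (Q j) = a - j" for j
    unfolding Q_def by (subst degree_prod_eq_sum_degree) auto
  have "lead_coeff (Q j) = 1" for j
    unfolding Q_def by (simp add: lead_coeff_prod)
  then have lcQ: "coeff (Q j) (a - j) = 1" for j using degQ[of j] by metis
  have polyQ: "poly (Q j) y = (\<Prod>k\<in>{j<..a}. y - x k)" for j y
    by (simp add: Q_def poly_prod)
  have "detf a (\<lambda>i j. poly (P j) (x i)) = detf a (\<lambda>i j. poly (Q j) (x i))"
    using detf_monic_powers[of a P x] detf_monic_powers[of a Q x] P degQ lcQ by simp
  also have "\<dots> = (\<Prod>i\<in>{1..a}. poly (Q i) (x i))"
  proof -
    let ?A = "mat a a (\<lambda>(i, j). poly (Q (Suc j)) (x (Suc i)))"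
    have "det ?A = prod_list (diag_mat ?A)"
    proof (rule det_upper_triangular[where n = a])
      show "upper_triangular ?A"
      proof (rule upper_triangularI)
        fix i j assume "j < i" "i < dim_row ?A"
        then show "?A $$ (i, j) = 0" by (auto simp: polyQ intro!: prod_zero)
      qed
    qed simp
    also have "\<dots> = (\<Prod>i = 0..<a. poly (Q (Suc i)) (x (Suc i)))"
      unfolding diag_mat_def by (simp add: prod.list_conv_set_nth)
    also have "\<dots> = (\<Prod>i\<in>{1..a}. poly (Q i) (x i))"
      by (rule prod.reindex_bij_witness[where i = "\<lambda>k. k - 1" and j = Suc]) auto
    finally show ?thesis by (simp add: detf_eq_det)
  qed
  also have "\<dots> = (\<Prod>(i, j)\<in>pairs a. x i - x j)"
    unfolding pairs_Sigma polyQ by (subst prod.Sigma) auto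
  finally show ?thesis .
qed

definition parity_pairs :: "nat \<Rightarrow> (nat \<times> nat) set"
  where "parity_pairs n = {(i, j). 1 \<le> i \<and> i < j \<and> j \<le> n \<and> even (j - i)}"

text \<open>
  The Vandermonde product at arbitrary ring elements: in the variables it is the polynomial by which
  the determinants are divided, and at a node it is the value of that polynomial.
\<close>

definition vdm :: "nat \<Rightarrow> (nat \<Rightarrow> 'b::comm_ring_1) \<Rightarrow> 'b"
  where "vdm n x = (\<Prod>(i, j)\<in>parity_pairs n. x i - x j)"

lemma vandermonde_eq: "vandermonde n = vdm n zvar"
  by (simp add: vandermonde_def vdm_def parity_pairs_def)

lemma halves: "upper_half n + lower_half n = n"
  unfolding upper_half_def lower_half_def by presburger

lemma parity_pairs_split:
  "parity_pairs n = (\<lambda>(i, j). (2 * i - 1, 2 * j - 1)) ` pairs (upper_half n)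
    \<union> (\<lambda>(i, j). (2 * i, 2 * j)) ` pairs (lower_half n)" (is "_ = ?O \<union> ?E")
proof (intro equalityI subsetI)
  fix z assume "z \<in> parity_pairs n"
  then obtain i j where z: "z = (i, j)" and ij: "1 \<le> i" "i < j" "j \<le> n" "even (j - i)"
    by (auto simp: parity_pairs_def)
  show "z \<in> ?O \<union> ?E"
  proof (cases "even i")
    case True
    then have "even j" using ij by simp
    with True ij have "(i div 2, j div 2) \<in> pairs (lower_half n)"
      unfolding pairs_def lower_half_def by auto
    moreover have "z = (\<lambda>(i, j). (2 * i, 2 * j)) (i div 2, j div 2)" using True \<open>even j\<close> z by simp
    ultimately show ?thesis by blast
  next
    case False
    then have "odd j" using ij by simp
    with False ij have "((i + 1) div 2, (j + 1) div 2) \<in> pairs (upper_half n)"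
      unfolding pairs_def upper_half_def by (auto elim!: oddE)
    moreover have "z = (\<lambda>(i, j). (2 * i - 1, 2 * j - 1)) ((i + 1) div 2, (j + 1) div 2)"
      using False \<open>odd j\<close> z by simp
    ultimately show ?thesis by blast
  qed
next
  fix z assume "z \<in> ?O \<union> ?E"
  then show "z \<in> parity_pairs n"
    unfolding parity_pairs_def pairs_def upper_half_def lower_half_def by auto
qed

lemma prod_parity_pairs:
  "(\<Prod>z\<in>parity_pairs n. F z) = (\<Prod>(i, j)\<in>pairs (upper_half n). F (2 * i - 1, 2 * j - 1))
    * (\<Prod>(i, j)\<in>pairs (lower_half n). F (2 * i, 2 * j))" for F :: "_ \<Rightarrow> 'b::comm_monoid_mult"
proof -
  have inj: "inj_on (\<lambda>(i, j). (2 * i - 1, 2 * j - 1)) (pairs a)"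
      "inj_on (\<lambda>(i, j). (2 * i, 2 * j)) (pairs a)" for a :: nat
    by (auto simp: inj_on_def pairs_def)
  have dj: "(\<lambda>(i, j). (2 * i - 1, 2 * j - 1)) ` pairs (upper_half n)
      \<inter> (\<lambda>(i, j). (2 * i, 2 * j)) ` pairs (lower_half n) = {}"
  proof -
    have "2 * i - 1 \<noteq> 2 * k" if "1 \<le> i" for i k :: nat using that by presburger
    then show ?thesis by (auto simp: pairs_def)
  qed
  have "prod F ((\<lambda>(i, j). (2 * i - 1, 2 * j - 1)) ` pairs a) = (\<Prod>(i, j)\<in>pairs a. F (2 * i - 1, 2 * j - 1))"
      "prod F ((\<lambda>(i, j). (2 * i, 2 * j)) ` pairs a) = (\<Prod>(i, j)\<in>pairs a. F (2 * i, 2 * j))" for a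
    by (subst prod.reindex[OF inj(1)] prod.reindex[OF inj(2)]; simp add: o_def case_prod_beta)+
  then show ?thesis
    unfolding parity_pairs_split by (subst prod.union_disjoint[OF _ _ dj]) auto
qed

lemma finite_parity_pairs [simp]: "finite (parity_pairs n)"
  unfolding parity_pairs_split by simp

text \<open>
  The variable of a row of the block matrices: the rows of the odd variables precede those of the even
  ones.
\<close>

definition row_var :: "nat \<Rightarrow> nat \<Rightarrow> nat"
  where "row_var n p = (if p \<le> upper_half n then 2 * p - 1 else 2 * (p - upper_half n))"

lemma vdm_block:
  fixes P Q :: "nat \<Rightarrow> 'a::idom poly"
  assumes ab: "a = upper_half n" "b = lower_half n"
    and P: "\<And>j. j \<in> {1..a} \<Longrightarrow> degree (P j) \<le> a - j" "\<And>j. j \<in> {1..a} \<Longrightarrow> coeff (P j) (a - j) = 1"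
    and Q: "\<And>j. j \<in> {1..b} \<Longrightarrow> degree (Q j) \<le> b - j" "\<And>j. j \<in> {1..b} \<Longrightarrow> coeff (Q j) (b - j) = 1"
    and M: "\<And>p q. p \<in> {1..a} \<Longrightarrow> q \<in> {1..a} \<Longrightarrow> M p q = poly (P q) (x (row_var n p))"
      "\<And>p q. p \<in> {1..a} \<Longrightarrow> q \<in> {a + 1..n} \<Longrightarrow> M p q = 0"
      "\<And>p q. p \<in> {a + 1..n} \<Longrightarrow> q \<in> {a + 1..n} \<Longrightarrow> M p q = poly (Q (q - a)) (x (row_var n p))"
  shows "detf n M = vdm n x"
proof -
  have n: "n = a + b" using halves[of n] ab by simp
  have "detf n M = detf a M * detf b (\<lambda>p q. M (a + p) (a + q))"
    unfolding n by (rule detf_block) (use M(2) n in simp)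
  also have "detf a M = detf a (\<lambda>i j. poly (P j) (x (2 * i - 1)))"
    by (rule detf_cong) (simp add: M(1) row_var_def ab(1)[symmetric])
  also have "\<dots> = (\<Prod>(i, j)\<in>pairs a. x (2 * i - 1) - x (2 * j - 1))"
    by (rule detf_vandermonde[OF P])
  also have "detf b (\<lambda>p q. M (a + p) (a + q)) = detf b (\<lambda>i j. poly (Q j) (x (2 * i)))"
  proof (rule detf_cong)
    fix p q assume pq: "p \<in> {1..b}" "q \<in> {1..b}"
    then have "row_var n (a + p) = 2 * p"
      unfolding row_var_def ab(1)[symmetric] by simp
    moreover have "a + p \<in> {a + 1..n}" "a + q \<in> {a + 1..n}" using pq n by auto
    ultimately show "M (a + p) (a + q) = poly (Q q) (x (2 * p))"
      by (simp add: M(3))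
  qed
  also have "\<dots> = (\<Prod>(i, j)\<in>pairs b. x (2 * i) - x (2 * j))"
    by (rule detf_vandermonde[OF Q])
  finally show ?thesis
    unfolding vdm_def prod_parity_pairs ab by simp
qed

lemma vdm_hom: "comm_ring_hom h \<Longrightarrow> h (vdm n x) = vdm n (\<lambda>i. h (x i))"
proof -
  assume "comm_ring_hom h"
  then interpret comm_ring_hom h .
  show ?thesis by (simp add: vdm_def hom_prod hom_minus case_prod_beta)
qed

lemma row_var_in: "p \<in> {1..n} \<Longrightarrow> row_var n p \<in> {1..n}"
  unfolding row_var_def upper_half_def by auto

lemma row_var_parity: "p \<in> {1..n} \<Longrightarrow> odd (row_var n p) \<longleftrightarrow> p \<le> upper_half n"
  unfolding row_var_def by auto

lemma row_var_inj: "inj_on (row_var n) {1..n}"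
proof (rule inj_onI)
  fix p q assume pq: "p \<in> {1..n}" "q \<in> {1..n}" "row_var n p = row_var n q"
  then have "p \<le> upper_half n \<longleftrightarrow> q \<le> upper_half n"
    using row_var_parity by metis
  with pq show "p = q" by (auto simp: row_var_def split: if_splits)
qed

lemma row_var_image: "row_var n ` {1..n} = {1..n}"
  by (rule endo_inj_surj) (use row_var_in row_var_inj in auto)

lemma row_var_bij: "bij_betw (row_var n) {1..n} {1..n}"
  using row_var_image row_var_inj by (simp add: bij_betw_def)

text \<open>
  Writing the product as a determinant makes the sign that of exchanging two rows.
\<close>

lemma vdm_antisym:
  fixes x :: "nat \<Rightarrow> 'a::idom"
  assumes ij: "i \<in> {1..n}" "j \<in> {1..n}" "i \<noteq> j" "even (i + j)"
  shows "vdm n (\<lambda>k. x (transpose i j k)) = - vdm n x"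
proof -
  define a b where "a = upper_half n" and "b = lower_half n"
  define M where "M x p q = (if p \<le> a then if q \<le> a then x (row_var n p) ^ (a - q) else 0
    else if q \<le> a then 0 else x (row_var n p) ^ (b - (q - a)))" for x :: "nat \<Rightarrow> 'a" and p q
  have M: "detf n (M x) = vdm n x" for x
    by (rule vdm_block[OF a_def b_def, where P = "\<lambda>j. monom 1 (a - j)" and Q = "\<lambda>j. monom 1 (b - j)"])
      (auto simp: M_def degree_monom_le poly_monom)
  obtain p q where pq: "p \<in> {1..n}" "q \<in> {1..n}" "row_var n p = i" "row_var n q = j"
    using ij(1,2) row_var_image[of n] by (metis imageE)
  have "p \<noteq> q" using pq ij(3) by auto
  have par: "p \<le> a \<longleftrightarrow> q \<le> a"
    using row_var_parity[OF pq(1)] row_var_parity[OF pq(2)] pq(3,4) ij(4) by (auto simp: a_def)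
  have "M (\<lambda>k. x (transpose i j k)) k l = M x (transpose p q k) l" if "k \<in> {1..n}" for k l
  proof -
    have "row_var n (transpose p q k) = transpose i j (row_var n k)"
      using inj_on_eq_iff[OF row_var_inj that] pq that
      by (auto simp: transpose_def)
    moreover have "transpose p q k \<le> a \<longleftrightarrow> k \<le> a" using par by (auto simp: transpose_def)
    ultimately show ?thesis by (simp add: M_def)
  qed
  then have "detf n (M (\<lambda>k. x (transpose i j k))) = detf n (\<lambda>k. M x (transpose p q k))"
    by (intro detf_cong) auto
  then show ?thesis using detf_swap_rows[OF pq(1,2) \<open>p \<noteq> q\<close>, of "M x"] by (simp add: M)
qed

lemma vdm_zvar_nonzero: "vdm n zvar \<noteq> (0 :: 'a::idom mpol)"
proof -
  have "zvar i - zvar j \<noteq> (0 :: 'a mpol)" if "i \<noteq> j" for i j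
  proof
    assume "zvar i - zvar j = (0 :: 'a mpol)"
    then have "eval_at (\<lambda>k. if k = i then 1 else 0) (zvar i - zvar j :: 'a mpol) = 0" by simp
    then show False using that by (simp add: eval_at.hom_minus)
  qed
  then show ?thesis by (auto simp: vdm_def parity_pairs_def[symmetric]) (auto simp: parity_pairs_def)
qed

text \<open>
  Identifying \<open>z\<^sub>i\<close> with \<open>z\<^sub>j\<close> turns antisymmetry into \<open>h = - h\<close>, so each linear factor divides \<open>h\<close>.
\<close>

lemma vdm_dvd:
  fixes h :: "'a::{idom,ring_char_0} mpol"
  assumes h: "\<And>i j. i \<in> {1..n} \<Longrightarrow> j \<in> {1..n} \<Longrightarrow> i \<noteq> j \<Longrightarrow> even (i + j) \<Longrightarrow>
    swap_vars i j h = - h"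
  shows "vdm n zvar dvd h"
proof -
  have "(\<Prod>z\<in>parity_pairs n. zvar (fst z) - zvar (snd z)) dvd h"
  proof (rule prod_linear_dvd)
    fix z assume "z \<in> parity_pairs n"
    then obtain i j where z: "z = (i, j)" and ij: "i \<in> {1..n}" "j \<in> {1..n}" "i \<noteq> j" "even (i + j)"
      by (auto simp: parity_pairs_def)
    let ?s = "subst (zvar(i := zvar j))"
    have "?s (swap_vars i j h) = ?s h"
      unfolding subst_subst
      by (rule arg_cong[of _ _ "\<lambda>s. subst s h"]) (auto simp: const_hom transpose_def)
    then have "?s h = - ?s h" by (simp add: h[OF ij] subst.hom_uminus)
    from eq_neg_imp_0[OF this] show "subst (zvar(fst z := zvar (snd z))) h = 0" by (simp add: z)
  next
    fix z z' assume z: "z \<in> parity_pairs n" "z' \<in> parity_pairs n" "z \<noteq> z'"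
    obtain i j k l where zz: "z = (i, j)" "z' = (k, l)" by (metis surj_pair)
    have lt: "i < j" "k < l" using z zz by (auto simp: parity_pairs_def)
    \<comment> \<open>identifying \<open>i\<close> with \<open>j\<close> leaves the indices of any other pair distinct\<close>
    define c :: "nat \<Rightarrow> 'a" where "c m = of_nat (if m = i then j else m)" for m
    have "eval_at (\<lambda>m. of_nat m) (subst (zvar(i := zvar j)) (zvar k - zvar l)) = c k - c l"
      by (auto simp: subst.hom_minus eval_at.hom_minus const_hom c_def)
    moreover have "c k \<noteq> c l"
      using z(3) zz lt by (auto simp: c_def)
    ultimately show "subst (zvar(fst z := zvar (snd z))) (zvar (fst z') - zvar (snd z')) \<noteq> (0 :: 'a mpol)"
      unfolding zz by auto
  qed simp
  then show ?thesis by (simp add: vdm_def case_prod_beta)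
qed

lemma vdm_zvar_polys: "vdm n zvar \<in> polys n"
  unfolding vdm_def by (intro polys_prod) (auto simp: parity_pairs_def intro!: polys_diff polys_zvar)

lemma lead_vdm: "lead (int (card (parity_pairs n))) (vdm n zvar) (vdm n zvar)"
proof -
  have "lead 1 (case z of (i, j) \<Rightarrow> zvar i - zvar j) (case z of (i, j) \<Rightarrow> zvar i - zvar j)" for z
    by (auto split: prod.split intro!: lead_diff lead_zvar)
  from lead_prod[where D = "\<lambda>_. 1" and S = "parity_pairs n", OF this] show ?thesis
    by (simp add: vdm_def)
qed

text \<open>
  Counting by evaluating products of the constant 2, so that \<open>prod_parity_pairs\<close> can be used.
\<close>

lemma card_parity_pairs:
  "card (parity_pairs n) = (\<Sum>j\<in>{1..upper_half n}. upper_half n - j) + (\<Sum>j\<in>{1..lower_half n}. lower_half n - j)"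
proof -
  have "(2::nat) ^ card (parity_pairs n) = 2 ^ card (pairs (upper_half n)) * 2 ^ card (pairs (lower_half n))"
    using prod_parity_pairs[of "\<lambda>_. 2::nat" n] by (simp add: case_prod_beta)
  then have "(2::nat) ^ card (parity_pairs n) = 2 ^ (card (pairs (upper_half n)) + card (pairs (lower_half n)))"
    by (simp add: power_add)
  then show ?thesis unfolding card_pairs[symmetric] by (simp only: power_inject_exp one_less_numeral_iff semiring_norm)
qed

section \<open>Determinants of difference operators\<close>

definition ev :: "'a::comm_ring_1 poly \<Rightarrow> 'a mpol \<Rightarrow> 'a mpol"
  where "ev p x = (\<Sum>i\<le>degree p. const (coeff p i) * x ^ i)"

lemma ev_superset:
  assumes "degree p \<le> e"
  shows "ev p x = (\<Sum>i\<le>e. const (coeff p i) * x ^ i)"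
  unfolding ev_def
  by (rule sum.mono_neutral_left) (use assms in \<open>auto simp: coeff_eq_0\<close>)

lemma ev_diff: "ev (p - q) x = ev p x - ev q x"
proof -
  let ?e = "max (degree p) (degree q)"
  have "degree (p - q) \<le> ?e" by (rule degree_diff_le_max)
  then show ?thesis
    by (simp add: ev_superset[of _ ?e] const.hom_minus left_diff_distrib sum_subtractf)
qed

lemma hom_ev:
  assumes "comm_ring_hom h" "\<And>c. h (const c) = const c"
  shows "h (ev p x) = ev p (h x)"
proof -
  interpret comm_ring_hom h by fact
  show ?thesis by (simp add: ev_def hom_sum hom_mult hom_power assms(2))
qed

lemma subst_ev: "subst s (ev p x) = ev p (subst s x)"
  by (rule hom_ev[OF subst_hom]) (simp add: const_hom)

lemma eval_at_ev: "eval_at a (ev p x) = poly p (eval_at a x)"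
  by (simp add: ev_def eval_at.hom_sum eval_at.hom_mult eval_at.hom_power poly_altdef)

lemma polys_ev: "x \<in> polys n \<Longrightarrow> ev p x \<in> polys n"
  unfolding ev_def by (intro polys_sum polys_mult polys_power polys_const)

lemma lead_ev:
  assumes "degree p \<le> e"
  shows "lead (int e) (ev p (zvar i)) (const (coeff p e) * zvar i ^ e)"
proof -
  have l: "lead (int k) (const c * zvar i ^ k) (const c * zvar i ^ k)" for k and c :: 'a
    using lead_const_mult[OF lead_power[OF lead_zvar[of i], of k], of c] by simp
  have "{..e} = insert e {..<e}" by auto
  then have "ev p (zvar i) = const (coeff p e) * zvar i ^ e + (\<Sum>k<e. const (coeff p k) * zvar i ^ k)"
    unfolding ev_superset[OF assms] by simp
  moreover have "deg_in {..<int e} (\<Sum>k<e. const (coeff p k) * zvar i ^ k)"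
  proof (rule deg_in_sum)
    fix k assume "k \<in> {..<e}"
    then show "deg_in {..<int e} (const (coeff p k) * zvar i ^ k)"
      by (intro deg_in_mono[OF lead_le[OF l]]) auto
  qed
  ultimately show ?thesis using lead_add[OF l lead_low] by fastforce
qed

text \<open>
  The operator \<open>P - Q T\<close> in the variable with index \<open>v\<close>, where \<open>T\<close> is the unit shift.
\<close>

definition dop :: "'a::comm_ring_1 poly \<Rightarrow> 'a poly \<Rightarrow> nat \<Rightarrow> 'a mpol \<Rightarrow> 'a mpol"
  where "dop P Q v F = ev P (zvar v) * F - ev Q (zvar v) * shift v F"

text \<open>
  The operator \<open>c z\<^sup>e + c' z\<^sup>e' \<partial>\<close>. Every entry of the two matrices of differential
  operators has this form once \<open>t\<close> has a value.
\<close>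

definition sym_op :: "'a::comm_ring_1 \<Rightarrow> nat \<Rightarrow> 'a \<Rightarrow> nat \<Rightarrow> nat \<Rightarrow> 'a mpol \<Rightarrow> 'a mpol"
  where "sym_op c e c' e' v G =
    const c * zvar v ^ e * G + const c' * zvar v ^ e' * pdiff v G"

lemma lead_dop_order_0:
  assumes "degree P \<le> e" "degree Q \<le> e" "lead d F G"
  shows "lead (int e + d) (dop P Q v F) (sym_op (coeff P e - coeff Q e) e 0 e' v G)"
proof -
  have "lead (int e + d) (dop P Q v F)
      (const (coeff P e) * zvar v ^ e * G - const (coeff Q e) * zvar v ^ e * G)"
    unfolding dop_def
    by (intro lead_diff lead_mult lead_ev lead_shift assms)
  then show ?thesis by (simp add: sym_op_def const.hom_minus left_diff_distrib)
qed

text \<open>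
  If the leading terms of \<open>P\<close> and \<open>Q\<close> agree, write \<open>P - Q T = (P - Q) + Q (1 - T)\<close>: both summands
  raise the degree by \<open>e - 1\<close> only, and \<open>1 - T\<close> acts as the derivative to leading order. For
  \<open>e = 0\<close> the first summand is required to be absent, since its exponent \<open>e - 1\<close> is truncated.
\<close>

lemma lead_dop_order_1:
  assumes "degree Q \<le> e" "degree (P - Q) \<le> e - 1" "e = 0 \<Longrightarrow> P = Q" "lead d F G"
  shows "lead (int e - 1 + d) (dop P Q v F) (sym_op (coeff (P - Q) (e - 1)) (e - 1) (coeff Q e) e v G)"
proof -
  have eq: "dop P Q v F = ev (P - Q) (zvar v) * F + ev Q (zvar v) * (F - shift v F)"
    by (simp add: dop_def ev_diff algebra_simps)
  have "lead (int e + (d - 1)) (ev Q (zvar v) * (F - shift v F)) (const (coeff Q e) * zvar v ^ e * pdiff v G)"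
    by (intro lead_mult lead_ev lead_diff_shift assms)
  then have 1: "lead (int e - 1 + d) (ev Q (zvar v) * (F - shift v F)) (const (coeff Q e) * zvar v ^ e * pdiff v G)"
    by (simp add: algebra_simps)
  have 2: "lead (int e - 1 + d) (ev (P - Q) (zvar v) * F) (const (coeff (P - Q) (e - 1)) * zvar v ^ (e - 1) * G)"
  proof (cases "e = 0")
    case True
    with assms(3) show ?thesis by (simp add: ev_def)
  next
    case False
    then have "int e - 1 = int (e - 1)" by simp
    then show ?thesis by (simp only:) (intro lead_mult lead_ev assms)
  qed
  show ?thesis unfolding eq sym_op_def by (rule lead_add[OF 2 1])
qed

definition shifts :: "nat set \<Rightarrow> 'a::comm_ring_1 mpol \<Rightarrow> 'a mpol"
  where "shifts I = subst (\<lambda>i. zvar i - (if i \<in> I then 1 else 0))"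

lemma shifts_empty [simp]: "shifts {} F = F"
  by (simp add: shifts_def)

lemma shift_shifts:
  assumes "v \<notin> I"
  shows "shift v (shifts I F) = shifts (insert v I) F"
  unfolding shift_def shifts_def subst_subst
  by (rule arg_cong[of _ _ "\<lambda>s. subst s F"])
    (use assms in \<open>auto simp: fun_eq_iff subst.hom_minus const_hom\<close>)

lemma eval_at_shifts: "eval_at a (shifts I F) = eval_at (\<lambda>i. a i - (if i \<in> I then 1 else 0)) F"
  unfolding shifts_def eval_at_subst
  by (rule arg_cong[of _ _ "\<lambda>s. eval_at s F"]) (auto simp: fun_eq_iff eval_at.hom_minus)

definition row_coeff :: "('a::comm_ring_1 poly) \<Rightarrow> 'a poly \<Rightarrow> nat \<Rightarrow> nat set \<Rightarrow> 'a mpol"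
  where "row_coeff P Q v I = (if v \<in> I then - ev Q (zvar v) else ev P (zvar v))"

lemma shift_row_coeff: "v \<noteq> w \<Longrightarrow> shift v (row_coeff P Q w I) = row_coeff P Q w I"
  by (simp add: row_coeff_def hom_ev[OF shift_hom] shift_zvar shift.hom_uminus)

text \<open>
  The operators act on distinct variables, so a shift passes through the coefficients of the other
  rows, and each row contributes either \<open>P\<close> or \<open>- Q\<close> with its shift.
\<close>

lemma foldr_dop:
  assumes "distinct ps" "inj_on v (set ps)"
  shows "foldr (\<lambda>p. dop (P p) (Q p) (v p)) ps F =
    (\<Sum>I\<in>Pow (v ` set ps). (\<Prod>p\<in>set ps. row_coeff (P p) (Q p) (v p) I) * shifts I F)"
  using assms
proof (induction ps)
  case (Cons p ps)
  let ?B = "v ` set ps"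
  let ?A = "\<lambda>I. \<Prod>p\<in>set ps. row_coeff (P p) (Q p) (v p) I"
  have p: "p \<notin> set ps" "v p \<notin> ?B" using Cons.prems by auto
  have vp: "v p' \<noteq> v p" if "p' \<in> set ps" for p' using p(2) that by (metis imageI)
  have out: "v p \<notin> I" if "I \<in> Pow ?B" for I using p(2) that by blast
  have IH: "foldr (\<lambda>p. dop (P p) (Q p) (v p)) ps F = (\<Sum>I\<in>Pow ?B. ?A I * shifts I F)"
    using Cons by simp
  have A1: "shift (v p) (?A I) = ?A I" for I
    unfolding shift.hom_prod by (intro prod.cong refl shift_row_coeff) (metis vp)
  have A2: "?A (insert (v p) I) = ?A I" for I
    by (rule prod.cong) (use vp in \<open>auto simp: row_coeff_def\<close>)
  have Pow: "Pow (v ` set (p # ps)) = Pow ?B \<union> insert (v p) ` Pow ?B"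
    by (simp add: Pow_insert)
  have inj: "inj_on (insert (v p)) (Pow ?B)"
  proof (rule inj_onI)
    fix I J assume IJ: "I \<in> Pow ?B" "J \<in> Pow ?B" "insert (v p) I = insert (v p) J"
    then have "v p \<notin> I" "v p \<notin> J" using p(2) by blast+
    with IJ(3) show "I = J" by (metis Diff_insert_absorb)
  qed
  have dj: "Pow ?B \<inter> insert (v p) ` Pow ?B = {}" using p(2) by auto
  have "foldr (\<lambda>p. dop (P p) (Q p) (v p)) (p # ps) F =
      ev (P p) (zvar (v p)) * (\<Sum>I\<in>Pow ?B. ?A I * shifts I F)
      - ev (Q p) (zvar (v p)) * (\<Sum>I\<in>Pow ?B. ?A I * shift (v p) (shifts I F))"
    by (simp add: IH dop_def shift.hom_sum shift.hom_mult A1)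
  also have "(\<Sum>I\<in>Pow ?B. ?A I * shift (v p) (shifts I F)) = (\<Sum>I\<in>Pow ?B. ?A I * shifts (insert (v p) I) F)"
    by (rule sum.cong) (simp_all add: shift_shifts[OF out])
  also have "ev (P p) (zvar (v p)) * (\<Sum>I\<in>Pow ?B. ?A I * shifts I F)
      - ev (Q p) (zvar (v p)) * (\<Sum>I\<in>Pow ?B. ?A I * shifts (insert (v p) I) F) =
      (\<Sum>I\<in>Pow ?B. row_coeff (P p) (Q p) (v p) I * ?A I * shifts I F)
      + (\<Sum>I\<in>Pow ?B. row_coeff (P p) (Q p) (v p) (insert (v p) I) * ?A (insert (v p) I) * shifts (insert (v p) I) F)"
  proof -
    have "(\<Sum>I\<in>Pow ?B. row_coeff (P p) (Q p) (v p) I * ?A I * shifts I F) =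
        (\<Sum>I\<in>Pow ?B. ev (P p) (zvar (v p)) * ?A I * shifts I F)"
      by (rule sum.cong) (simp_all add: row_coeff_def out)
    moreover have "(\<Sum>I\<in>Pow ?B. row_coeff (P p) (Q p) (v p) (insert (v p) I) * ?A (insert (v p) I)
        * shifts (insert (v p) I) F) =
        - (\<Sum>I\<in>Pow ?B. ev (Q p) (zvar (v p)) * ?A I * shifts (insert (v p) I) F)"
      unfolding A2 by (simp add: row_coeff_def sum_negf)
    ultimately show ?thesis by (simp add: sum_distrib_left mult.assoc)
  qed
  also have "\<dots> = (\<Sum>I\<in>Pow (v ` set (p # ps)). (\<Prod>p\<in>set (p # ps). row_coeff (P p) (Q p) (v p) I) * shifts I F)"
    unfolding Pow by (subst sum.union_disjoint[OF _ _ dj]) (auto simp: sum.reindex[OF inj] p(1))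
  finally show ?case .
qed simp

definition diff_det :: "nat \<Rightarrow> (nat \<Rightarrow> nat \<Rightarrow> 'a::comm_ring_1 poly) \<Rightarrow> (nat \<Rightarrow> nat \<Rightarrow> 'a poly)
    \<Rightarrow> 'a mpol \<Rightarrow> 'a mpol"
  where "diff_det n P Q F = (\<Sum>\<pi> \<in> {\<pi>. \<pi> permutes {1..n}}. of_int (sign \<pi>) *
    foldr (\<lambda>p. dop (P p (\<pi> p)) (Q p (\<pi> p)) (row_var n p)) [1..<Suc n] F)"

definition shift_coeff :: "nat \<Rightarrow> (nat \<Rightarrow> nat \<Rightarrow> 'a::comm_ring_1 poly) \<Rightarrow> (nat \<Rightarrow> nat \<Rightarrow> 'a poly)
    \<Rightarrow> nat set \<Rightarrow> 'a mpol"
  where "shift_coeff n P Q I = detf n (\<lambda>p q. row_coeff (P p q) (Q p q) (row_var n p) I)"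

lemma diff_det_expand:
  "diff_det n P Q F = (\<Sum>I\<in>Pow {1..n}. shift_coeff n P Q I * shifts I F)"
proof -
  have s: "set [1..<Suc n] = {1..n}" by auto
  have "foldr (\<lambda>p. dop (P p (\<pi> p)) (Q p (\<pi> p)) (row_var n p)) [1..<Suc n] F =
      (\<Sum>I\<in>Pow {1..n}. (\<Prod>p\<in>{1..n}. row_coeff (P p (\<pi> p)) (Q p (\<pi> p)) (row_var n p) I) * shifts I F)"
    for \<pi>
    using foldr_dop[of "[1..<Suc n]" "row_var n" "\<lambda>p. P p (\<pi> p)" "\<lambda>p. Q p (\<pi> p)" F]
    unfolding s row_var_image using row_var_inj[of n] by simp
  then have "diff_det n P Q F = (\<Sum>\<pi> \<in> {\<pi>. \<pi> permutes {1..n}}. \<Sum>I\<in>Pow {1..n}. of_int (sign \<pi>) *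
      (\<Prod>p\<in>{1..n}. row_coeff (P p (\<pi> p)) (Q p (\<pi> p)) (row_var n p) I) * shifts I F)"
    by (simp add: diff_det_def sum_distrib_left mult.assoc)
  also have "\<dots> = (\<Sum>I\<in>Pow {1..n}. shift_coeff n P Q I * shifts I F)"
    unfolding shift_coeff_def detf_def sum_distrib_right by (rule sum.swap)
  finally show ?thesis .
qed

lemma eval_at_shift_coeff:
  "eval_at z (shift_coeff n P Q I) = detf n (\<lambda>p q.
    if row_var n p \<in> I then - poly (Q p q) (z (row_var n p)) else poly (P p q) (z (row_var n p)))"
  unfolding shift_coeff_def detf_hom[OF eval_at_hom]
  by (rule detf_cong) (simp add: row_coeff_def eval_at_ev eval_at.hom_uminus)

lemma diff_det_polys:
  assumes "F \<in> polys n"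
  shows "diff_det n P Q F \<in> polys n"
proof -
  have "foldr (\<lambda>p. dop (P p (\<pi> p)) (Q p (\<pi> p)) (row_var n p)) ps F \<in> polys n"
    if "set ps \<subseteq> {1..n}" for ps \<pi>
    using that
  proof (induction ps)
    case (Cons p ps)
    then have "p \<in> {1..n}" by simp
    note v = row_var_in[OF this]
    show ?case using Cons v unfolding dop_def shift_def
      by (auto intro!: polys_diff polys_mult polys_ev polys_zvar polys_subst[where n = n] polys_1)
  qed (simp add: assms)
  moreover have "(of_int k :: 'a mpol) \<in> polys n" for k
    using polys_const[of "of_int k :: 'a" n] by (simp add: const.hom_of_int)
  moreover have "set [1..<Suc n] \<subseteq> {1..n}" by auto
  ultimately show ?thesis
    unfolding diff_det_def by (intro polys_sum polys_mult) blast+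
qed

text \<open>
  Exchanging two variables of equal parity exchanges two rows of the same block, whose polynomials
  \<open>P\<close> and \<open>Q\<close> are the same; the summand of a set \<open>I\<close> becomes that of the exchanged set.
\<close>

lemma diff_det_antisym:
  assumes PQ: "\<And>p p' q. (p \<le> upper_half n \<longleftrightarrow> p' \<le> upper_half n) \<Longrightarrow> P p q = P p' q \<and> Q p q = Q p' q"
    and ij: "i \<in> {1..n}" "j \<in> {1..n}" "i \<noteq> j" "even (i + j)"
    and F: "swap_vars i j F = F"
  shows "swap_vars i j (diff_det n P Q F) = - diff_det n P Q F"
proof -
  let ?t = "transpose i j"
  let ?s = "subst (\<lambda>k. zvar (?t k))"
  obtain p q where pq: "p \<in> {1..n}" "q \<in> {1..n}" "row_var n p = i" "row_var n q = j"
    using ij(1,2) row_var_image[of n] by (metis imageE)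
  let ?u = "transpose p q"
  have "p \<noteq> q" using pq ij(3) by auto
  have par: "p \<le> upper_half n \<longleftrightarrow> q \<le> upper_half n"
    using row_var_parity[OF pq(1)] row_var_parity[OF pq(2)] pq(3,4) ij(4) by auto
  have C: "?s (shift_coeff n P Q I) = - shift_coeff n P Q (?t ` I)" for I
  proof -
    have "?s (shift_coeff n P Q I) =
        detf n (\<lambda>k l. row_coeff (P (?u k) l) (Q (?u k) l) (row_var n (?u k)) (?t ` I))"
      unfolding shift_coeff_def detf_hom[OF subst_hom]
    proof (rule detf_cong)
      fix k l assume k: "k \<in> {1..n}"
      have v: "row_var n (?u k) = ?t (row_var n k)"
        using inj_on_eq_iff[OF row_var_inj k] pq by (auto simp: transpose_def)
      have "P (?u k) l = P k l" "Q (?u k) l = Q k l"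
        using PQ[of "?u k" k l] par by (auto simp: transpose_def)
      moreover have "?t x \<in> ?t ` I \<longleftrightarrow> x \<in> I" for x by (auto simp: image_iff) (metis transpose_involutory)
      ultimately show "?s (row_coeff (P k l) (Q k l) (row_var n k) I) =
          row_coeff (P (?u k) l) (Q (?u k) l) (row_var n (?u k)) (?t ` I)"
        unfolding v row_coeff_def by (simp add: subst.hom_uminus subst_ev const_hom)
    qed
    also have "\<dots> = - shift_coeff n P Q (?t ` I)"
      unfolding shift_coeff_def
      by (rule detf_swap_rows[OF pq(1,2) \<open>p \<noteq> q\<close>,
            of "\<lambda>k l. row_coeff (P k l) (Q k l) (row_var n k) (?t ` I)"])
    finally show ?thesis .
  qed
  have S: "?s (shifts I F) = shifts (?t ` I) F" for I
  proof -
    have "shifts (?t ` I) F = shifts (?t ` I) (?s F)" by (simp only: F)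
    also have "\<dots> = ?s (shifts I F)"
      unfolding shifts_def subst_subst
    proof (rule arg_cong[of _ _ "\<lambda>s. subst s F"], rule ext)
      fix k
      have "?t k \<in> ?t ` I \<longleftrightarrow> k \<in> I" by (auto simp: image_iff) (metis transpose_involutory)
      then show "subst (\<lambda>i. zvar i - (if i \<in> ?t ` I then 1 else 0)) (zvar (?t k)) =
          ?s (zvar k - (if k \<in> I then 1 else 0))"
        by (simp add: const_hom subst.hom_minus)
    qed
    finally show ?thesis by simp
  qed
  have "?s (diff_det n P Q F) = (\<Sum>I\<in>Pow {1..n}. - (shift_coeff n P Q (?t ` I) * shifts (?t ` I) F))"
    unfolding diff_det_expand by (simp add: subst.hom_sum subst.hom_mult C S)
  also have "\<dots> = (\<Sum>I\<in>Pow {1..n}. - (shift_coeff n P Q I * shifts I F))"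
  proof (rule sum.reindex_bij_witness[where i = "(`) ?t" and j = "(`) ?t"])
    fix I assume "I \<in> Pow {1..n}"
    then show "?t ` I \<in> Pow {1..n}" using ij by (auto simp: transpose_def)
    then show "?t ` I \<in> Pow {1..n}" .
  qed (auto simp: image_image)
  finally show ?thesis by (simp add: diff_det_expand sum_negf)
qed

definition sym_det :: "nat \<Rightarrow> (nat \<Rightarrow> nat \<Rightarrow> 'a::comm_ring_1 mpol \<Rightarrow> 'a mpol) \<Rightarrow> 'a mpol \<Rightarrow> 'a mpol"
  where "sym_det n S G = (\<Sum>\<pi> \<in> {\<pi>. \<pi> permutes {1..n}}. of_int (sign \<pi>) *
    foldr (\<lambda>p. S p (\<pi> p)) [1..<Suc n] G)"

text \<open>
  The entry in row \<open>p\<close> and column \<open>q\<close> raises degrees by \<open>u p - w q\<close>, so all permutations in the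
  determinant raise the degree by the same amount.
\<close>

lemma lead_diff_det:
  assumes S: "\<And>p q d F G. p \<in> {1..n} \<Longrightarrow> q \<in> {1..n} \<Longrightarrow> lead d F G \<Longrightarrow>
      lead (u p - w q + d) (dop (P p q) (Q p q) (row_var n p) F) (S p q G)"
    and "lead d F G"
  shows "lead ((\<Sum>p\<in>{1..n}. u p) - (\<Sum>q\<in>{1..n}. w q) + d) (diff_det n P Q F) (sym_det n S G)"
  unfolding diff_det_def sym_det_def
proof (rule lead_sum)
  fix \<pi> assume "\<pi> \<in> {\<pi>. \<pi> permutes {1..n}}"
  then have \<pi>: "\<pi> permutes {1..n}" by simp
  have "lead (sum_list (map (\<lambda>p. u p - w (\<pi> p)) ps) + d)
      (foldr (\<lambda>p. dop (P p (\<pi> p)) (Q p (\<pi> p)) (row_var n p)) ps F) (foldr (\<lambda>p. S p (\<pi> p)) ps G)"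
    if "set ps \<subseteq> {1..n}" for ps
    using that
  proof (induction ps)
    case (Cons p ps)
    then have "p \<in> {1..n}" "\<pi> p \<in> {1..n}" using permutes_in_image[OF \<pi>] by auto
    from S[OF this Cons.IH] Cons.prems show ?case by (simp add: algebra_simps)
  qed (simp add: assms(2))
  moreover have "set [1..<Suc n] \<subseteq> {1..n}" by auto
  ultimately have "lead (sum_list (map (\<lambda>p. u p - w (\<pi> p)) [1..<Suc n]) + d)
      (foldr (\<lambda>p. dop (P p (\<pi> p)) (Q p (\<pi> p)) (row_var n p)) [1..<Suc n] F)
      (foldr (\<lambda>p. S p (\<pi> p)) [1..<Suc n] G)" by blast
  moreover have "sum_list (map (\<lambda>p. u p - w (\<pi> p)) [1..<Suc n]) = (\<Sum>p\<in>{1..n}. u p - w (\<pi> p))"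
    by (simp add: sum_list_distinct_conv_sum_set atLeastLessThanSuc_atLeastAtMost del: upt_Suc)
  moreover have "(\<Sum>p\<in>{1..n}. w (\<pi> p)) = (\<Sum>q\<in>{1..n}. w q)"
    using sum.permute[OF \<pi>, of w] by (simp add: o_def)
  ultimately have "lead ((\<Sum>p\<in>{1..n}. u p) - (\<Sum>q\<in>{1..n}. w q) + d)
      (foldr (\<lambda>p. dop (P p (\<pi> p)) (Q p (\<pi> p)) (row_var n p)) [1..<Suc n] F)
      (foldr (\<lambda>p. S p (\<pi> p)) [1..<Suc n] G)" by (simp add: sum_subtractf)
  then show "lead ((\<Sum>p\<in>{1..n}. u p) - (\<Sum>q\<in>{1..n}. w q) + d)
      (of_int (sign \<pi>) * foldr (\<lambda>p. dop (P p (\<pi> p)) (Q p (\<pi> p)) (row_var n p)) [1..<Suc n] F)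
      (of_int (sign \<pi>) * foldr (\<lambda>p. S p (\<pi> p)) [1..<Suc n] G)"
    using lead_const_mult[of _ _ _ "of_int (sign \<pi>)"] by (simp add: const.hom_of_int del: upt_Suc)
qed

section \<open>Eigenvectors\<close>

text \<open>
  For \<open>\<mu>\<^sub>n = 0\<close> the last coordinate of the node is zero, and a shift of the last variable must not
  occur there. The factor \<open>z\<close> that excludes it belongs to the rows of the parity of \<open>n\<close>: to
  the even rows if \<open>n\<close> is even (\<open>kap\<close>) and to the odd rows otherwise (\<open>kap'\<close>).
\<close>

definition kap :: "nat \<Rightarrow> 'a::comm_ring_1 poly"
  where "kap n = (if even n then [:0, 1:] else 1)"

definition kap' :: "nat \<Rightarrow> 'a::comm_ring_1 poly"
  where "kap' n = (if even n then 1 else [:0, 1:])"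

lemma Lam_antimono:
  assumes "\<mu> \<in> Lam n" "1 \<le> i" "i \<le> j" "j \<le> n"
  shows "\<mu> j \<le> \<mu> i"
  using assms(3,4)
proof (induction j rule: dec_induct)
  case (step k)
  then have "\<mu> (Suc k) \<le> \<mu> k" using assms(1,2) by (simp add: Lam_def)
  with step show ?case by simp
qed simp

text \<open>
  A row vector is of one of two types, given by the polynomials \<open>K1 q\<close> or \<open>K2 q\<close> in column \<open>q\<close>. Without
  shift, odd rows are multiples of type 1 and even rows multiples of type 2; with shift, the types are
  interchanged. The arguments of \<open>K1\<close> and \<open>K2\<close> are displaced by \<open>r\<close> such that a shifted row and the
  following unshifted row become proportional when their variables differ by \<open>r\<close>. By
  \<open>rank\<close>, the rows of type 1 span a space of dimension at most \<open>upper_half n\<close>; by \<open>unit\<close>, the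
  unshifted rows give the Vandermonde product up to the factors \<open>al\<close> and \<open>de\<close>, which will be \<open>z + t\<close>
  for the rows that contribute to the eigenvalue and \<open>1\<close> for the others.
\<close>

locale semisym_op =
  fixes n :: nat and r :: "'a::{idom,ring_char_0}"
    and K1 K2 :: "nat \<Rightarrow> 'a poly" and al de :: "'a poly"
  assumes rank: "\<And>J \<xi> c M. J \<subseteq> {1..n} \<Longrightarrow> upper_half n < card J \<Longrightarrow>
      (\<And>p q. p \<in> J \<Longrightarrow> q \<in> {1..n} \<Longrightarrow> M p q = c p * poly (K1 q) (\<xi> p)) \<Longrightarrow> detf n M = 0"
    and unit: "\<And>x. detf n (\<lambda>p q. if p \<le> upper_half n then poly (K1 q) (x (row_var n p))
      else poly (K2 q) (x (row_var n p) + r)) = vdm n x"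
begin

definition P where "P p q = (if p \<le> upper_half n then al * K1 q else de * pcompose (K2 q) [:r, 1:])"
definition Q where "Q p q = (if p \<le> upper_half n then kap' n * K2 q else kap n * pcompose (K1 q) [:- r, 1:])"

definition node where "node \<mu> = (\<lambda>i. rho n r i + of_nat (\<mu> i))"
definition eigenvalue where
  "eigenvalue \<mu> = (\<Prod>i\<in>{1..n}. poly (if odd i then al else de) (node \<mu> i))"

lemma eval_shift_coeff:
  "eval_at z (shift_coeff n P Q I) = detf n (\<lambda>p q.
    if row_var n p \<in> I
    then if p \<le> upper_half n then - (poly (kap' n) (z (row_var n p))) * poly (K2 q) (z (row_var n p))
      else - (poly (kap n) (z (row_var n p))) * poly (K1 q) (z (row_var n p) - r)
    else if p \<le> upper_half n then poly al (z (row_var n p)) * poly (K1 q) (z (row_var n p))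
      else poly de (z (row_var n p)) * poly (K2 q) (z (row_var n p) + r))"
  unfolding eval_at_shift_coeff
  by (rule detf_cong) (simp add: P_def Q_def poly_pcompose algebra_simps)

lemma shift_coeff_last:
  assumes "n \<in> I" "1 \<le> n" "\<mu> n = 0"
  shows "eval_at (node \<mu>) (shift_coeff n P Q I) = 0"
proof -
  have "n \<in> row_var n ` {1..n}" unfolding row_var_image using assms(2) by simp
  then obtain p where p: "p \<in> {1..n}" "row_var n p = n" by auto
  have "p \<le> upper_half n \<longleftrightarrow> odd n" using row_var_parity[OF p(1)] p(2) by simp
  moreover have "node \<mu> n = 0" using assms(3) by (simp add: node_def rho_def)
  ultimately show ?thesis
    unfolding eval_shift_coeff using assms(1)
    by (intro detf_zero_row[OF p(1)]) (simp add: p(2) kap_def kap'_def)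
qed

text \<open>
  The coordinates \<open>i\<close> and \<open>i + 1\<close> of the node differ by \<open>r\<close>. Then the row of the shifted variable
  \<open>i\<close> and the row of the unshifted variable \<open>i + 1\<close> are of the same type at the same argument.
\<close>

lemma shift_coeff_step:
  assumes i: "i \<in> I" "Suc i \<notin> I" "1 \<le> i" "i < n" and eq: "\<mu> (Suc i) = \<mu> i"
  shows "eval_at (node \<mu>) (shift_coeff n P Q I) = 0"
proof -
  have "i \<in> row_var n ` {1..n}" "Suc i \<in> row_var n ` {1..n}"
    unfolding row_var_image using i by auto
  then obtain p p' where p: "p \<in> {1..n}" "row_var n p = i" "p' \<in> {1..n}" "row_var n p' = Suc i"
    by auto
  have "p \<noteq> p'" using p by auto
  have par: "p \<le> upper_half n \<longleftrightarrow> odd i" "p' \<le> upper_half n \<longleftrightarrow> even i"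
    using row_var_parity[OF p(1)] row_var_parity[OF p(3)] p(2,4) by auto
  have nd: "node \<mu> (Suc i) = node \<mu> i - r"
  proof -
    have "n - i = Suc (n - Suc i)" using i(4) by simp
    then have "(of_nat (n - i) :: 'a) = 1 + of_nat (n - Suc i)" by simp
    then show ?thesis using eq by (simp add: node_def rho_def algebra_simps)
  qed
  show ?thesis
  proof (cases "odd i")
    case True
    show ?thesis
      unfolding eval_shift_coeff
      by (rule detf_proportional_rows[OF p(1,3) \<open>p \<noteq> p'\<close>, where w = "\<lambda>q. poly (K2 q) (node \<mu> i)"
            and \<alpha> = "- poly (kap' n) (node \<mu> i)" and \<beta> = "poly de (node \<mu> i - r)"])
        (use i True par in \<open>simp_all add: p nd\<close>)
  next
    case False
    show ?thesis
      unfolding eval_shift_coeff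
      by (rule detf_proportional_rows[OF p(1,3) \<open>p \<noteq> p'\<close>, where w = "\<lambda>q. poly (K1 q) (node \<mu> i - r)"
            and \<alpha> = "- poly (kap n) (node \<mu> i)" and \<beta> = "poly al (node \<mu> i - r)"])
        (use i False par in \<open>simp_all add: p nd\<close>)
  qed
qed

text \<open>
  The unshifted odd rows and the shifted even rows are all of type 1, and as \<open>I\<close> is not empty, there are more
  than \<open>upper_half n\<close> of them.
\<close>

lemma shift_coeff_even:
  assumes I: "I \<subseteq> {1..n}" "I \<noteq> {}" "\<And>i. i \<in> I \<Longrightarrow> even i"
  shows "eval_at z (shift_coeff n P Q I) = 0"
proof -
  let ?v = "row_var n"
  define J where "J = {1..upper_half n} \<union> {p \<in> {1..n}. ?v p \<in> I}"
  have un: "upper_half n \<le> n" using halves[of n] by simp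
  obtain i where "i \<in> I" using I(2) by blast
  with I(1) have "i \<in> ?v ` {1..n}" unfolding row_var_image by blast
  then obtain p where p: "p \<in> {1..n}" "?v p = i" by auto
  have lo: "\<not> k \<le> upper_half n" if "k \<in> {1..n}" "?v k \<in> I" for k
    using row_var_parity[OF that(1)] I(3)[OF that(2)] by simp
  have lo': "row_var n k \<notin> I" if "Suc 0 \<le> k" "k \<le> upper_half n" for k
    using lo[of k] that un by auto
  have "insert p {1..upper_half n} \<subseteq> J" using p \<open>i \<in> I\<close> by (auto simp: J_def)
  then have "card (insert p {1..upper_half n}) \<le> card J"
    by (intro card_mono) (auto simp: J_def)
  moreover have "p \<notin> {1..upper_half n}" using lo p \<open>i \<in> I\<close> by auto
  ultimately have "upper_half n < card J" by simp
  moreover have "J \<subseteq> {1..n}" using un by (auto simp: J_def)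
  ultimately show ?thesis
    unfolding eval_shift_coeff
    apply (intro rank[where J = J and c = "\<lambda>p. if p \<le> upper_half n then poly al (z (?v p)) else - poly (kap n) (z (?v p))"
          and \<xi> = "\<lambda>p. if p \<le> upper_half n then z (?v p) else z (?v p) - r"])
      apply assumption+
    using lo lo' un by (auto simp: J_def)
qed

lemma shift_coeff_empty:
  "eval_at (node \<mu>) (shift_coeff n P Q {}) = eigenvalue \<mu> * vdm n (node \<mu>)"
proof -
  let ?v = "row_var n" and ?z = "node \<mu>"
  have "eval_at ?z (shift_coeff n P Q {}) = detf n (\<lambda>p q.
      poly (if p \<le> upper_half n then al else de) (?z (?v p)) * (if p \<le> upper_half n
        then poly (K1 q) (?z (?v p)) else poly (K2 q) (?z (?v p) + r)))"
    unfolding eval_shift_coeff by (rule detf_cong) simp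
  also have "\<dots> = (\<Prod>p\<in>{1..n}. poly (if p \<le> upper_half n then al else de) (?z (?v p))) * vdm n ?z"
    unfolding detf_scale_rows unit ..
  also have "(\<Prod>p\<in>{1..n}. poly (if p \<le> upper_half n then al else de) (?z (?v p))) = eigenvalue \<mu>"
  proof -
    have "(\<Prod>p\<in>{1..n}. poly (if p \<le> upper_half n then al else de) (?z (?v p))) =
        (\<Prod>p\<in>{1..n}. poly (if odd (?v p) then al else de) (?z (?v p)))"
      by (rule prod.cong) (simp_all add: row_var_parity)
    also have "\<dots> = eigenvalue \<mu>"
      unfolding eigenvalue_def
      by (rule prod.reindex_bij_betw[OF row_var_bij, of "\<lambda>i. poly (if odd i then al else de) (?z i)"])
    finally show ?thesis .
  qed
  finally show ?thesis .
qed

text \<open>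
  By \<open>shift_coeff_last\<close> and \<open>shift_coeff_step\<close>, lowering \<open>\<mu>\<close> by one on \<open>I\<close> leaves it decreasing and
  nonnegative; by \<open>shift_coeff_even\<close>, it lowers an odd part.
\<close>

lemma shift_coeff_nonzero:
  assumes \<mu>: "\<mu> \<in> Lam n" and I: "I \<subseteq> {1..n}" "I \<noteq> {}"
    and nz: "eval_at (node \<mu>) (shift_coeff n P Q I) \<noteq> 0"
  obtains \<nu> where "\<nu> \<in> Lam n" "odd_size n \<nu> < odd_size n \<mu>"
    "\<And>i. node \<mu> i - (if i \<in> I then 1 else 0) = node \<nu> i"
proof -
  have mono: "\<mu> (Suc i) \<le> \<mu> i" if "1 \<le> i" "i < n" for i using \<mu> that by (simp add: Lam_def)
  have step: "\<mu> (Suc i) < \<mu> i" if "i \<in> I" "Suc i \<notin> I" "1 \<le> i" "i < n" for i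
    using shift_coeff_step[OF that, of \<mu>] nz mono[OF that(3,4)] by force
  have pos: "1 \<le> \<mu> i" if "i \<in> I" for i
  proof -
    from I(1) that have "i \<in> {1..n}" by blast
    then have "1 \<le> i" "i \<le> n" by auto
    from this(2,1) that show ?thesis
    proof (induction i rule: inc_induct)
      case base
      then show ?case using shift_coeff_last[of I \<mu>] nz by force
    next
      case (step k)
      show ?case
      proof (cases "Suc k \<in> I")
        case True
        then show ?thesis using step.IH mono[of k] step by force
      next
        case False
        then show ?thesis using \<open>\<And>i. i \<in> I \<Longrightarrow> Suc i \<notin> I \<Longrightarrow> 1 \<le> i \<Longrightarrow> i < n \<Longrightarrow> \<mu> (Suc i) < \<mu> i\<close>[of k] step by force
      qed
    qed
  qed
  define \<nu> where "\<nu> i = \<mu> i - (if i \<in> I then 1 else 0)" for i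
  have "\<nu> \<in> Lam n"
    unfolding Lam_def
  proof (intro CollectI conjI ballI allI impI)
    fix i assume "i \<in> {1..<n}"
    then have i: "1 \<le> i" "i < n" by auto
    show "\<nu> (Suc i) \<le> \<nu> i"
      using mono[OF i] step[OF _ _ i] by (auto simp: \<nu>_def)
  next
    fix i assume "i \<notin> {1..n}"
    then show "\<nu> i = 0" using \<mu> by (simp add: Lam_def \<nu>_def)
  qed
  moreover have "odd_size n \<nu> < odd_size n \<mu>"
  proof -
    obtain i where i: "i \<in> I" "odd i" using shift_coeff_even[OF I, of "node \<mu>"] nz by blast
    show ?thesis
      unfolding odd_size_def
    proof (rule sum_strict_mono_ex1)
      show "\<exists>i\<in>{i \<in> {1..n}. odd i}. \<nu> i < \<mu> i"
        using i I(1) pos[OF i(1)] by (intro bexI[of _ i]) (auto simp: \<nu>_def)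
    qed (auto simp: \<nu>_def)
  qed
  moreover have "node \<mu> i - (if i \<in> I then 1 else 0) = node \<nu> i" for i
    using pos[of i] by (auto simp: node_def \<nu>_def of_nat_diff)
  ultimately show ?thesis by (rule that)
qed

text \<open>
  All summands with \<open>I \<noteq> \<emptyset>\<close> vanish at the nodes, as \<open>\<nu>\<close> in \<open>shift_coeff_nonzero\<close> has smaller odd
  size than \<open>l\<close>; what remains is the Vandermonde product times the eigenvalue.
\<close>

theorem eigenvector:
  assumes r: "\<And>j m. 1 \<le> j \<or> 1 \<le> m \<Longrightarrow> of_nat j * r + of_nat m \<noteq> 0"
    and deg: "\<And>d F G. lead d F G \<Longrightarrow> deg_in {..int (card (parity_pairs n)) + d} (diff_det n P Q F)"
    and l: "l \<in> Lam n" and F: "semisym n F" "deg_in {..int (odd_size n l)} F"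
    and zero: "\<And>\<mu>. \<mu> \<in> Lam n \<Longrightarrow> odd_size n \<mu> \<le> odd_size n l \<Longrightarrow> \<mu> \<noteq> l \<Longrightarrow> eval_at (node \<mu>) F = 0"
  shows "diff_det n P Q F = vdm n zvar * (const (eigenvalue l) * F)"
proof -
  let ?D = "diff_det n P Q F" and ?d = "int (odd_size n l)"
  have anti: "swap_vars i j ?D = - ?D"
    if "i \<in> {1..n}" "j \<in> {1..n}" "i \<noteq> j" "even (i + j)" for i j
    by (rule diff_det_antisym[OF _ that semisymD[OF F(1) that(1,2,4)]]) (auto simp: P_def Q_def)
  obtain g where g: "?D = vdm n zvar * g" using vdm_dvd[OF anti] by (auto simp: dvd_def)
  have gp: "g \<in> polys n"
    by (rule polys_cofactor[OF vdm_zvar_polys _ vdm_zvar_nonzero])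
      (use diff_det_polys[OF semisym_polys[OF F(1)], of P Q] g in simp)
  have g_sym: "semisym n g"
    unfolding semisym_def
  proof (intro conjI gp ballI impI)
    fix i j assume ij: "i \<in> {1..n}" "j \<in> {1..n}" "even (i + j)"
    let ?s = "swap_vars i j"
    show "?s g = g"
    proof (cases "i = j")
      case False
      have "?s (vdm n zvar) = - (vdm n zvar :: 'a mpol)"
        unfolding vdm_hom[OF subst_hom]
        using vdm_antisym[OF ij(1,2) False ij(3), of "zvar :: nat \<Rightarrow> 'a mpol"] by (simp add: const_hom)
      then have "vdm n zvar * ?s g = vdm n zvar * g"
        using anti[OF ij(1,2) False ij(3)] unfolding g subst.hom_mult by simp
      then show ?thesis using vdm_zvar_nonzero[of n, where 'a = 'a] by simp
    qed simp
  qed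
  have g_deg: "deg_in {..?d} g"
    by (rule deg_in_cofactor[OF lead_vdm vdm_zvar_nonzero])
      (use deg[OF lead_hom_component[OF F(2)]] in \<open>simp only: g\<close>)
  have "g - const (eigenvalue l) * F = 0"
  proof (rule semisym_eq_0[where c = 0 and d = "odd_size n l" and n = n and r = r])
    show "semisym n (g - const (eigenvalue l) * F)"
      by (intro semisym_diff semisym_const_mult g_sym F(1))
    show "deg_in {..?d} (g - const (eigenvalue l) * F)"
      by (intro deg_in_diff deg_in_const_mult g_deg F(2))
    fix \<mu> assume \<mu>: "\<mu> \<in> Lam n" "odd_size n \<mu> \<le> odd_size n l"
    let ?e = "eval_at (node \<mu>)"
    have "?e (shift_coeff n P Q I * shifts I F) = 0" if "I \<in> Pow {1..n} - {{}}" for I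
    proof (cases "?e (shift_coeff n P Q I) = 0")
      case False
      have I: "I \<subseteq> {1..n}" "I \<noteq> {}" using that by auto
      obtain \<nu> where \<nu>: "\<nu> \<in> Lam n" "odd_size n \<nu> < odd_size n \<mu>"
          "\<And>i. node \<mu> i - (if i \<in> I then 1 else 0) = node \<nu> i"
        using shift_coeff_nonzero[OF \<mu>(1) I False] by metis
      have "eval_at (node \<nu>) F = 0" using \<nu>(1,2) \<mu>(2) by (intro zero) auto
      then show ?thesis by (simp add: eval_at.hom_mult eval_at_shifts \<nu>(3))
    qed (simp add: eval_at.hom_mult)
    then have "(\<Sum>I\<in>Pow {1..n} - {{}}. ?e (shift_coeff n P Q I * shifts I F)) = 0" by (intro sum.neutral) blast
    then have "?e ?D = ?e (shift_coeff n P Q {} * shifts {} F)"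
      unfolding diff_det_expand eval_at.hom_sum by (subst sum.remove[of _ "{}"]) auto
    then have "vdm n (node \<mu>) * ?e g = vdm n (node \<mu>) * (eigenvalue \<mu> * ?e F)"
      by (simp add: g eval_at.hom_mult shift_coeff_empty vdm_hom[OF eval_at_hom] mult_ac)
    moreover have "vdm n (node \<mu>) \<noteq> 0"
      unfolding vdm_def prod_zero_iff[OF finite_parity_pairs]
    proof safe
      fix i j assume "(i, j) \<in> parity_pairs n" and 0: "node \<mu> i - node \<mu> j = 0"
      then have ij: "1 \<le> i" "i < j" "j \<le> n" by (auto simp: parity_pairs_def)
      have le: "\<mu> j \<le> \<mu> i" using Lam_antimono[OF \<mu>(1) ij(1) _ ij(3)] ij(2) by simp
      have "n - i = (n - j) + (j - i)" using ij by simp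
      then have "(of_nat (n - i) :: 'a) = of_nat (n - j) + of_nat (j - i)" by (metis of_nat_add)
      then have "node \<mu> i - node \<mu> j = of_nat (j - i) * r + of_nat (\<mu> i - \<mu> j)"
        using le by (simp add: node_def rho_def of_nat_diff algebra_simps)
      moreover have "of_nat (j - i) * r + of_nat (\<mu> i - \<mu> j) \<noteq> 0"
        by (rule r, rule disjI1) (use ij in linarith)
      ultimately show False using 0 by metis
    qed
    ultimately have "?e g = eigenvalue \<mu> * ?e F" by simp
    then have "?e (g - const (eigenvalue l) * F) = 0"
      using zero[OF \<mu>] by (cases "\<mu> = l") (auto simp: eval_at.hom_minus eval_at.hom_mult)
    then show "eval_at (\<lambda>i. 0 + rho n r i + of_nat (\<mu> i)) (g - const (eigenvalue l) * F) = 0"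
      by (simp add: node_def)
  qed (use r in auto)
  then show ?thesis by (simp add: g)
qed

end

section \<open>Two leading coefficients\<close>

text \<open>
  A monic polynomial of degree \<open>k\<close> with next coefficient \<open>c\<close>. For \<open>k = 0\<close> the absent next coefficient
  counts as zero, which keeps the rules for products uniform.
\<close>

definition monic_top :: "'a::comm_ring_1 poly \<Rightarrow> nat \<Rightarrow> 'a \<Rightarrow> bool"
  where "monic_top p k c \<longleftrightarrow> degree p \<le> k \<and> coeff p k = 1 \<and>
    (case k of 0 \<Rightarrow> c = 0 | Suc k' \<Rightarrow> coeff p k' = c)"

lemma monic_top_monom: "monic_top (monom 1 k) k 0"
  by (auto simp: monic_top_def degree_monom_le split: nat.split)

lemma monic_top_mult_linear:
  assumes "monic_top p k c"
  shows "monic_top ([:d, 1:] * p) (Suc k) (c + d)"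
proof -
  have "degree ([:d, 1:] * p) \<le> degree [:d, 1:] + degree p" by (rule degree_mult_le)
  also have "\<dots> \<le> Suc k" using assms by (simp add: monic_top_def)
  finally have "degree ([:d, 1:] * p) \<le> Suc k" .
  moreover have "coeff p (Suc k) = 0" using assms by (intro coeff_eq_0) (simp add: monic_top_def)
  ultimately show ?thesis using assms
    by (cases k) (auto simp: monic_top_def mult_pCons_left coeff_pCons split: nat.splits)
qed

lemma monic_top_linear_power: "monic_top ([:- r, 1:] ^ k) k (- (of_nat k * r))"
proof (induction k)
  case 0
  show ?case by (simp add: monic_top_def)
next
  case (Suc k)
  from monic_top_mult_linear[OF this, of "- r"] show ?case by (simp add: algebra_simps)
qed

lemma monic_top_degree: "monic_top p k c \<Longrightarrow> degree p \<le> k" and monic_top_coeff: "monic_top p k c \<Longrightarrow> coeff p k = 1"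
  by (simp_all add: monic_top_def)

text \<open>
  The zeroth order term of the leading part is the difference of the second coefficients; this is
  where the multiples of \<open>r\<close> in the differential operators come from.
\<close>

lemma lead_dop_monic_top:
  assumes P: "monic_top P e c" and Q: "monic_top Q e c'" and F: "lead d F G" and u: "u = int e - 1 + d" and k: "k = c - c'"
  shows "lead u (dop P Q v F) (sym_op k (e - 1) 1 e v G)"
proof -
  have deg: "degree (P - Q) \<le> e - 1"
  proof (rule degree_le, intro allI impI)
    fix i assume "e - 1 < i"
    then consider "i = e" | "e < i" by linarith
    then show "coeff (P - Q) i = 0"
      by cases (use P Q in \<open>auto simp: monic_top_def coeff_eq_0\<close>)
  qed
  have eq: "P = Q" if "e = 0"
    using P Q that by (auto simp: monic_top_def elim!: degree_eq_zeroE)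
  have "coeff (P - Q) (e - 1) = c - c'"
    using P Q by (cases e) (auto simp: monic_top_def)
  then show ?thesis
    using lead_dop_order_1[OF monic_top_degree[OF Q] deg eq F] monic_top_coeff[OF Q] by (simp add: u k)
qed

lemma lead_dop_P:
  assumes P: "degree P \<le> e" "coeff P e = 1" and F: "lead d F G" and u: "u = int e + d"
  shows "lead u (dop P 0 v F) (sym_op 1 e 0 0 v G)"
  using lead_dop_order_0[of P e 0 d F G v 0] assms by simp

lemma lead_dop_Q:
  assumes Q: "degree Q \<le> e" "coeff Q e = 1" and F: "lead d F G" and u: "u = int e + d"
  shows "lead u (dop 0 Q v F) (sym_op (- 1) e 0 0 v G)"
  using lead_dop_order_0[of 0 e Q d F G v 0] assms by simp

lemma kap_mult: "kap' n * kap n = ([:0, 1:] :: 'a::comm_ring_1 poly)"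
  by (simp add: kap_def kap'_def)

lemma pcompose_linear: "pcompose [:c, 1:] [:d, 1:] = [:c + d, 1:]" for c d :: "'a::comm_ring_1"
  by (simp add: pcompose_pCons add.commute)

lemma pcompose_one: "pcompose 1 q = 1" for q :: "'a::comm_ring_1 poly"
  by (metis one_pCons pcompose_const)

lemma pcompose_power: "pcompose (p ^ k) q = pcompose p q ^ k" for p q :: "'a::comm_ring_1 poly"
  by (induction k) (simp_all add: pcompose_mult pcompose_one)

lemma pcompose_monom_1: "pcompose (monom 1 k) q = q ^ k" for q :: "'a::comm_ring_1 poly"
proof -
  have "monom 1 k = ([:0, 1:] :: 'a poly) ^ k" by (simp add: monom_altdef)
  then show ?thesis by (simp add: pcompose_power pcompose_pCons)
qed

lemma linear_0_power: "[:0, 1:] ^ k = (monom 1 k :: 'a::comm_ring_1 poly)"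
  by (simp add: monom_altdef)

lemma sum_upto_add: "(\<Sum>p\<in>{1..a + b}. f p) = (\<Sum>p\<in>{1..a}. f p) + (\<Sum>p\<in>{1..b}. f (a + p))"
  for f :: "nat \<Rightarrow> 'b::comm_monoid_add"
proof (induction b)
  case (Suc b)
  then show ?case by (simp add: add.assoc)
qed simp

lemma upper_half_parity:
  "even n \<Longrightarrow> upper_half n = lower_half n" "odd n \<Longrightarrow> upper_half n = Suc (lower_half n)"
  by (auto simp: upper_half_def lower_half_def elim!: evenE oddE)

lemma upper_half_double: "n \<le> upper_half n + upper_half n"
  by (simp add: upper_half_def)

text \<open>
  The determinant raises degrees by exactly the degree of the Vandermonde product. The offset \<open>k\<close>,
  which is 0 for \<open>X\<close> and 1 for \<open>Y\<close>, occurs in as many rows as columns and cancels.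
\<close>

lemma degree_sum:
  fixes u :: "nat \<Rightarrow> int"
  assumes u: "\<And>p. p \<in> {1..n} \<Longrightarrow> u p = (if p \<le> upper_half n then int (upper_half n) else int (lower_half n) + k)"
    and w: "\<And>q. q \<in> {1..n} \<Longrightarrow> w q = (if q \<le> upper_half n then int q else int (q - upper_half n) + k)"
  shows "(\<Sum>p\<in>{1..n}. u p) - (\<Sum>q\<in>{1..n}. w q) = int (card (parity_pairs n))"
proof -
  define a b where "a = upper_half n" and "b = lower_half n"
  have n: "n = a + b" using halves[of n] by (simp add: a_def b_def)
  have le: "a \<le> n" "\<And>p. p \<le> b \<Longrightarrow> a + p \<le> n" using n by simp_all
  have "(\<Sum>p\<in>{1..n}. u p) - (\<Sum>q\<in>{1..n}. w q) = (\<Sum>p\<in>{1..n}. u p - w p)"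
    by (simp add: sum_subtractf)
  also have "\<dots> = (\<Sum>p\<in>{1..a}. u p - w p) + (\<Sum>p\<in>{1..b}. u (a + p) - w (a + p))"
    unfolding n by (rule sum_upto_add)
  also have "(\<Sum>p\<in>{1..a}. u p - w p) = (\<Sum>p\<in>{1..a}. int (a - p))"
    by (rule sum.cong) (use le in \<open>auto simp: u w a_def[symmetric] of_nat_diff\<close>)
  also have "(\<Sum>p\<in>{1..b}. u (a + p) - w (a + p)) = (\<Sum>p\<in>{1..b}. int (b - p))"
    by (rule sum.cong) (use le in \<open>auto simp: u w a_def[symmetric] b_def[symmetric] of_nat_diff\<close>)
  finally show ?thesis by (simp add: card_parity_pairs a_def b_def)
qed

lemma top_component_eigen:
  fixes F :: "'a::{idom,ring_char_0} mpol"
  assumes op: "semisym_op n r K1 K2"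
    and S: "\<And>p q d F G. p \<in> {1..n} \<Longrightarrow> q \<in> {1..n} \<Longrightarrow> lead d F G \<Longrightarrow>
      lead (u p - w q + d)
        (dop (semisym_op.P n r K1 K2 al de p q) (semisym_op.Q n r K1 K2 p q) (row_var n p) F) (S p q G)"
    and D: "(\<Sum>p\<in>{1..n}. u p) - (\<Sum>q\<in>{1..n}. w q) = int (card (parity_pairs n))"
    and r: "\<And>j m. 1 \<le> j \<or> 1 \<le> m \<Longrightarrow> of_nat j * r + of_nat m \<noteq> 0"
    and l: "l \<in> Lam n" and F: "semisym n F" "deg_in {..int (odd_size n l)} F"
    and zero: "\<And>\<mu>. \<mu> \<in> Lam n \<Longrightarrow> odd_size n \<mu> \<le> odd_size n l \<Longrightarrow> \<mu> \<noteq> l \<Longrightarrow>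
      eval_at (\<lambda>i. rho n r i + of_nat (\<mu> i)) F = 0"
  shows "sym_det n S (hom_component (odd_size n l) F) =
    vdm n zvar * (const (\<Prod>i\<in>{1..n}. poly (if odd i then al else de) (rho n r i + of_nat (l i)))
      * hom_component (odd_size n l) F)"
proof -
  interpret semisym_op n r K1 K2 al de by (rule op)
  let ?d = "odd_size n l"
  have lead: "lead (int (card (parity_pairs n)) + d) (diff_det n P Q F) (sym_det n S G)"
    if "lead d F G" for d F G
    using lead_diff_det[of n u w P Q S, OF S that] by (simp only: D)
  have "diff_det n P Q F = vdm n zvar * (const (eigenvalue l) * F)"
    by (rule eigenvector[OF r lead_le[OF lead] l F])
      (use zero in \<open>auto simp: node_def\<close>)
  moreover have "lead (int (card (parity_pairs n)) + int ?d) (vdm n zvar * (const (eigenvalue l) * F))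
      (vdm n zvar * (const (eigenvalue l) * hom_component ?d F))"
    by (intro lead_mult lead_vdm lead_const_mult lead_hom_component F(2))
  ultimately show ?thesis
    using lead_unique[OF lead[OF lead_hom_component[OF F(2)]]]
    by (simp add: eigenvalue_def node_def)
qed

section \<open>The operator X\<close>

text \<open>
  The entries of \<open>X_mat\<close> at a value of \<open>t\<close>, over any ring, because they are needed over \<open>k[\<epsilon>]\<close> and
  over \<open>k\<close>.
\<close>

definition xsym :: "nat \<Rightarrow> 'a::comm_ring_1 \<Rightarrow> 'a \<Rightarrow> nat \<Rightarrow> nat \<Rightarrow> 'a mpol \<Rightarrow> 'a mpol"
  where "xsym n r t p q = (let a = upper_half n; b = lower_half n; v = row_var n p in
    if p \<le> a
    then if q \<le> a then sym_op (of_nat (a - q) * r + t) (a - q) 1 (a - q + 1) v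
      else sym_op (- 1) (a - (q - a)) 0 0 v
    else if q \<le> a then sym_op (of_nat (b + 1 - q) * r) (b + 1 - q - 1) 1 (b + 1 - q) v
      else sym_op 1 (b - (q - a)) 0 0 v)"

text \<open>
  Let \<open>a = upper_half n\<close>. In the first block the unshifted odd rows are \<open>(z + t) z\<^sup>a\<^sup>-\<^sup>q\<close>. Since
  \<open>kap' n * kap n\<close> is \<open>z\<close>, the shifted ones are \<open>z (z - r)\<^sup>a\<^sup>-\<^sup>q\<close>: the leading terms agree, and the
  next coefficients differ by \<open>(a - q) r + t\<close>, as the operator \<open>X(t)\<close> requires.
\<close>

definition X_K1 :: "nat \<Rightarrow> nat \<Rightarrow> 'a::comm_ring_1 poly"
  where "X_K1 n q = (if q \<le> upper_half n then monom 1 (upper_half n - q) else 0)"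

definition X_K2 :: "nat \<Rightarrow> 'a::comm_ring_1 \<Rightarrow> nat \<Rightarrow> 'a poly"
  where "X_K2 n r q = (if q \<le> upper_half n then kap n * [:- r, 1:] ^ (upper_half n - q)
    else [:- r, 1:] ^ (lower_half n - (q - upper_half n)))"

lemma X_semisym_op: "semisym_op n r (X_K1 n) (X_K2 n r)"
  for r :: "'a::{idom,ring_char_0}"
proof
  fix J \<xi> c and M :: "nat \<Rightarrow> nat \<Rightarrow> 'a"
  assume J: "J \<subseteq> {1..n}" "upper_half n < card J"
    and M: "\<And>p q. p \<in> J \<Longrightarrow> q \<in> {1..n} \<Longrightarrow> M p q = c p * poly (X_K1 n q) (\<xi> p)"
  show "detf n M = 0"
    by (rule detf_pigeonhole[OF J]) (simp add: M X_K1_def)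
next
  fix x :: "nat \<Rightarrow> 'a"
  show "detf n (\<lambda>p q. if p \<le> upper_half n then poly (X_K1 n q) (x (row_var n p))
      else poly (X_K2 n r q) (x (row_var n p) + r)) = vdm n x"
    by (rule vdm_block[OF refl refl, where P = "\<lambda>j. monom 1 (upper_half n - j)"
          and Q = "\<lambda>j. monom 1 (lower_half n - j)"])
      (auto simp: X_K1_def X_K2_def degree_monom_le poly_monom)
qed

lemma X_symbol:
  fixes r t :: "'a::{idom,ring_char_0}"
  assumes pq: "p \<in> {1..n}" "q \<in> {1..n}" and F: "lead d F G"
  shows "lead ((if p \<le> upper_half n then int (upper_half n) else int (lower_half n) + 0)
      - (if q \<le> upper_half n then int q else int (q - upper_half n) + 0) + d)
    (dop (semisym_op.P n r (X_K1 n) (X_K2 n r) [:t, 1:] 1 p q) (semisym_op.Q n r (X_K1 n) (X_K2 n r) p q) (row_var n p) F)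
    (xsym n r t p q G)"
proof -
  interpret semisym_op n r "X_K1 n" "X_K2 n r" "[:t, 1:]" 1 by (rule X_semisym_op)
  define a b where "a = upper_half n" and "b = lower_half n"
  have n: "n = a + b" using halves[of n] by (simp add: a_def b_def)
  note ab = a_def[symmetric] b_def[symmetric]
  consider "p \<le> a" "q \<le> a" | "p \<le> a" "\<not> q \<le> a" | "\<not> p \<le> a" "q \<le> a" | "\<not> p \<le> a" "\<not> q \<le> a" by blast
  then show ?thesis
  proof cases
    case 1
    have "Q p q = [:0, 1:] * [:- r, 1:] ^ (a - q)"
      using 1 kap_mult[of n, where 'a = 'a] by (simp add: Q_def X_K2_def ab mult.assoc[symmetric])
    moreover have "P p q = [:t, 1:] * monom 1 (a - q)"
      using 1 by (simp add: P_def X_K1_def ab)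
    moreover have "xsym n r t p q =
        sym_op (of_nat (a - q) * r + t) (Suc (a - q) - 1) 1 (Suc (a - q)) (row_var n p)"
      using 1 by (simp add: xsym_def ab Let_def)
    ultimately show ?thesis
      by (simp only:, intro lead_dop_monic_top[OF monic_top_mult_linear[OF monic_top_monom]
            monic_top_mult_linear[OF monic_top_linear_power] F])
        (use 1 in \<open>simp_all add: ab of_nat_diff\<close>)
  next
    case 2
    have "monic_top (Q p q) (a - (q - a)) (if odd n then 0 - of_nat (b - (q - a)) * r else - (of_nat (b - (q - a)) * r))"
    proof (cases "even n")
      case True
      then have "a = b" using upper_half_parity[of n] by (simp add: ab)
      then show ?thesis using True 2 monic_top_linear_power[of r "b - (q - a)"]
        by (simp add: Q_def X_K2_def kap'_def ab)
    next
      case False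
      then have "a = Suc b" using upper_half_parity(2)[of n] by (simp add: ab)
      then have "a - (q - a) = Suc (b - (q - a))" using 2 pq n by (simp add: Suc_diff_le)
      then show ?thesis using False 2 monic_top_mult_linear[OF monic_top_linear_power[of r "b - (q - a)"], of 0]
        by (simp add: Q_def X_K2_def kap'_def ab)
    qed
    then have "degree (Q p q) \<le> a - (q - a)" "coeff (Q p q) (a - (q - a)) = 1"
      by (auto simp: monic_top_def)
    moreover have "P p q = 0" using 2 by (simp add: P_def X_K1_def ab)
    moreover have "q - a \<le> a" using pq upper_half_double[of n] unfolding a_def by auto
    moreover have "xsym n r t p q = sym_op (- 1) (a - (q - a)) 0 0 (row_var n p)"
      using 2 by (simp add: xsym_def ab Let_def)
    ultimately show ?thesis
      by (simp only:, intro lead_dop_Q[OF _ _ F]) (use 2 in \<open>simp_all add: ab of_nat_diff\<close>)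
  next
    case 3
    define e where "e = b + 1 - q"
    have "monic_top (P p q) e (of_nat e * r - of_nat (a - q) * r) \<and> monic_top (Q p q) e (- (of_nat (a - q) * r))
        \<and> int e - 1 = int b - int q"
    proof (cases "even n")
      case True
      then have "a = b" using upper_half_parity[of n] by (simp add: ab)
      then have e: "e = Suc (a - q)" using 3 by (simp add: e_def)
      have "P p q = [:r, 1:] * monom 1 (a - q)"
        using 3 True by (simp add: P_def X_K2_def ab kap_def pcompose_mult pcompose_power pcompose_linear linear_0_power del: mult_pCons_left)
      moreover have "Q p q = [:0, 1:] * [:- r, 1:] ^ (a - q)"
        using 3 True by (simp add: Q_def X_K1_def ab kap_def pcompose_monom_1)
      ultimately show ?thesis
        using monic_top_mult_linear[OF monic_top_monom, of r "a - q"]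
          monic_top_mult_linear[OF monic_top_linear_power[of r "a - q"], of 0] e \<open>a = b\<close> 3
        by (simp add: algebra_simps)
    next
      case False
      then have ab': "a = Suc b" using upper_half_parity(2)[of n] by (simp add: ab)
      then have e: "e = a - q" using 3 by (simp add: e_def)
      have "P p q = monom 1 (a - q)"
        using 3 False by (simp add: P_def X_K2_def ab kap_def pcompose_power pcompose_linear linear_0_power)
      moreover have "Q p q = [:- r, 1:] ^ (a - q)"
        using 3 False by (simp add: Q_def X_K1_def ab kap_def pcompose_monom_1)
      ultimately show ?thesis
        using monic_top_monom[of "a - q", where 'a = 'a] monic_top_linear_power[of r "a - q"] e ab' 3 by simp
    qed
    moreover have "xsym n r t p q = sym_op (of_nat e * r) (e - 1) 1 e (row_var n p)"
      using 3 by (simp add: xsym_def ab Let_def e_def)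
    ultimately show ?thesis
      by (simp only:, intro lead_dop_monic_top[OF _ _ F, of _ _ "of_nat e * r - of_nat (a - q) * r"
            _ "- (of_nat (a - q) * r)"]) (use 3 in \<open>auto simp: ab\<close>)
  next
    case 4
    have "P p q = monom 1 (b - (q - a))"
      using 4 by (simp add: P_def X_K2_def ab pcompose_power pcompose_linear linear_0_power)
    moreover have "Q p q = 0" using 4 by (simp add: Q_def X_K1_def ab)
    moreover have "q - a \<le> b" using pq n by auto
    moreover have "xsym n r t p q = sym_op 1 (b - (q - a)) 0 0 (row_var n p)"
      using 4 by (simp add: xsym_def ab Let_def)
    ultimately show ?thesis
      by (simp only:, intro lead_dop_P[OF _ _ F])
        (use 4 in \<open>simp_all add: ab of_nat_diff degree_monom_le\<close>)
  qed
qed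

section \<open>The operator Y\<close>

definition ysym :: "nat \<Rightarrow> 'a::comm_ring_1 \<Rightarrow> 'a \<Rightarrow> nat \<Rightarrow> nat \<Rightarrow> 'a mpol \<Rightarrow> 'a mpol"
  where "ysym n r t p q = (let a = upper_half n; b = lower_half n; v = row_var n p in
    if p \<le> a
    then if q \<le> a then sym_op 1 (a - q) 0 0 v
      else sym_op (of_nat (a - (q - a)) * r) (a - (q - a) - 1) 1 (a - (q - a)) v
    else if q \<le> a then sym_op (- 1) (b + 1 - q) 0 0 v
      else sym_op (of_nat (b - (q - a)) * r + t) (b - (q - a)) 1 (b - (q - a) + 1) v)"

text \<open>
  Let \<open>b = lower_half n\<close>. In the second block of an even row, the unshifted \<open>(z + t) z\<^sup>b\<^sup>-\<^sup>j\<close> must be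
  matched by \<open>z (z - r)\<^sup>b\<^sup>-\<^sup>j\<close>, which is \<open>kap n\<close> times the column moved by \<open>r\<close>. If \<open>n\<close> is
  odd then \<open>kap n = 1\<close>, and the column itself has to contain \<open>z + r\<close>. The last column of the
  first block then has index \<open>b + 1\<close> and degree zero.
\<close>

definition Y_col :: "nat \<Rightarrow> 'a::comm_ring_1 \<Rightarrow> nat \<Rightarrow> 'a poly"
  where "Y_col n r j = (if even n then monom 1 (upper_half n - j)
    else if j \<le> lower_half n then [:r, 1:] * monom 1 (lower_half n - j) else 1)"

definition Y_K1 :: "nat \<Rightarrow> 'a::comm_ring_1 \<Rightarrow> nat \<Rightarrow> 'a poly"
  where "Y_K1 n r q = Y_col n r (if q \<le> upper_half n then q else q - upper_half n)"

definition Y_K2 :: "nat \<Rightarrow> 'a::comm_ring_1 \<Rightarrow> nat \<Rightarrow> 'a poly"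
  where "Y_K2 n r q = (if q \<le> upper_half n then 0
    else [:- r, 1:] ^ (lower_half n - (q - upper_half n)))"

lemma monic_top_Y_col:
  assumes "j \<le> upper_half n"
  shows "degree (Y_col n r j) \<le> upper_half n - j" "coeff (Y_col n r j) (upper_half n - j) = 1"
    and "j \<le> lower_half n \<Longrightarrow> monic_top (Y_col n r j) (upper_half n - j) (if even n then 0 else r)"
proof -
  have *: "monic_top (Y_col n r j) (upper_half n - j) (if even n then 0 else r)" if "j \<le> lower_half n"
  proof (cases "even n")
    case True
    then show ?thesis by (simp add: Y_col_def monic_top_monom)
  next
    case False
    then show ?thesis
      using that upper_half_parity(2)[of n] monic_top_mult_linear[OF monic_top_monom, of r "lower_half n - j"]
      by (simp add: Y_col_def Suc_diff_le)
  qed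
  show "j \<le> lower_half n \<Longrightarrow> monic_top (Y_col n r j) (upper_half n - j) (if even n then 0 else r)" by (rule *)
  have "degree (Y_col n r j) \<le> upper_half n - j \<and> coeff (Y_col n r j) (upper_half n - j) = 1"
  proof (cases "j \<le> lower_half n")
    case True
    then show ?thesis using monic_top_degree[OF *] monic_top_coeff[OF *] by blast
  next
    case False
    then have "odd n" "j = upper_half n" using assms upper_half_parity[of n] by (cases "even n"; simp)+
    then show ?thesis using False by (simp add: Y_col_def)
  qed
  then show "degree (Y_col n r j) \<le> upper_half n - j" "coeff (Y_col n r j) (upper_half n - j) = 1" by auto
qed

text \<open>
  Both blocks of a row of type 1 are the same polynomials, so subtracting the first columns from the
  second block clears it; the rows of type 2 are zero in the first block and do not change.
\<close>

lemma Y_semisym_op: "semisym_op n r (Y_K1 n r) (Y_K2 n r)"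
  for r :: "'a::{idom,ring_char_0}"
proof
  let ?a = "upper_half n"
  fix J \<xi> c and M :: "nat \<Rightarrow> nat \<Rightarrow> 'a"
  assume J: "J \<subseteq> {1..n}" "?a < card J"
    and M: "\<And>p q. p \<in> J \<Longrightarrow> q \<in> {1..n} \<Longrightarrow> M p q = c p * poly (Y_K1 n r q) (\<xi> p)"
  show "detf n M = 0"
  proof (subst detf_subtract_columns[OF upper_half_double], rule detf_pigeonhole[OF J])
    fix p q assume pq: "p \<in> J" "q \<in> {1..n}" "?a < q"
    then have "q - ?a \<in> {1..n}" "q - ?a \<le> ?a" using upper_half_double[of n] by auto
    then show "(if ?a < q then M p q - M p (q - ?a) else M p q) = 0"
      using pq by (simp add: M Y_K1_def)
  qed
next
  let ?a = "upper_half n"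
  fix x :: "nat \<Rightarrow> 'a"
  have "q - ?a \<le> ?a" if "q \<in> {?a + 1..n}" for q using that upper_half_double[of n] by auto
  then show "detf n (\<lambda>p q. if p \<le> ?a then poly (Y_K1 n r q) (x (row_var n p))
      else poly (Y_K2 n r q) (x (row_var n p) + r)) = vdm n x"
    by (subst detf_subtract_columns[OF upper_half_double], intro vdm_block[OF refl refl, where P = "Y_col n r" and Q = "\<lambda>j. monom 1 (lower_half n - j)"])
      (auto simp: Y_K1_def Y_K2_def degree_monom_le poly_monom monic_top_Y_col)
qed

lemma Y_col_shift:
  assumes "j \<le> upper_half n"
  shows "kap n * pcompose (Y_col n r j) [:- r, 1:] =
    (if j \<le> lower_half n then [:0, 1:] * [:- r, 1:] ^ (lower_half n - j) else 1)"
  using assms upper_half_parity[of n]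
  by (auto simp: Y_col_def kap_def pcompose_mult pcompose_linear pcompose_monom_1 pcompose_one simp del: mult_pCons_left)

lemma Y_symbol:
  fixes r t :: "'a::{idom,ring_char_0}"
  assumes pq: "p \<in> {1..n}" "q \<in> {1..n}" and F: "lead d F G"
  shows "lead ((if p \<le> upper_half n then int (upper_half n) else int (lower_half n) + 1)
      - (if q \<le> upper_half n then int q else int (q - upper_half n) + 1) + d)
    (dop (semisym_op.P n r (Y_K1 n r) (Y_K2 n r) 1 [:t, 1:] p q) (semisym_op.Q n r (Y_K1 n r) (Y_K2 n r) p q) (row_var n p) F)
    (ysym n r t p q G)"
proof -
  interpret semisym_op n r "Y_K1 n r" "Y_K2 n r" 1 "[:t, 1:]" by (rule Y_semisym_op)
  define a b where "a = upper_half n" and "b = lower_half n"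
  have n: "n = a + b" using halves[of n] by (simp add: a_def b_def)
  note ab = a_def[symmetric] b_def[symmetric]
  have ba: "b \<le> a" "a \<le> Suc b" using upper_half_parity[of n] by (cases "even n"; simp add: ab)+
  consider "p \<le> a" "q \<le> a" | "p \<le> a" "\<not> q \<le> a" | "\<not> p \<le> a" "q \<le> a" | "\<not> p \<le> a" "\<not> q \<le> a" by blast
  then show ?thesis
  proof cases
    case 1
    have "Q p q = 0" using 1 by (simp add: Q_def Y_K2_def ab)
    moreover have "P p q = Y_col n r q" using 1 by (simp add: P_def Y_K1_def ab)
    moreover have "ysym n r t p q = sym_op 1 (a - q) 0 0 (row_var n p)"
      using 1 by (simp add: ysym_def ab Let_def)
    ultimately show ?thesis
      by (simp only:, intro lead_dop_P[OF _ _ F])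
        (use 1 monic_top_Y_col(1,2)[of q n r] in \<open>simp_all add: ab of_nat_diff\<close>)
  next
    case 2
    define j where "j = q - a"
    have j: "j \<le> b" "1 \<le> j" "j \<le> a" using 2 pq n ba by (auto simp: j_def)
    have P: "P p q = Y_col n r j" using 2 by (simp add: P_def Y_K1_def ab j_def)
    have Q: "Q p q = kap' n * [:- r, 1:] ^ (b - j)" using 2 by (simp add: Q_def Y_K2_def ab j_def)
    have "monic_top (Q p q) (a - j) (- (of_nat (b - j) * r)) \<and>
        (if even n then 0 else r) - - (of_nat (b - j) * r) = of_nat (a - j) * r"
    proof (cases "even n")
      case True
      then show ?thesis
        using upper_half_parity(1)[of n] monic_top_linear_power[of r "b - j"] by (simp add: Q kap'_def ab)
    next
      case False
      then have "a - j = Suc (b - j)" using upper_half_parity(2)[of n] j by (simp add: ab)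
      then show ?thesis
        using False monic_top_mult_linear[OF monic_top_linear_power[of r "b - j"], of 0]
        by (simp add: Q kap'_def algebra_simps)
    qed
    moreover have "monic_top (P p q) (a - j) (if even n then 0 else r)"
      unfolding P using monic_top_Y_col(3)[of j n r] j by (simp add: ab)
    moreover have "ysym n r t p q = sym_op (of_nat (a - j) * r) (a - j - 1) 1 (a - j) (row_var n p)"
      using 2 by (simp add: ysym_def ab Let_def j_def)
    ultimately show ?thesis
      by (simp only:, intro lead_dop_monic_top[OF _ _ F, of _ _ "if even n then 0 else r"
            _ "- (of_nat (b - j) * r)"]) (use 2 j in \<open>auto simp: ab of_nat_diff j_def[symmetric]\<close>)
  next
    case 3
    define e where "e = b + 1 - q"
    have "P p q = 0" using 3 by (simp add: P_def Y_K2_def ab)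
    moreover have "Q p q = (if q \<le> b then [:0, 1:] * [:- r, 1:] ^ (b - q) else 1)"
      using 3 Y_col_shift[of q n r] by (simp add: Q_def Y_K1_def ab)
    then have "degree (Q p q) \<le> e \<and> coeff (Q p q) e = 1"
      using monic_top_mult_linear[OF monic_top_linear_power[of r "b - q"], of 0]
      by (auto simp: e_def Suc_diff_le monic_top_def simp del: mult_pCons_left)
    moreover have "ysym n r t p q = sym_op (- 1) e 0 0 (row_var n p)"
      using 3 by (simp add: ysym_def ab Let_def e_def)
    moreover have "int e = int b + 1 - int q" using 3 ba by (simp add: e_def of_nat_diff)
    ultimately show ?thesis
      by (simp only:, intro lead_dop_Q[OF _ _ F]) (use 3 in \<open>auto simp: ab\<close>)
  next
    case 4
    define j where "j = q - a"
    have j: "j \<le> b" "1 \<le> j" "j \<le> a" using 4 pq n ba by (auto simp: j_def)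
    have "P p q = [:t, 1:] * monom 1 (b - j)"
      using 4 by (simp add: P_def Y_K2_def ab j_def pcompose_power pcompose_linear linear_0_power)
    moreover have "Q p q = [:0, 1:] * [:- r, 1:] ^ (b - j)"
      using 4 Y_col_shift[of j n r] j by (simp add: Q_def Y_K1_def ab j_def)
    moreover have "ysym n r t p q =
        sym_op (of_nat (b - j) * r + t) (Suc (b - j) - 1) 1 (Suc (b - j)) (row_var n p)"
      using 4 by (simp add: ysym_def ab Let_def j_def)
    ultimately show ?thesis
      by (simp only:, intro lead_dop_monic_top[OF monic_top_mult_linear[OF monic_top_monom]
            monic_top_mult_linear[OF monic_top_linear_power] F])
        (use 4 j in \<open>simp_all add: ab of_nat_diff j_def[symmetric]\<close>)
  qed
qed

lemma prod_if_parity: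
  "(\<Prod>i\<in>{1..n}. if odd i then f i else 1) = (\<Prod>i\<in>{i\<in>{1..n}. odd i}. f i)"
  "(\<Prod>i\<in>{1..n}. if odd i then 1 else f i) = (\<Prod>i\<in>{i\<in>{1..n}. even i}. f i)"
  for f :: "nat \<Rightarrow> 'a::comm_monoid_mult"
  by (subst prod.inter_filter, simp, rule prod.cong, simp, simp)+

theorem sym_det_eigen:
  fixes F :: "'a::{idom,ring_char_0} mpol"
  assumes r: "\<And>j m. 1 \<le> j \<or> 1 \<le> m \<Longrightarrow> of_nat j * r + of_nat m \<noteq> 0"
    and l: "l \<in> Lam n" and F: "semisym n F" "deg_in {..int (odd_size n l)} F"
    and zero: "\<And>\<mu>. \<mu> \<in> Lam n \<Longrightarrow> odd_size n \<mu> \<le> odd_size n l \<Longrightarrow> \<mu> \<noteq> l \<Longrightarrow>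
      eval_at (\<lambda>i. rho n r i + of_nat (\<mu> i)) F = 0"
  shows "sym_det n (xsym n r t) (hom_component (odd_size n l) F) =
      vdm n zvar * (const (\<Prod>i\<in>{i\<in>{1..n}. odd i}. t + (rho n r i + of_nat (l i))) * hom_component (odd_size n l) F)"
    and "sym_det n (ysym n r t) (hom_component (odd_size n l) F) =
      vdm n zvar * (const (\<Prod>i\<in>{i\<in>{1..n}. even i}. t + (rho n r i + of_nat (l i))) * hom_component (odd_size n l) F)"
proof -
  let ?H = "hom_component (odd_size n l) F" and ?z = "\<lambda>i. rho n r i + of_nat (l i)"
  define u w where "u k p = (if p \<le> upper_half n then int (upper_half n) else int (lower_half n) + k)"
    and "w k q = (if q \<le> upper_half n then int q else int (q - upper_half n) + k)" for k p q
  have D: "(\<Sum>p\<in>{1..n}. u k p) - (\<Sum>q\<in>{1..n}. w k q) = int (card (parity_pairs n))" for k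
    by (rule degree_sum) (simp_all add: u_def w_def)
  have "sym_det n (xsym n r t) ?H =
      vdm n zvar * (const (\<Prod>i\<in>{1..n}. poly (if odd i then [:t, 1:] else 1) (?z i)) * ?H)"
  proof (rule top_component_eigen[OF X_semisym_op _ D[of 0] r l F zero])
    fix p q d and F G :: "'a mpol"
    assume pq: "p \<in> {1..n}" "q \<in> {1..n}" "lead d F G"
    show "lead (u 0 p - w 0 q + d)
        (dop (semisym_op.P n r (X_K1 n) (X_K2 n r) [:t, 1:] 1 p q) (semisym_op.Q n r (X_K1 n) (X_K2 n r) p q) (row_var n p) F)
        (xsym n r t p q G)"
      unfolding u_def w_def by (rule X_symbol[OF pq])
  qed
  moreover have "(\<Prod>i\<in>{1..n}. poly (if odd i then [:t, 1:] else 1) (?z i)) = (\<Prod>i\<in>{i\<in>{1..n}. odd i}. t + ?z i)"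
    unfolding prod_if_parity(1)[symmetric] by (rule prod.cong) auto
  ultimately show "sym_det n (xsym n r t) ?H =
      vdm n zvar * (const (\<Prod>i\<in>{i\<in>{1..n}. odd i}. t + ?z i) * ?H)" by (simp only:)
  have "sym_det n (ysym n r t) ?H =
      vdm n zvar * (const (\<Prod>i\<in>{1..n}. poly (if odd i then 1 else [:t, 1:]) (?z i)) * ?H)"
  proof (rule top_component_eigen[OF Y_semisym_op _ D[of 1] r l F zero])
    fix p q d and F G :: "'a mpol"
    assume pq: "p \<in> {1..n}" "q \<in> {1..n}" "lead d F G"
    show "lead (u 1 p - w 1 q + d)
        (dop (semisym_op.P n r (Y_K1 n r) (Y_K2 n r) 1 [:t, 1:] p q) (semisym_op.Q n r (Y_K1 n r) (Y_K2 n r) p q) (row_var n p) F)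
        (ysym n r t p q G)"
      unfolding u_def w_def by (rule Y_symbol[OF pq])
  qed
  moreover have "(\<Prod>i\<in>{1..n}. poly (if odd i then 1 else [:t, 1:]) (?z i)) = (\<Prod>i\<in>{i\<in>{1..n}. even i}. t + ?z i)"
    unfolding prod_if_parity(2)[symmetric] by (rule prod.cong) auto
  ultimately show "sym_det n (ysym n r t) ?H =
      vdm n zvar * (const (\<Prod>i\<in>{i\<in>{1..n}. even i}. t + ?z i) * ?H)" by (simp only:)
qed

section \<open>Orbit sums indexed by tuples\<close>

text \<open>
  The alternating sum \<open>l\<^sub>m - l\<^sub>m\<^sub>+\<^sub>1 + l\<^sub>m\<^sub>+\<^sub>2 - \<dots>\<close>, grouped into the nonnegative gaps of a tuple. The
  sum runs far enough because tuples vanish beyond \<open>n\<close>.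
\<close>

definition gap_exp :: "nat \<Rightarrow> (nat \<Rightarrow> nat) \<Rightarrow> nat \<Rightarrow> nat"
  where "gap_exp n l m = (\<Sum>j\<le>n. l (m + 2 * j) - l (Suc (m + 2 * j)))"

lemma gap_exp_beyond:
  assumes "l \<in> Lam n" "n < m"
  shows "gap_exp n l m = 0"
  using assms by (simp add: gap_exp_def Lam_def)

lemma gap_exp_rec:
  assumes "l \<in> Lam n"
  shows "gap_exp n l m = (l m - l (Suc m)) + gap_exp n l (m + 2)"
proof -
  let ?f = "\<lambda>k. l k - l (Suc k)"
  have last: "?f (m + 2 + 2 * n) = 0" using assms by (simp add: Lam_def)
  have "gap_exp n l m + ?f (m + 2 + 2 * n) = (\<Sum>j\<le>Suc n. ?f (m + 2 * j))"
    by (simp add: gap_exp_def add_ac)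
  also have "\<dots> = ?f m + (\<Sum>j\<le>n. ?f (m + 2 * Suc j))"
    by (subst sum.atMost_Suc_shift) simp
  finally show ?thesis using last by (simp add: gap_exp_def add_ac)
qed

lemma gap_exp_pair:
  assumes l: "l \<in> Lam n" and "1 \<le> m"
  shows "gap_exp n l m + gap_exp n l (Suc m) = l m"
  using assms(2)
proof (induction "Suc n - m" arbitrary: m rule: less_induct)
  case less
  show ?case
  proof (cases "n < m")
    case True
    then show ?thesis using gap_exp_beyond[OF l] l by (simp add: Lam_def)
  next
    case False
    have "l (Suc m) \<le> l m" using l False less.prems by (cases "m = n") (auto simp: Lam_def)
    moreover have "gap_exp n l (Suc m) + gap_exp n l (Suc (Suc m)) = l (Suc m)"
      using less.hyps[of "Suc m"] False by simp
    ultimately show ?thesis using gap_exp_rec[OF l, of m] by simp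
  qed
qed

lemma gap_exp_antimono:
  assumes l: "l \<in> Lam n" and "i \<le> j" "even (i + j)"
  shows "gap_exp n l j \<le> gap_exp n l i"
proof -
  from assms(2,3) have "even (j - i)" by simp
  then obtain k where "j - i = 2 * k" by (rule evenE)
  with assms(2) have "j = i + 2 * k" by simp
  moreover have "gap_exp n l (i + 2 * k) \<le> gap_exp n l i"
  proof (induction k)
    case (Suc k)
    then show ?case using gap_exp_rec[OF l, of "i + 2 * k"] by simp
  qed simp
  ultimately show ?thesis by simp
qed

lemma sum_pairwise: "(\<Sum>m\<in>{1..n}. g m) + (if odd n then g (Suc n) else 0) =
    (\<Sum>m\<in>{m\<in>{1..n}. odd m}. g m + g (Suc m))" for g :: "nat \<Rightarrow> nat"
proof (induction n)
  case (Suc n)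
  have "{m \<in> {1..Suc n}. odd m} =
      (if odd (Suc n) then insert (Suc n) {m \<in> {1..n}. odd m} else {m \<in> {1..n}. odd m})"
    by (auto simp: le_Suc_eq)
  then show ?case using Suc by (cases "odd n") simp_all
qed simp

lemma sum_gap_exp:
  assumes l: "l \<in> Lam n"
  shows "(\<Sum>m\<in>{1..n}. gap_exp n l m) = odd_size n l"
proof -
  have "(\<Sum>m\<in>{1..n}. gap_exp n l m) = (\<Sum>m\<in>{m\<in>{1..n}. odd m}. gap_exp n l m + gap_exp n l (Suc m))"
    using sum_pairwise[of "gap_exp n l" n] gap_exp_beyond[OF l, of "Suc n"] by (simp split: if_splits)
  also have "\<dots> = odd_size n l"
    unfolding odd_size_def by (rule sum.cong) (use gap_exp_pair[OF l] in auto)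
  finally show ?thesis .
qed

definition gap_mon :: "nat \<Rightarrow> (nat \<Rightarrow> nat) \<Rightarrow> nat \<Rightarrow>\<^sub>0 nat"
  where "gap_mon n l = (\<Sum>m\<in>{1..n}. single m (gap_exp n l m))"

lemma lookup_gap_mon:
  "lookup (gap_mon n l) m = (if m \<in> {1..n} then gap_exp n l m else 0)"
  by (auto simp: gap_mon_def lookup_sum lookup_single when_def)

lemma keys_gap_mon: "keys (gap_mon n l) \<subseteq> {1..n}"
  by (auto simp: in_keys_iff lookup_gap_mon split: if_splits)

lemma mon_degree_gap_mon:
  assumes "l \<in> Lam n"
  shows "mon_degree (gap_mon n l) = odd_size n l"
proof -
  have "mon_degree (gap_mon n l) = (\<Sum>i\<in>{1..n}. lookup (gap_mon n l) i)"
    by (rule mon_degree_superset[OF _ keys_gap_mon]) simp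
  also have "\<dots> = (\<Sum>i\<in>{1..n}. gap_exp n l i)"
    by (rule sum.cong) (simp_all add: lookup_gap_mon)
  also have "\<dots> = odd_size n l" by (rule sum_gap_exp[OF assms])
  finally show ?thesis .
qed

text \<open>
  A monomial is repeated as often as there are permutations fixing it. In characteristic zero this
  does no harm, and invariance is a mere reindexing.
\<close>

definition orbit_sum :: "nat \<Rightarrow> (nat \<Rightarrow> nat) \<Rightarrow> 'a::comm_ring_1 mpol"
  where "orbit_sum n l = (\<Sum>\<pi>\<in>parity_perms n. mon_val (\<lambda>i. zvar (\<pi> i)) (gap_mon n l))"

lemma finite_parity_perms: "finite (parity_perms n)"
  by (rule finite_subset[OF _ finite_permutations[of "{1..n}"]]) (auto simp: parity_perms_def)

lemma subst_mon_val: "subst s (mon_val t m) = mon_val (\<lambda>i. subst s (t i)) m"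
  by (simp add: mon_val_def subst.hom_prod subst.hom_power)

lemma orbit_sum_semisym: "semisym n (orbit_sum n l)"
  unfolding semisym_def
proof (intro conjI ballI impI)
  show "orbit_sum n l \<in> polys n"
    unfolding orbit_sum_def mon_val_def
  proof (intro polys_sum polys_prod polys_power)
    fix \<pi> i assume "\<pi> \<in> parity_perms n" "i \<in> keys (gap_mon n l)"
    then have "\<pi> permutes {1..n}" "i \<in> {1..n}" using keys_gap_mon[of n l] unfolding parity_perms_def by blast+
    then have "\<pi> i \<in> {1..n}" using permutes_in_image by metis
    then show "zvar (\<pi> i) \<in> polys n" by (rule polys_zvar)
  qed
  fix i j assume ij: "i \<in> {1..n}" "j \<in> {1..n}" "even (i + j)"
  let ?t = "transpose i j"
  have "subst (\<lambda>k. zvar (?t k)) (orbit_sum n l) =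
      (\<Sum>\<pi>\<in>parity_perms n. mon_val (\<lambda>k. zvar ((?t \<circ> \<pi>) k)) (gap_mon n l))"
    by (simp add: orbit_sum_def subst.hom_sum subst_mon_val const_hom)
  also have "\<dots> = orbit_sum n l"
    unfolding orbit_sum_def
  proof (rule sum.reindex_bij_witness[where i = "\<lambda>\<pi>. ?t \<circ> \<pi>" and j = "\<lambda>\<pi>. ?t \<circ> \<pi>"])
    fix \<pi> assume \<pi>: "\<pi> \<in> parity_perms n"
    have "?t \<circ> (?t \<circ> \<pi>) = \<pi>" by (simp add: fun_eq_iff)
    then show "?t \<circ> (?t \<circ> \<pi>) = \<pi>" "?t \<circ> (?t \<circ> \<pi>) = \<pi>" by auto
    have "i mod 2 = j mod 2" using ij(3) by presburger
    then have "?t k mod 2 = k mod 2" for k by (simp add: transpose_def)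
    moreover have "?t \<circ> \<pi> permutes {1..n}"
      using \<pi> permutes_compose[OF _ permutes_swap_id[OF ij(1,2)], of \<pi>] by (simp add: parity_perms_def)
    ultimately have "?t \<circ> \<pi> \<in> parity_perms n" using \<pi> by (simp add: parity_perms_def)
    then show "?t \<circ> \<pi> \<in> parity_perms n" "?t \<circ> \<pi> \<in> parity_perms n" by auto
  qed auto
  finally show "subst (\<lambda>k. zvar (?t k)) (orbit_sum n l) = orbit_sum n l" .
qed

lemma mon_val_perm: "mon_val (\<lambda>i. zvar (\<pi> i)) m =
    single (\<Sum>i\<in>keys m. single (\<pi> i) (lookup m i)) 1"
proof -
  have "(\<Prod>i\<in>S. zvar (\<pi> i) ^ g i) = single (\<Sum>i\<in>S. single (\<pi> i) (g i)) 1"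
    if "finite S" for S :: "nat set" and g
    using that by (induction S) (auto simp: zvar_power mult_single)
  from this[of "keys m" "lookup m"] show ?thesis by (simp add: mon_val_def)
qed

lemma orbit_sum_deg:
  assumes "l \<in> Lam n"
  shows "deg_in {..int (odd_size n l)} (orbit_sum n l)"
  unfolding orbit_sum_def
proof (rule deg_in_sum)
  fix \<pi> :: "nat \<Rightarrow> nat"
  have "mon_degree (\<Sum>i\<in>S. single (\<pi> i) (g i)) = (\<Sum>i\<in>S. g i)" if "finite S" for S :: "nat set" and g
    using that by (induction S) (auto simp: mon_degree_add mon_degree_single mon_degree_0)
  then show "deg_in {..int (odd_size n l)} (mon_val (\<lambda>i. zvar (\<pi> i)) (gap_mon n l) :: 'a mpol)"
    using mon_degree_gap_mon[OF assms]
    by (simp add: mon_val_perm deg_in_def mon_degree_def[of "gap_mon n l"])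
qed

text \<open>
  Count the indices in the parity class of \<open>i\<close> with a value of at least \<open>M i\<close>. By the injection \<open>\<pi>\<close>
  there are at least as many for \<open>M'\<close> as for \<open>M\<close>. Since both sequences decrease,
  \<open>M' i < M i\<close> would make them fewer.
\<close>

lemma sorted_rearrangement_le:
  fixes M M' :: "nat \<Rightarrow> nat"
  assumes inj: "inj_on \<pi> {1..n}" and \<pi>: "\<And>j. j \<in> {1..n} \<Longrightarrow> \<pi> j \<in> {1..n} \<and> even (\<pi> j + j) \<and> M' (\<pi> j) = M j"
    and M: "\<And>i j. i \<in> {1..n} \<Longrightarrow> j \<in> {1..n} \<Longrightarrow> i \<le> j \<Longrightarrow> even (i + j) \<Longrightarrow> M j \<le> M i"
    and M': "\<And>i j. i \<in> {1..n} \<Longrightarrow> j \<in> {1..n} \<Longrightarrow> i \<le> j \<Longrightarrow> even (i + j) \<Longrightarrow> M' j \<le> M' i"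
    and i: "i \<in> {1..n}"
  shows "M i \<le> M' i"
proof (rule ccontr)
  assume less: "\<not> M i \<le> M' i"
  define A where "A = {j \<in> {1..n}. even (i + j) \<and> M i \<le> M j}"
  define A' where "A' = {j \<in> {1..n}. even (i + j) \<and> M i \<le> M' j}"
  \<comment> \<open>\<open>B \<subseteq> A\<close> and \<open>A' \<subseteq> B - {i}\<close> contradict \<open>card A \<le> card A'\<close>\<close>
  define B where "B = {j \<in> {1..n}. even (i + j) \<and> j \<le> i}"
  have fin: "finite A" "finite A'" "finite B" by (simp_all add: A_def A'_def B_def)
  have "B \<subseteq> A" using M i by (auto simp: A_def B_def add.commute)
  then have "card B \<le> card A" by (rule card_mono[OF fin(1)])
  also have "\<dots> \<le> card A'"
  proof (rule card_inj_on_le[where f = \<pi>])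
    show "inj_on \<pi> A" by (rule inj_on_subset[OF inj]) (auto simp: A_def)
    show "\<pi> ` A \<subseteq> A'"
    proof
      fix k assume "k \<in> \<pi> ` A"
      then obtain j where j: "k = \<pi> j" "j \<in> {1..n}" "even (i + j)" "M i \<le> M j" by (auto simp: A_def)
      have "even (i + \<pi> j)" using conjunct1[OF conjunct2[OF \<pi>[OF j(2)]]] j(3) by presburger
      then show "k \<in> A'" using \<pi>[OF j(2)] j by (simp add: A'_def)
    qed
  qed (rule fin)
  also have "A' \<subseteq> B - {i}"
  proof
    fix j assume j: "j \<in> A'"
    then have "\<not> i \<le> j" using M'[OF i, of j] less by (auto simp: A'_def)
    then show "j \<in> B - {i}" using j by (auto simp: A'_def B_def)
  qed
  then have "card A' \<le> card (B - {i})" by (intro card_mono) (use fin in auto)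
  also have "\<dots> < card B" by (rule card_Diff1_less[OF fin(3)]) (use i in \<open>auto simp: B_def\<close>)
  finally show False by simp
qed

text \<open>
  The exponents are sorted in each parity class, so they are determined by their orbit; and the tuple is
  recovered from sums of neighbouring exponents. Hence different tuples have disjoint orbits.
\<close>

lemma gap_exp_inject:
  assumes l: "l \<in> Lam n" and l': "l' \<in> Lam n" and \<pi>: "\<pi> \<in> parity_perms n"
    and eq: "\<And>i. i \<in> {1..n} \<Longrightarrow> gap_exp n l' (\<pi> i) = gap_exp n l i"
  shows "l = l'"
proof -
  have p: "\<pi> permutes {1..n}" using \<pi> by (simp add: parity_perms_def)
  have pin: "\<pi> j \<in> {1..n}" if "j \<in> {1..n}" for j using p that permutes_in_image by metis
  have par: "even (\<pi> j + j)" if "j \<in> {1..n}" for j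
  proof -
    have "\<pi> j mod 2 = j mod 2" using \<pi> that by (simp add: parity_perms_def)
    then show ?thesis by presburger
  qed
  have invin: "inv_into UNIV \<pi> j \<in> {1..n}" if "j \<in> {1..n}" for j
    using permutes_inv[OF p] that permutes_in_image by metis
  have e: "gap_exp n l i = gap_exp n l' i" if "i \<in> {1..n}" for i
  proof (rule antisym)
    show "gap_exp n l i \<le> gap_exp n l' i"
      by (rule sorted_rearrangement_le[where n = n and \<pi> = \<pi>])
        (use that pin par eq gap_exp_antimono[OF l] gap_exp_antimono[OF l'] permutes_inj_on[OF p] in auto)
    have "inv_into UNIV \<pi> j \<in> {1..n} \<and> even (inv_into UNIV \<pi> j + j) \<and> gap_exp n l (inv_into UNIV \<pi> j) = gap_exp n l' j"
      if j: "j \<in> {1..n}" for j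
      using par[OF invin[OF j]] eq[OF invin[OF j]] invin[OF j] permutes_inverses(1)[OF p, of j]
      by (simp add: add.commute)
    then show "gap_exp n l' i \<le> gap_exp n l i"
      by (intro sorted_rearrangement_le[where n = n and \<pi> = "inv_into UNIV \<pi>" and M = "gap_exp n l'" and M' = "gap_exp n l"])
        (use that gap_exp_antimono[OF l] gap_exp_antimono[OF l'] permutes_inj_on[OF permutes_inv[OF p]] in auto)
  qed
  show ?thesis
  proof
    fix i
    show "l i = l' i"
    proof (cases "i \<in> {1..n}")
      case True
      have "gap_exp n l (Suc i) = gap_exp n l' (Suc i)"
        using e[of "Suc i"] gap_exp_beyond[OF l, of "Suc i"] gap_exp_beyond[OF l', of "Suc i"] True
        by (cases "i = n") auto
      then show ?thesis
        using e[OF True] gap_exp_pair[OF l, of i] gap_exp_pair[OF l', of i] True by simp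
    next
      case False
      then show ?thesis using l l' by (simp add: Lam_def)
    qed
  qed
qed

lemma lookup_orbit_sum_other:
  assumes "l \<in> Lam n" "l' \<in> Lam n" "l \<noteq> l'"
  shows "lookup (orbit_sum n l) (gap_mon n l') = 0"
  unfolding orbit_sum_def lookup_sum
proof (rule sum.neutral, rule ballI)
  fix \<pi> assume \<pi>: "\<pi> \<in> parity_perms n"
  then have p: "\<pi> permutes {1..n}" by (simp add: parity_perms_def)
  let ?N = "\<Sum>i\<in>keys (gap_mon n l). single (\<pi> i) (lookup (gap_mon n l) i)"
  have N: "lookup ?N (\<pi> i) = lookup (gap_mon n l) i" for i
  proof -
    have "lookup ?N (\<pi> i) = (\<Sum>k\<in>keys (gap_mon n l).
        if k = i then lookup (gap_mon n l) k else 0)"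
      unfolding lookup_sum lookup_single when_def
      by (rule sum.cong) (auto dest: injD[OF permutes_inj[OF p]])
    then show ?thesis by (auto simp: in_keys_iff)
  qed
  have "?N \<noteq> gap_mon n l'"
  proof
    assume eq: "?N = gap_mon n l'"
    have "gap_exp n l' (\<pi> i) = gap_exp n l i" if "i \<in> {1..n}" for i
    proof -
      have "\<pi> i \<in> {1..n}" using p that permutes_in_image by metis
      moreover have "lookup (gap_mon n l') (\<pi> i) = lookup (gap_mon n l) i"
        using N[of i] unfolding eq .
      ultimately show ?thesis using that by (simp add: lookup_gap_mon)
    qed
    from gap_exp_inject[OF assms(1,2) \<pi> this] assms(3) show False by simp
  qed
  then show "lookup (mon_val (\<lambda>i. zvar (\<pi> i)) (gap_mon n l)) (gap_mon n l') = 0"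
    unfolding mon_val_perm by (simp add: lookup_single)
qed

lemma lookup_orbit_sum_self:
  "lookup (orbit_sum n l :: 'a::{comm_ring_1,ring_char_0} mpol) (gap_mon n l) \<noteq> 0"
proof -
  define c :: "(nat \<Rightarrow> nat) \<Rightarrow> nat" where "c \<pi> = (if (\<Sum>i\<in>keys (gap_mon n l).
    single (\<pi> i) (lookup (gap_mon n l) i)) = gap_mon n l then 1 else 0)" for \<pi>
  have "lookup (orbit_sum n l :: 'a mpol) (gap_mon n l) = of_nat (\<Sum>\<pi>\<in>parity_perms n. c \<pi>)"
    unfolding orbit_sum_def lookup_sum of_nat_sum
    by (rule sum.cong) (auto simp: mon_val_perm lookup_single c_def)
  moreover have "(\<Sum>\<pi>\<in>parity_perms n. c \<pi>) \<noteq> 0"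
  proof -
    have "id \<in> parity_perms n" by (simp add: parity_perms_def permutes_id)
    moreover have "c id = 1" unfolding c_def id_apply monom_expand[of "gap_mon n l", symmetric] by simp
    ultimately show ?thesis using finite_parity_perms[of n] by (auto intro!: bexI[where x = id])
  qed
  ultimately show ?thesis by (metis of_nat_eq_0_iff)
qed

section \<open>Underdetermined linear systems\<close>

text \<open>
  There is one unknown for each \<open>u\<close>, and one equation for each \<open>e \<noteq> u0\<close>. Completing them by a zero row
  gives a square matrix of determinant zero, which has a nonzero vector in its kernel even over a domain.
\<close>

lemma underdetermined_system:
  fixes M :: "'u \<Rightarrow> 'u \<Rightarrow> 'a::idom"
  assumes U: "finite U" "u0 \<in> U"
  shows "\<exists>c. (\<exists>u\<in>U. c u \<noteq> 0) \<and> (\<forall>e\<in>U - {u0}. (\<Sum>u\<in>U. M e u * c u) = 0)"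
proof -
  define N where "N = card U"
  obtain f where f: "bij_betw f {0..<N} U"
    using ex_bij_betw_nat_finite[OF U(1)] by (auto simp: N_def)
  define G where "G p q = (if f (p - 1) = u0 then 0 else M (f (p - 1)) (f (q - 1)))" for p q
  let ?A = "mat N N (\<lambda>(i, j). G (Suc i) (Suc j))"
  obtain i0 where i0: "i0 < N" "f i0 = u0" using f U(2) by (metis atLeastLessThan_iff bij_betwE bij_betw_imp_surj_on imageE)
  have "detf N G = 0" by (rule detf_zero_row[of "Suc i0"]) (use i0 in \<open>auto simp: G_def\<close>)
  then have "det ?A = 0" by (simp only: detf_eq_det)
  then obtain v where v: "v \<in> carrier_vec N" "v \<noteq> 0\<^sub>v N" "?A *\<^sub>v v = 0\<^sub>v N"
    using det_0_iff_vec_prod_zero[of ?A N] by auto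
  define c where "c u = v $ (inv_into {0..<N} f u)" for u
  have cf: "c (f j) = v $ j" if "j < N" for j
    unfolding c_def using bij_betw_inv_into_left[OF f, of j] that by simp
  have "\<exists>j<N. v $ j \<noteq> 0"
  proof (rule ccontr)
    assume "\<not> (\<exists>j<N. v $ j \<noteq> 0)"
    then have "v = 0\<^sub>v N" using v(1) by (intro eq_vecI) auto
    with v(2) show False by simp
  qed
  then obtain j where j: "j < N" "v $ j \<noteq> 0" by blast
  have "f j \<in> U" using f j(1) by (auto dest: bij_betwE)
  moreover have "c (f j) \<noteq> 0" using j cf by simp
  moreover have "(\<Sum>u\<in>U. M e u * c u) = 0" if e: "e \<in> U - {u0}" for e
  proof -
    obtain i where i: "i < N" "f i = e" using f e by (metis DiffD1 atLeastLessThan_iff bij_betw_imp_surj_on imageE)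
    have "(\<Sum>u\<in>U. M e u * c u) = (\<Sum>j\<in>{0..<N}. M e (f j) * c (f j))"
      by (rule sum.reindex_bij_betw[OF f, symmetric])
    also have "\<dots> = (\<Sum>j\<in>{0..<N}. G (Suc i) (Suc j) * v $ j)"
      by (rule sum.cong) (use i e in \<open>auto simp: cf G_def\<close>)
    also have "\<dots> = (?A *\<^sub>v v) $ i"
      using i v(1) by (simp add: scalar_prod_def)
    finally show ?thesis using v(3) i by simp
  qed
  ultimately show ?thesis by blast
qed

text \<open>
  Divide a nonzero solution by the indeterminate until some entry has a nonzero constant term.
\<close>

lemma primitive_solution:
  fixes M :: "'u \<Rightarrow> 'u \<Rightarrow> 'k::idom poly"
  assumes U: "finite U" "u0 \<in> U"
  shows "\<exists>c. (\<exists>u\<in>U. poly (c u) 0 \<noteq> 0) \<and> (\<forall>e\<in>U - {u0}. (\<Sum>u\<in>U. M e u * c u) = 0)"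
proof -
  obtain c u1 where c: "u1 \<in> U" "c u1 \<noteq> 0" "\<forall>e\<in>U - {u0}. (\<Sum>u\<in>U. M e u * c u) = 0"
    using underdetermined_system[OF U, of M] by blast
  from c(2,3) show ?thesis
  proof (induction "degree (c u1)" arbitrary: c rule: less_induct)
    case less
    show ?case
    proof (cases "\<exists>u\<in>U. poly (c u) 0 \<noteq> 0")
      case True
      then show ?thesis using less.prems by blast
    next
      case False
      then have "\<forall>u\<in>U. \<exists>q. c u = [:0, 1:] * q"
        by (auto simp: poly_eq_0_iff_dvd dvd_def)
      from bchoice[OF this] obtain d where d: "\<forall>u\<in>U. c u = [:0, 1:] * d u" by blast
      have d1: "d u1 \<noteq> 0" using d c(1) less.prems(1) by auto
      then have "degree (d u1) < degree (c u1)" using d c(1) by simp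
      moreover have "(\<Sum>u\<in>U. M e u * d u) = 0" if "e \<in> U - {u0}" for e
      proof -
        have "[:0, 1:] * (\<Sum>u\<in>U. M e u * d u) = (\<Sum>u\<in>U. M e u * c u)"
          unfolding sum_distrib_left by (rule sum.cong) (use d in \<open>simp_all add: mult.left_commute\<close>)
        then have "[:0, 1:] * (\<Sum>u\<in>U. M e u * d u) = 0" using less.prems(2) that by simp
        moreover have "[:0, 1:] \<noteq> (0 :: 'k poly)" by simp
        ultimately show ?thesis by (metis mult_eq_0_iff)
      qed
      ultimately show ?thesis using less.hyps[of d] d1 by blast
    qed
  qed
qed

lemma finite_Lam: "finite {\<mu> \<in> Lam n. odd_size n \<mu> \<le> d}"
proof -
  have "\<mu> i \<le> d" if "\<mu> \<in> Lam n" "odd_size n \<mu> \<le> d" "i \<in> {1..n}" for \<mu> i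
  proof -
    have "\<mu> i \<le> \<mu> 1" using Lam_antimono[OF that(1), of 1 i] that(3) by simp
    also have "\<dots> \<le> odd_size n \<mu>"
      unfolding odd_size_def by (rule member_le_sum) (use that(3) in auto)
    finally show ?thesis using that(2) by simp
  qed
  then have "{\<mu> \<in> Lam n. odd_size n \<mu> \<le> d} \<subseteq>
      {f. \<forall>x. (x \<in> {1..n} \<longrightarrow> f x \<in> {..d}) \<and> (x \<notin> {1..n} \<longrightarrow> f x = 0)}"
    by (auto simp: Lam_def)
  then show ?thesis
    by (rule finite_subset) (rule finite_set_of_finite_funs, auto)
qed

section \<open>Specialisation of the parameter\<close>

text \<open>
  Coefficients are polynomials in \<open>\<epsilon>\<close>, and \<open>\<epsilon>\<close> is set to zero.
\<close>

definition spec :: "'k::comm_ring_1 poly mpol \<Rightarrow> 'k mpol"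
  where "spec = hsubst (\<lambda>p. const (poly p 0)) zvar"

lemma const_poly_0_hom: "comm_ring_hom (\<lambda>p :: 'k::comm_ring_1 poly. const (poly p 0))"
  by standard (auto simp: const.hom_add const.hom_mult)

lemma spec_hom: "comm_ring_hom (spec :: 'k::comm_ring_1 poly mpol \<Rightarrow> 'k mpol)"
  unfolding spec_def by (rule hsubst_hom[OF const_poly_0_hom])

interpretation spec: comm_ring_hom "spec :: 'k::comm_ring_1 poly mpol \<Rightarrow> 'k mpol"
  by (rule spec_hom)

lemma spec_const [simp]: "spec (const p) = const (poly p 0)"
  by (simp add: spec_def const_poly_0_hom)

lemma spec_zvar [simp]: "spec (zvar i) = zvar i"
  by (simp add: spec_def const_poly_0_hom)

lemma spec_pdiff: "spec (pdiff i f) = pdiff i (spec f)"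
  by (induction f rule: mpol_induct)
    (simp_all add: pdiff_zvar pdiff_add pdiff_mult spec.hom_add spec.hom_mult)

lemma spec_deg_in:
  assumes "deg_in D f"
  shows "deg_in D (spec f)"
  unfolding spec_def hsubst_def
proof (rule deg_in_sum)
  fix m assume "m \<in> keys f"
  then show "deg_in D (const (poly (lookup f m) 0) * mon_val zvar m)"
    using assms by (auto simp: deg_in_def simp flip: single_eq split: if_splits)
qed

lemma spec_lead: "lead d f g \<Longrightarrow> lead d (spec f) (spec g)"
  unfolding lead_def spec.hom_minus[symmetric] by (blast intro: spec_deg_in)

lemma spec_hom_component:
  assumes "deg_in {..int d} f"
  shows "spec (hom_component d f) = hom_component d (spec f)"
  by (rule lead_unique[OF spec_lead[OF lead_hom_component[OF assms]] lead_hom_component[OF spec_deg_in[OF assms]]])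

lemma spec_subst_vars: "spec (subst (\<lambda>k. zvar (g k)) f) = subst (\<lambda>k. zvar (g k)) (spec f)"
  by (induction f rule: mpol_induct)
    (simp_all add: spec.hom_add spec.hom_mult subst.hom_add subst.hom_mult const_hom)

lemma spec_polys:
  assumes "f \<in> polys n"
  shows "spec f \<in> polys n"
  unfolding spec_def hsubst_def mon_val_def
proof (intro polys_sum polys_mult polys_prod polys_power polys_const)
  fix m i assume "m \<in> keys f" "i \<in> keys m"
  then have "i \<in> {1..n}" using assms unfolding polys_def by blast
  then show "zvar i \<in> polys n" by (rule polys_zvar)
qed

lemma spec_semisym: "semisym n f \<Longrightarrow> semisym n (spec f)"
  by (auto simp: semisym_def spec_polys simp flip: spec_subst_vars)

lemma eval_at_spec:
  assumes "\<And>i. poly (a i) 0 = b i"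
  shows "eval_at b (spec f) = poly (eval_at a f) 0"
  by (induction f rule: mpol_induct)
    (simp_all add: assms spec.hom_add spec.hom_mult eval_at.hom_add eval_at.hom_mult)

lemma spec_sym_op:
  "spec (sym_op c e c' e' v G) = sym_op (poly c 0) e (poly c' 0) e' v (spec G)"
  by (simp add: sym_op_def spec.hom_add spec.hom_mult spec.hom_power spec_pdiff)

lemma spec_sym_det:
  assumes "\<And>p q G. spec (S p q G) = S' p q (spec G)"
  shows "spec (sym_det n S G) = sym_det n S' (spec G)"
proof -
  have "spec (foldr (\<lambda>p. S p (\<pi> p)) ps G) = foldr (\<lambda>p. S' p (\<pi> p)) ps (spec G)" for \<pi> ps
    by (induction ps) (simp_all add: assms)
  then show ?thesis
    by (simp add: sym_det_def spec.hom_sum spec.hom_mult spec.hom_of_int del: upt_Suc)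
qed

lemma spec_xsym: "spec (xsym n r t p q G) = xsym n (poly r 0) (poly t 0) p q (spec G)"
  by (simp add: xsym_def Let_def spec_sym_op)

lemma spec_ysym: "spec (ysym n r t p q G) = ysym n (poly r 0) (poly t 0) p q (spec G)"
  by (simp add: ysym_def Let_def spec_sym_op)

lemma spec_orbit_sum: "spec (orbit_sum n l) = orbit_sum n l"
  by (simp add: orbit_sum_def mon_val_def spec.hom_sum spec.hom_prod spec.hom_power)

text \<open>
  The unknowns are the coefficients of the orbit sums of the tuples of odd size at most that of \<open>l\<close>; the
  equations are the values at the nodes of these tuples other than \<open>l\<close>. The orbit sums are linearly
  independent, so a primitive solution stays nonzero at \<open>\<epsilon> = 0\<close>.
\<close>

lemma vanishing_family:
  fixes r :: "'k::field_char_0"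
  assumes l: "l \<in> Lam n"
  obtains F :: "'k poly mpol" where "semisym n F" "deg_in {..int (odd_size n l)} F" "spec F \<noteq> 0"
    "\<And>\<mu>. \<mu> \<in> Lam n \<Longrightarrow> odd_size n \<mu> \<le> odd_size n l \<Longrightarrow> \<mu> \<noteq> l \<Longrightarrow>
      eval_at (\<lambda>i. rho n [:r, 1:] i + of_nat (\<mu> i)) F = 0"
proof -
  define U where "U = {\<mu> \<in> Lam n. odd_size n \<mu> \<le> odd_size n l}"
  define z where "z \<mu> = (\<lambda>i. rho n [:r, 1:] i + of_nat (\<mu> i))" for \<mu>
  have U: "finite U" "l \<in> U" using finite_Lam l by (auto simp: U_def)
  obtain c u where c: "u \<in> U" "poly (c u) 0 \<noteq> 0"
      "\<forall>\<mu>\<in>U - {l}. (\<Sum>\<nu>\<in>U. eval_at (z \<mu>) (orbit_sum n \<nu>) * c \<nu>) = 0"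
    using primitive_solution[OF U, of "\<lambda>\<mu> \<nu>. eval_at (z \<mu>) (orbit_sum n \<nu>)"] by blast
  define F where "F = (\<Sum>\<nu>\<in>U. const (c \<nu>) * orbit_sum n \<nu>)"
  show ?thesis
  proof (rule that[of F])
    show "semisym n F" unfolding F_def by (intro semisym_sum semisym_const_mult orbit_sum_semisym)
    show "deg_in {..int (odd_size n l)} F"
      unfolding F_def
    proof (intro deg_in_sum deg_in_const_mult)
      fix \<nu> assume "\<nu> \<in> U"
      then show "deg_in {..int (odd_size n l)} (orbit_sum n \<nu> :: 'k poly mpol)"
        by (intro deg_in_mono[OF orbit_sum_deg]) (auto simp: U_def)
    qed
    have "lookup (spec F) (gap_mon n u) =
        (\<Sum>\<nu>\<in>U. poly (c \<nu>) 0 * lookup (orbit_sum n \<nu> :: 'k mpol) (gap_mon n u))"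
    proof -
      have "lookup (const a * f) m = a * lookup f m" for a :: 'k and f m
        unfolding const_def mult_map_scale_conv_mult[symmetric]
        by (simp add: map.rep_eq when_def)
      then show ?thesis by (simp add: F_def spec.hom_sum spec.hom_mult spec_orbit_sum lookup_sum)
    qed
    also have "\<dots> = (\<Sum>\<nu>\<in>U. if \<nu> = u then poly (c u) 0 * lookup (orbit_sum n u :: 'k mpol) (gap_mon n u) else 0)"
      by (rule sum.cong) (use c(1) in \<open>auto simp: U_def lookup_orbit_sum_other\<close>)
    also have "\<dots> = poly (c u) 0 * lookup (orbit_sum n u :: 'k mpol) (gap_mon n u)"
      using U(1) c(1) by simp
    finally have "lookup (spec F) (gap_mon n u) \<noteq> 0"
      using c(2) lookup_orbit_sum_self[of n u, where 'a = 'k] by simp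
    then show "spec F \<noteq> 0" by auto
    fix \<mu> assume "\<mu> \<in> Lam n" "odd_size n \<mu> \<le> odd_size n l" "\<mu> \<noteq> l"
    then have "\<mu> \<in> U - {l}" by (simp add: U_def)
    with c(3) have "(\<Sum>\<nu>\<in>U. eval_at (z \<mu>) (orbit_sum n \<nu>) * c \<nu>) = 0" by blast
    then show "eval_at (\<lambda>i. rho n [:r, 1:] i + of_nat (\<mu> i)) F = 0"
      by (simp add: F_def eval_at.hom_sum eval_at.hom_mult z_def mult.commute)
  qed
qed

section \<open>The eigenvector property at a value of t\<close>

lemma sym_op_const_mult: "sym_op c e c' e' v (const k * G) = const k * sym_op c e c' e' v G"
  unfolding sym_op_def pdiff_const_mult by (simp only: algebra_simps)

lemma sym_det_const_mult:
  assumes "\<And>p q G. S p q (const k * G) = const k * S p q G"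
  shows "sym_det n S (const k * G) = const k * sym_det n S G"
proof -
  have "foldr (\<lambda>p. S p (\<pi> p)) ps (const k * G) = const k * foldr (\<lambda>p. S p (\<pi> p)) ps G" for \<pi> ps
    by (induction ps) (simp_all add: assms)
  then show ?thesis
    by (simp add: sym_det_def sum_distrib_left mult.left_commute del: upt_Suc)
qed

text \<open>
  A suitable linear combination of \<open>R\<close> and \<open>F\<close> vanishes at the node of \<open>l\<close> too, hence is zero.
\<close>

lemma is_R_proportional:
  fixes r :: "'k::field_char_0"
  assumes r: "\<not> (\<exists>q::rat. q < 0 \<and> r = of_rat q)" and l: "l \<in> Lam n" and R: "is_R n r l R"
    and F: "semisym n F" "deg_in {..int (odd_size n l)} F" "F \<noteq> 0"
    and zero: "\<And>\<mu>. \<mu> \<in> Lam n \<Longrightarrow> odd_size n \<mu> \<le> odd_size n l \<Longrightarrow> \<mu> \<noteq> l \<Longrightarrow>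
      eval_at (\<lambda>i. rho n r i + of_nat (\<mu> i)) F = 0"
  shows "R \<noteq> 0 \<and> (\<exists>u v. u \<noteq> 0 \<and> const u * R = const v * F)"
proof
  let ?e = "\<lambda>\<mu>. eval_at (\<lambda>i. rho n r i + of_nat (\<mu> i))"
  have nz: "of_nat j * r + of_nat m \<noteq> 0" if "1 \<le> m" for j m :: nat
  proof
    assume eq: "of_nat j * r + of_nat m = 0"
    have j: "j \<noteq> 0" using eq that by (cases "j = 0") auto
    then have "r = - (of_nat m / of_nat j)" using eq by (simp add: field_simps eq_neg_iff_add_eq_0)
    also have "\<dots> = of_rat (- (of_nat m / of_nat j))" by (simp add: of_rat_minus of_rat_divide)
    finally have "r = of_rat (- (of_nat m / of_nat j))" .
    moreover have "- (of_nat m / of_nat j) < (0::rat)" using j that by simp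
    ultimately show False using r by blast
  qed
  have RD: "R \<in> invariants n" "total_degree R = odd_size n l"
      "\<And>\<mu>. \<mu> \<in> Lam n \<Longrightarrow> odd_size n \<mu> \<le> odd_size n l \<Longrightarrow> \<mu> \<noteq> l \<Longrightarrow> ?e \<mu> R = 0"
      "lookup R (bracket_mon n l) = 1"
    using R by (auto simp: is_R_def)
  show R0: "R \<noteq> 0" using RD(4) by auto
  have Rd: "deg_in {..int (odd_size n l)} R" using deg_in_total_degree[of R] RD(2) by simp
  have uniq: "f = 0" if "semisym n f" "deg_in {..int (odd_size n l)} f"
    "\<And>\<mu>. \<mu> \<in> Lam n \<Longrightarrow> odd_size n \<mu> \<le> odd_size n l \<Longrightarrow> ?e \<mu> f = 0" for f
    using semisym_eq_0[where c = 0 and r = r, OF nz that(1,2)] that(3) by simp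
  have "?e l F \<noteq> 0" using uniq[OF F(1,2)] zero F(3) by metis
  moreover have "const (?e l F) * R - const (?e l R) * F = 0"
  proof (rule uniq)
    show "semisym n (const (?e l F) * R - const (?e l R) * F)"
      by (intro semisym_diff semisym_const_mult invariants_semisym RD F)
    show "deg_in {..int (odd_size n l)} (const (?e l F) * R - const (?e l R) * F)"
      by (intro deg_in_diff deg_in_const_mult Rd F)
    fix \<mu> assume "\<mu> \<in> Lam n" "odd_size n \<mu> \<le> odd_size n l"
    then show "?e \<mu> (const (?e l F) * R - const (?e l R) * F) = 0"
      using zero[of \<mu>] RD(3)[of \<mu>] by (cases "\<mu> = l") (auto simp: eval_at.hom_minus eval_at.hom_mult)
  qed
  ultimately show "\<exists>u v. u \<noteq> 0 \<and> const u * R = const v * F" by auto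
qed

text \<open>
  The statement holds over \<open>k[\<epsilon>]\<close> for the family \<open>F\<close>, where \<open>j (r + \<epsilon>) + m\<close> is never zero for \<open>j \<ge> 1\<close>.
  It is specialised to \<open>\<epsilon> = 0\<close> and transferred to \<open>R\<close> by proportionality.
\<close>

theorem sym_det_top_component:
  fixes r :: "'k::field_char_0"
  assumes r: "\<not> (\<exists>q::rat. q < 0 \<and> r = of_rat q)" and l: "l \<in> Lam n" and R: "is_R n r l R"
  shows "top_component R \<noteq> 0"
    and "sym_det n (xsym n r t) (top_component R) =
      vdm n zvar * (const (\<Prod>i\<in>{i\<in>{1..n}. odd i}. t + (rho n r i + of_nat (l i))) * top_component R)"
    and "sym_det n (ysym n r t) (top_component R) =
      vdm n zvar * (const (\<Prod>i\<in>{i\<in>{1..n}. even i}. t + (rho n r i + of_nat (l i))) * top_component R)"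
proof -
  let ?d = "odd_size n l"
  obtain F :: "'k poly mpol" where F: "semisym n F" "deg_in {..int ?d} F" "spec F \<noteq> 0"
    "\<And>\<mu>. \<mu> \<in> Lam n \<Longrightarrow> odd_size n \<mu> \<le> ?d \<Longrightarrow> \<mu> \<noteq> l \<Longrightarrow>
      eval_at (\<lambda>i. rho n [:r, 1:] i + of_nat (\<mu> i)) F = 0"
    by (rule vanishing_family[OF l, where r = r]) (rule that; blast)
  have rho0: "poly (rho n [:r, 1:] i) 0 = rho n r i" for i by (simp add: rho_def)
  have "eval_at (\<lambda>i. rho n r i + of_nat (\<mu> i)) (spec F) =
      poly (eval_at (\<lambda>i. rho n [:r, 1:] i + of_nat (\<mu> i)) F) 0" for \<mu>
    by (rule eval_at_spec) (simp add: rho0)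
  then have "eval_at (\<lambda>i. rho n r i + of_nat (\<mu> i)) (spec F) = 0"
    if "\<mu> \<in> Lam n" "odd_size n \<mu> \<le> ?d" "\<mu> \<noteq> l" for \<mu>
    using F(4)[OF that] by simp
  from is_R_proportional[OF r l R spec_semisym[OF F(1)] spec_deg_in[OF F(2)] F(3) this]
  obtain u v where R0: "R \<noteq> 0" and uv: "u \<noteq> 0" "const u * R = const v * spec F" by blast
  show "top_component R \<noteq> 0" by (rule top_component_nonzero[OF R0])
  let ?H = "hom_component ?d (spec F)"
  have td: "total_degree R = ?d" using R by (simp add: is_R_def)
  have top: "const u * top_component R = const v * ?H"
  proof (rule lead_unique)
    show "lead (int ?d) (const u * R) (const u * top_component R)"
      using lead_const_mult[OF lead_top_component] td by metis
    show "lead (int ?d) (const u * R) (const v * ?H)"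
      unfolding uv(2) by (intro lead_const_mult lead_hom_component spec_deg_in F(2))
  qed
  have nz: "of_nat j * [:r, 1:] + of_nat m \<noteq> 0" if "1 \<le> j \<or> 1 \<le> m" for j m :: nat
  proof
    assume "of_nat j * [:r, 1:] + of_nat m = (0 :: 'k poly)"
    then have "coeff (of_nat j * [:r, 1:] + of_nat m :: 'k poly) 1 = 0"
      "coeff (of_nat j * [:r, 1:] + of_nat m :: 'k poly) 0 = 0" by simp_all
    then have "j = 0" "m = 0" by (auto simp: of_nat_poly)
    then show False using that by simp
  qed
  have transfer: "sym_det n S (top_component R) = vdm n zvar * (const E * top_component R)"
    if S: "\<And>p q k G. S p q (const k * G) = const k * S p q G"
      and H: "sym_det n S ?H = vdm n zvar * (const E * ?H)" for S :: "nat \<Rightarrow> nat \<Rightarrow> 'k mpol \<Rightarrow> 'k mpol" and E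
  proof -
    have "const u * sym_det n S (top_component R) = sym_det n S (const v * ?H)"
      by (simp only: sym_det_const_mult[of S, OF S, symmetric] top)
    also have "\<dots> = const v * (vdm n zvar * (const E * ?H))"
      by (simp only: sym_det_const_mult[of S, OF S] H)
    also have "\<dots> = vdm n zvar * (const E * (const v * ?H))" by (simp add: mult_ac)
    also have "\<dots> = const u * (vdm n zvar * (const E * top_component R))"
      unfolding top[symmetric] by (simp add: mult_ac)
    finally show ?thesis using uv(1) by simp
  qed
  have eig: "sym_det n (xsym n [:r, 1:] [:t:]) (hom_component ?d F) = vdm n zvar *
      (const (\<Prod>i\<in>{i\<in>{1..n}. odd i}. [:t:] + (rho n [:r, 1:] i + of_nat (l i))) * hom_component ?d F)"
    "sym_det n (ysym n [:r, 1:] [:t:]) (hom_component ?d F) = vdm n zvar *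
      (const (\<Prod>i\<in>{i\<in>{1..n}. even i}. [:t:] + (rho n [:r, 1:] i + of_nat (l i))) * hom_component ?d F)"
    by (rule sym_det_eigen[OF nz l F(1,2)], assumption, rule F(4), assumption+)+
  have vd: "spec (vdm n zvar) = vdm n zvar" by (simp add: vdm_hom[OF spec_hom])
  have E: "poly (\<Prod>i\<in>A. [:t:] + (rho n [:r, 1:] i + of_nat (l i))) 0 = (\<Prod>i\<in>A. t + (rho n r i + of_nat (l i)))"
    for A by (simp add: poly_prod rho0)
  show "sym_det n (xsym n r t) (top_component R) =
      vdm n zvar * (const (\<Prod>i\<in>{i\<in>{1..n}. odd i}. t + (rho n r i + of_nat (l i))) * top_component R)"
  proof (rule transfer)
    show "xsym n r t p q (const k * G) = const k * xsym n r t p q G" for p q k G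
      by (simp add: xsym_def Let_def sym_op_const_mult)
    have "spec (sym_det n (xsym n [:r, 1:] [:t:]) (hom_component ?d F)) = sym_det n (xsym n r t) ?H"
      using spec_sym_det[of "xsym n [:r, 1:] [:t:]" "xsym n r t" n "hom_component ?d F"]
      by (simp add: spec_xsym spec_hom_component[OF F(2)])
    then show "sym_det n (xsym n r t) ?H =
        vdm n zvar * (const (\<Prod>i\<in>{i\<in>{1..n}. odd i}. t + (rho n r i + of_nat (l i))) * ?H)"
      unfolding eig(1) by (simp only: spec.hom_mult spec_const vd E spec_hom_component[OF F(2)])
  qed
  show "sym_det n (ysym n r t) (top_component R) =
      vdm n zvar * (const (\<Prod>i\<in>{i\<in>{1..n}. even i}. t + (rho n r i + of_nat (l i))) * top_component R)"
  proof (rule transfer)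
    show "ysym n r t p q (const k * G) = const k * ysym n r t p q G" for p q k G
      by (simp add: ysym_def Let_def sym_op_const_mult)
    have "spec (sym_det n (ysym n [:r, 1:] [:t:]) (hom_component ?d F)) = sym_det n (ysym n r t) ?H"
      using spec_sym_det[of "ysym n [:r, 1:] [:t:]" "ysym n r t" n "hom_component ?d F"]
      by (simp add: spec_ysym spec_hom_component[OF F(2)])
    then show "sym_det n (ysym n r t) ?H =
        vdm n zvar * (const (\<Prod>i\<in>{i\<in>{1..n}. even i}. t + (rho n r i + of_nat (l i))) * ?H)"
      unfolding eig(2) by (simp only: spec.hom_mult spec_const vd E spec_hom_component[OF F(2)])
  qed
qed

section \<open>The indeterminate t\<close>

lemma poly_diff_op: "poly (diff_op i F) (const c) = pdiff i (poly F (const c))"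
  unfolding diff_op_def
proof (induction F)
  case (pCons a F)
  then show ?case by (simp add: map_poly_pCons pdiff_add)
qed simp

lemma poly_X_mat:
  assumes "p \<in> {1..n}" "q \<in> {1..n}"
  shows "poly (X_mat n r p q F) (const c) = xsym n r c p q (poly F (const c))"
  by (auto simp: X_mat_def xsym_def Let_def block_mat_def row_var_def euler_op_def shifted_op_def
      mult_op_def t_op_def sym_op_def poly_diff_op const.hom_add const.hom_uminus distrib_left distrib_right mult_ac add_ac
      simp del: of_nat_diff)

lemma poly_Y_mat:
  assumes "p \<in> {1..n}" "q \<in> {1..n}"
  shows "poly (Y_mat n r p q F) (const c) = ysym n r c p q (poly F (const c))"
  by (auto simp: Y_mat_def ysym_def Let_def block_mat_def row_var_def euler_op_def shifted_op_def
      mult_op_def t_op_def sym_op_def poly_diff_op const.hom_add const.hom_uminus distrib_left distrib_right mult_ac add_ac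
      simp del: of_nat_diff)

lemma poly_det_op:
  assumes M: "\<And>p q F. p \<in> {1..n} \<Longrightarrow> q \<in> {1..n} \<Longrightarrow> poly (M p q F) (const c) = S p q (poly F (const c))"
  shows "poly (det_op n M F) (const c) = sym_det n S (poly F (const c))"
proof -
  have "poly (foldr (\<lambda>p. M p (\<pi> p)) ps F) (const c) = foldr (\<lambda>p. S p (\<pi> p)) ps (poly F (const c))"
    if "\<pi> permutes {1..n}" "set ps \<subseteq> {1..n}" for \<pi> ps
    using that(2)
  proof (induction ps)
    case (Cons p ps)
    then have "p \<in> {1..n}" "\<pi> p \<in> {1..n}" using permutes_in_image[OF that(1)] by auto
    then show ?case using Cons by (simp add: M)
  qed simp
  moreover have "set [1..<Suc n] \<subseteq> {1..n}" by auto
  moreover have "poly (of_int k) x = of_int k" for k and x :: "'a mpol"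
    by (cases k rule: int_cases2) simp_all
  ultimately show ?thesis
    unfolding det_op_def sym_det_def poly_sum by (intro sum.cong) (auto simp del: upt_Suc)
qed

text \<open>
  The indeterminate \<open>t\<close> may be replaced by all constants, since there are infinitely many of them.
\<close>

lemma poly_eq_on_constants:
  fixes p q :: "'k::{idom,ring_char_0} mpol poly"
  assumes "\<And>c. poly p (const c) = poly q (const c)"
  shows "p = q"
proof (rule ccontr)
  assume "p \<noteq> q"
  then have "finite {x. poly (p - q) x = 0}" by (intro poly_roots_finite) simp
  moreover have "range const \<subseteq> {x. poly (p - q) x = 0}" using assms by auto
  ultimately have "finite (range (const :: 'k \<Rightarrow> 'k mpol))" by (rule finite_subset[rotated])
  then have "finite (UNIV :: 'k set)" by (rule finite_imageD) (simp add: inj_on_def)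
  then show False by (simp add: infinite_UNIV_char_0)
qed

lemma det_op_eigen:
  fixes G :: "'k::{idom,ring_char_0} mpol"
  assumes "\<And>t. poly (det_op n M [:G:]) (const t) = vdm n zvar * (const (\<Prod>i\<in>A. t + e i) * G)"
  shows "det_op n M [:G:] = [:vdm n zvar:] * ((\<Prod>i\<in>A. [:const (e i), 1:]) * [:G:])"
proof (rule poly_eq_on_constants)
  fix t
  show "poly (det_op n M [:G:]) (const t) =
      poly ([:vdm n zvar:] * ((\<Prod>i\<in>A. [:const (e i), 1:]) * [:G:])) (const t)"
    unfolding assms by (simp add: poly_prod const.hom_prod const.hom_add add.commute)
qed

lemma to_frac_hom: "comm_ring_hom (to_frac :: 'k::field mpol \<Rightarrow> 'k mpol fract)"
  by standard (auto simp: to_frac_def Zero_fract_def One_fract_def)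

lemma map_poly_hom:
  assumes "comm_ring_hom h"
  shows "comm_ring_hom (map_poly h)"
proof -
  interpret comm_ring_hom h by fact
  show ?thesis
  proof
    show "map_poly h (p + q) = map_poly h p + map_poly h q" for p q
      by (rule poly_eqI) (simp add: coeff_map_poly hom_add)
    show "map_poly h (p * q) = map_poly h p * map_poly h q" for p q
      by (rule poly_eqI) (simp add: coeff_map_poly coeff_mult hom_sum hom_mult)
  qed (simp_all add: map_poly_pCons one_pCons)
qed

lemma divide_vandermonde:
  fixes G :: "'k::field mpol"
  shows "Polynomial.smult (inverse (to_frac (vandermonde n)))
      (map_poly to_frac ([:vdm n zvar:] * ((\<Prod>i\<in>A. [:const (e i), 1:]) * [:G:]))) =
    (\<Prod>i\<in>A. [:to_frac (const (e i)), 1:]) * [:to_frac G:]"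
proof -
  interpret tf: comm_ring_hom "to_frac :: 'k mpol \<Rightarrow> 'k mpol fract" by (rule to_frac_hom)
  interpret mp: comm_ring_hom "map_poly (to_frac :: 'k mpol \<Rightarrow> 'k mpol fract)"
    by (rule map_poly_hom[OF to_frac_hom])
  have "to_frac (vdm n zvar) \<noteq> (0 :: 'k mpol fract)"
    using vdm_zvar_nonzero[of n, where 'a = 'k] by (simp add: to_frac_def Zero_fract_def eq_fract)
  then have cancel: "inverse (to_frac (vdm n zvar)) * (to_frac G * to_frac (vdm n zvar)) = to_frac G"
    by (simp add: field_simps)
  show ?thesis
    unfolding vandermonde_eq mp.hom_mult mp.hom_prod
    by (simp add: map_poly_pCons, simp only: cancel)
qed

theorem theorem5p1:
  fixes r :: "'k::field_char_0" and n :: nat and l :: "nat \<Rightarrow> nat" and R :: "'k mpol"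
  assumes "n \<ge> 1"
    and "\<not> (\<exists>q::rat. q < 0 \<and> r = of_rat q)"
    and "l \<in> Lam n"
    and "is_R n r l R"
  shows "top_component R \<noteq> 0
    \<and> X_op n r [:top_component R:] =
        (\<Prod>i \<in> {i \<in> {1..n}. odd i}. [:to_frac (const (rho n r i + of_nat (l i))), 1:])
          * [:to_frac (top_component R):]
    \<and> Y_op n r [:top_component R:] =
        (\<Prod>i \<in> {i \<in> {1..n}. even i}. [:to_frac (const (rho n r i + of_nat (l i))), 1:])
          * [:to_frac (top_component R):]"
proof (intro conjI)
  note top = sym_det_top_component[OF assms(2-4)]
  show "top_component R \<noteq> 0" by (rule top(1))
  have "det_op n (X_mat n r) [:top_component R:] = [:vdm n zvar:] *
      ((\<Prod>i\<in>{i\<in>{1..n}. odd i}. [:const (rho n r i + of_nat (l i)), 1:]) * [:top_component R:])"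
  proof (rule det_op_eigen)
    fix t
    show "poly (det_op n (X_mat n r) [:top_component R:]) (const t) =
        vdm n zvar * (const (\<Prod>i\<in>{i\<in>{1..n}. odd i}. t + (rho n r i + of_nat (l i))) * top_component R)"
      using poly_det_op[of n "X_mat n r" t "xsym n r t" "[:top_component R:]", OF poly_X_mat] top(2)[of t]
      by simp
  qed
  then show "X_op n r [:top_component R:] =
        (\<Prod>i \<in> {i \<in> {1..n}. odd i}. [:to_frac (const (rho n r i + of_nat (l i))), 1:])
          * [:to_frac (top_component R):]"
    unfolding X_op_def by (simp only: divide_vandermonde)
  have "det_op n (Y_mat n r) [:top_component R:] = [:vdm n zvar:] *
      ((\<Prod>i\<in>{i\<in>{1..n}. even i}. [:const (rho n r i + of_nat (l i)), 1:]) * [:top_component R:])"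
  proof (rule det_op_eigen)
    fix t
    show "poly (det_op n (Y_mat n r) [:top_component R:]) (const t) =
        vdm n zvar * (const (\<Prod>i\<in>{i\<in>{1..n}. even i}. t + (rho n r i + of_nat (l i))) * top_component R)"
      using poly_det_op[of n "Y_mat n r" t "ysym n r t" "[:top_component R:]", OF poly_Y_mat] top(3)[of t]
      by simp
  qed
  then show "Y_op n r [:top_component R:] =
        (\<Prod>i \<in> {i \<in> {1..n}. even i}. [:to_frac (const (rho n r i + of_nat (l i))), 1:])
          * [:to_frac (top_component R):]"
    unfolding Y_op_def by (simp only: divide_vandermonde)
qed

end
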